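(* Let $d\ge 2$, let $\mathbb{Q}=2\sigma_{d-1}$ be the uniform probability measure on the unit hemisphere $\mathbb{S}^{d-1}_+$, and let $K=B_d(o,1)$. For $x\in[0,1]^{d-1}\times(0,1]$ define $$\varphi_d(x)=\int_{[0,1]^{d-1}}\frac{1}{\|(y,0)-x\|^{d-1}}\,dy .$$ Then, as $\rho\to\infty$, $$\frac{R_\rho(B_d(o,1))}{(\log\rho/\rho)^{1/(d-1)}}\ \longrightarrow\ \left(\frac{d^2}{d-1}\cdot\frac{\kappa_d}{2\kappa_{d-1}}\cdot\frac{1}{\inf_{x\in[0,1]^d}\varphi_d(x)}\right)^{1/(d-1)}\quad\text{in probability,}$$ where $R_\rho$ is the coverage radius of the cylinder model with directional distribution $\mathbb{Q}$.
   Context: Notation: $B_n(x,r)$ is the closed Euclidean ball in $\mathbb{R}^n$ with centre $x$ and radius $r$; $o$ is the origin; $\kappa_n$ is the volume of the $n$-dimensional unit ball; $\mathbb{S}^{d-1}_+=\{s\in\mathbb{R}^d:\ s_1^2+\dots+s_d^2=1,\ s_d\ge 0\}$; $\sigma_{d-1}$ is the spherical measure on $\mathbb{S}^{d-1}$ normalised by $\sigma_{d-1}(\mathbb{S}^{d-1})=1$; $\oplus$ is Minkowski sum; $rK=\{rx:x\in K\}$. In the infimum of $\varphi_d$ over $[0,1]^d$, points with last coordinate $0$ are given the value $+\infty$ (the integral diverges there), i.e. the infimum is over $[0,1]^{d-1}\times(0,1]$. Cylinder model: for $\rho>0$ let $\eta_\rho=\{Y^{(1,\rho)},Y^{(2,\rho)},\dots\}$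 be a homogeneous Poisson point process on $\mathbb{R}^{d-1}$ with intensity measure $\rho$ times Lebesgue measure. Let $\xi_\rho=\eta_\rho([0,1]^{d-1})$ and index the points so that $Y^{(1,\rho)},\dots,Y^{(\xi_\rho,\rho)}$ are those in $[0,1]^{d-1}$. Let $S^{(i,\rho)}$, $i\in\mathbb{N}$, be i.i.d. random vectors in $\mathbb{S}^{d-1}_+$ with law $\mathbb{Q}$ (not depending on $\rho$), independent of $\eta_\rho$. Put $X^{(i,\rho)}=\{(Y^{(i,\rho)},0)+tS^{(i,\rho)}:\ t\ge 0\}\subset\mathbb{R}^d$ and, for $K\subset\mathbb{R}^d$, $\mathcal{X}_\rho(K)=\bigcup_{i=1}^{\xi_\rho}\big(X^{(i,\rho)}\oplus K\big)$. The coverage radius is $R_\rho(K)=\inf\{r\ge 0:\ \mathcal{X}_\rho(rK)\supset[0,1]^d\}$, with $\inf\emptyset=\infty$. *)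

theory Defs
  imports "HOL-Probability.Probability"
begin

text \<open>
  For a Euclidean space \<open>'a\<close> of dimension \<open>d - 1\<close>, the space \<open>\<real>\<^sup>d\<close> is modelled by \<open>'a \<times> real\<close>, whose
  norm is the Euclidean one; \<open>snd\<close> is the last coordinate. Enumerations start at 0 instead of 1.
\<close>

definition unit_cube :: "'a::euclidean_space set" where
  "unit_cube = cbox 0 One"


subsection \<open>The spherical measure\<close>

text \<open>
  The normalised spherical measure is the normalised cone measure: the radial projection of the
  uniform distribution on the unit ball. The origin, where \<open>sgn\<close> vanishes, has measure 0.
\<close>

definition sphere_measure :: "'a::euclidean_space measure" where
  "sphere_measure = distr (uniform_measure lborel (cball 0 1)) borel sgn"

lemma borel_measurable_sgn_euclidean [measurable]:
  "(sgn :: 'a::euclidean_space \<Rightarrow> 'a) \<in> borel_measurable borel"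
proof -
  have "(\<lambda>x::'a. inverse (norm x) *\<^sub>R x) \<in> borel_measurable borel"
    by measurable
  then show ?thesis
    by (simp add: sgn_div_norm[abs_def])
qed

lemma prob_space_sphere_measure: "prob_space (sphere_measure :: 'a::euclidean_space measure)"
proof -
  have "emeasure lborel (cball (0::'a) 1) \<noteq> 0"
    using unit_ball_vol_pos[of "real DIM('a)", OF of_nat_0_le_iff] by (simp add: emeasure_cball del: unit_ball_vol_pos)
  moreover have "emeasure lborel (cball (0::'a) 1) \<noteq> \<infinity>"
    using emeasure_lborel_cball_finite[of "0::'a" 1] by simp
  ultimately have "prob_space (uniform_measure lborel (cball (0::'a) 1))"
    by (intro prob_space_uniform_measure) auto
  then show ?thesis
    unfolding sphere_measure_def by (intro prob_space.prob_space_distr) simp_all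
qed

lemma emeasure_sphere_measure:
  fixes A :: "'a::euclidean_space set"
  assumes [measurable]: "A \<in> sets borel" and "A \<subseteq> sphere 0 1"
  shows "emeasure sphere_measure A =
    emeasure lborel {t *\<^sub>R s | t s. 0 < t \<and> t \<le> 1 \<and> s \<in> A} / emeasure lborel (cball (0::'a) 1)"
proof -
  have "cball 0 1 \<inter> sgn -` A = {t *\<^sub>R s | t s. 0 < t \<and> t \<le> 1 \<and> s \<in> A}" (is "?L = ?R")
  proof (intro equalityI subsetI)
    fix x assume x: "x \<in> ?L"
    then have "x \<noteq> 0" using \<open>A \<subseteq> sphere 0 1\<close> by (auto simp: sgn_div_norm)
    with x have "x = norm x *\<^sub>R sgn x" "0 < norm x" "norm x \<le> 1" "sgn x \<in> A"
      by (auto simp: sgn_div_norm)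
    then show "x \<in> ?R" by blast
  next
    fix x assume "x \<in> ?R"
    then obtain t s where x: "x = t *\<^sub>R s" "0 < t" "t \<le> 1" "s \<in> A" by blast
    with \<open>A \<subseteq> sphere 0 1\<close> have "norm s = 1" by auto
    with x show "x \<in> ?L" by (simp add: sgn_div_norm)
  qed
  moreover have "sgn -` A \<in> sets borel"
    using measurable_sets[OF borel_measurable_sgn_euclidean assms(1)] by simp
  ultimately show ?thesis
    by (simp add: sphere_measure_def emeasure_distr)
qed

definition hemisphere :: "('a::euclidean_space \<times> real) set" where
  "hemisphere = {s. norm s = 1 \<and> snd s \<ge> 0}"

definition uniform_hemisphere :: "('a::euclidean_space \<times> real) measure" where
  "uniform_hemisphere = density sphere_measure (\<lambda>s. 2 * indicator hemisphere s)"


subsection \<open>The cylinder model\<close>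

text \<open>
  A Poisson process given by an enumeration of its points (with multiplicity); the intensity
  \<open>\<Lambda>\<close> is meant to have infinite total mass, so that there are infinitely many points. The Poisson
  weights are written out because \<^const>\<open>poisson_pmf\<close> needs a positive rate, while
  \<open>\<Lambda> B = 0\<close> is allowed. Finiteness is stated separately because of \<open>card X = 0\<close> for infinite \<open>X\<close>.
\<close>

definition (in prob_space) poisson_process :: "'b measure \<Rightarrow> (nat \<Rightarrow> 'a \<Rightarrow> 'b) \<Rightarrow> bool" where
  "poisson_process \<Lambda> Y \<longleftrightarrow>
     (\<forall>i. random_variable \<Lambda> (Y i)) \<and>
     (\<forall>B\<in>sets \<Lambda>. emeasure \<Lambda> B < \<infinity> \<longrightarrow>
        (AE \<omega> in M. finite {i. Y i \<omega> \<in> B}) \<and>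
        (\<forall>k. prob {\<omega>\<in>space M. card {i. Y i \<omega> \<in> B} = k} =
               measure \<Lambda> B ^ k / fact k * exp (- measure \<Lambda> B))) \<and>
     (\<forall>n (B :: nat \<Rightarrow> 'b set).
        (\<forall>j<n. B j \<in> sets \<Lambda> \<and> emeasure \<Lambda> (B j) < \<infinity>) \<and> disjoint_family_on B {..<n} \<longrightarrow>
        indep_vars (\<lambda>_. count_space UNIV) (\<lambda>j \<omega>. card {i. Y i \<omega> \<in> B j}) {..<n})"

definition num_base_points :: "(nat \<Rightarrow> 'w \<Rightarrow> 'a::euclidean_space) \<Rightarrow> 'w \<Rightarrow> nat" where
  "num_base_points Y \<omega> = card {i. Y i \<omega> \<in> unit_cube}"

text \<open>
  The directions are independent of the whole enumeration of the points: independence of the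
  random set of points alone would allow an enumeration chosen in dependence on the directions.
\<close>

locale cylinder_model = prob_space M for M :: "'w measure" +
  fixes Q :: "('a::euclidean_space \<times> real) measure"
    and \<rho> :: real
    and Y :: "nat \<Rightarrow> 'w \<Rightarrow> 'a"
    and S :: "nat \<Rightarrow> 'w \<Rightarrow> 'a \<times> real"
  assumes poisson: "poisson_process (scale_measure (ennreal \<rho>) lborel) Y"
    and base_points_first: "AE \<omega> in M. {i. Y i \<omega> \<in> unit_cube} = {..<num_base_points Y \<omega>}"
    and direction_rv: "random_variable borel (S i)"
    and direction_law: "distr M borel (S i) = Q"
    and directions_indep: "indep_vars (\<lambda>_. borel) S UNIV"
    and points_directions_indep:
      "indep_set (sets (vimage_algebra (space M) (\<lambda>\<omega> i. Y i \<omega>) (\<Pi>\<^sub>M i\<in>UNIV. borel)))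
                 (sets (vimage_algebra (space M) (\<lambda>\<omega> i. S i \<omega>) (\<Pi>\<^sub>M i\<in>UNIV. borel)))"

definition ray :: "'a::euclidean_space \<Rightarrow> 'a \<times> real \<Rightarrow> ('a \<times> real) set" where
  "ray y s = {(y, 0) + t *\<^sub>R s | t. t \<ge> 0}"

text \<open>The sum of sets below is the Minkowski sum.\<close>

definition cylinders ::
  "(nat \<Rightarrow> 'w \<Rightarrow> 'a::euclidean_space) \<Rightarrow> (nat \<Rightarrow> 'w \<Rightarrow> 'a \<times> real) \<Rightarrow> ('a \<times> real) set \<Rightarrow> 'w \<Rightarrow> ('a \<times> real) set"
where
  "cylinders Y S K \<omega> = (\<Union>i<num_base_points Y \<omega>. ray (Y i \<omega>) (S i \<omega>) + K)"

definition coverage_radius ::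
  "(nat \<Rightarrow> 'w \<Rightarrow> 'a::euclidean_space) \<Rightarrow> (nat \<Rightarrow> 'w \<Rightarrow> 'a \<times> real) \<Rightarrow> ('a \<times> real) set \<Rightarrow> 'w \<Rightarrow> ereal"
where
  "coverage_radius Y S K \<omega> = Inf {ereal r | r. r \<ge> 0 \<and> unit_cube \<subseteq> cylinders Y S ((*\<^sub>R) r ` K) \<omega>}"


subsection \<open>The limit constant\<close>

definition phi :: "'a::euclidean_space \<times> real \<Rightarrow> real" where
  "phi x = (LINT y:unit_cube|lborel. 1 / norm ((y, 0) - x) ^ DIM('a))"


subsection \<open>Convergence in probability\<close>

text \<open>
  For extended real variables and a finite constant limit. Measurability is part of the
  notion, since \<^const>\<open>measure\<close> is 0 on non-measurable sets.
\<close>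

definition (in prob_space) tendsto_in_prob :: "('i \<Rightarrow> 'a \<Rightarrow> ereal) \<Rightarrow> real \<Rightarrow> 'i filter \<Rightarrow> bool" where
  "tendsto_in_prob X c F \<longleftrightarrow>
     (\<forall>\<^sub>F i in F. random_variable borel (X i)) \<and>
     (\<forall>\<epsilon>>0. ((\<lambda>i. prob {\<omega>\<in>space M. \<bar>X i \<omega> - ereal c\<bar> > ereal \<epsilon>}) \<longlongrightarrow> 0) F)"

end

theory Submission
  imports Defs
begin

text \<open>
  Write \<open>n\<close> for the dimension of the base space, so that \<open>d = n + 1\<close>. A point \<open>x\<close> is left uncovered
  at radius \<open>r\<close> if and only if no point of the marked process \<open>(Y i, S i)\<close> lies in the set
  \<open>hits x r\<close>. As the marked process is Poisson, this has probability \<open>exp (- \<rho> * \<integral> p y dy)\<close>, where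
  \<open>p y\<close> is the probability that a ray from \<open>y\<close> passes within \<open>r\<close> of \<open>x\<close> (\<open>void_probability\<close>).
  Seen from \<open>y\<close>, the ball around \<open>x\<close> is a spherical cap, and \<open>p y\<close> is asymptotically
  \<open>cap_const n * (r / norm ((y, 0) - x)) ^ n\<close> (\<open>hit_prob_ge\<close>, \<open>hit_prob_le\<close>). Integration over \<open>y\<close>
  produces \<open>phi x\<close>.

  Now put \<open>r = b * (ln \<rho> / \<rho>) powr (1 / n)\<close>. The probability that \<open>x\<close> is uncovered becomes, to
  first order in the exponent, \<open>\<rho> powr - (b ^ n * cap_const n * phi x)\<close>. Up to powers of \<open>ln \<rho>\<close> there
  are \<open>r powr - d\<close>, that is \<open>\<rho> powr (d / n)\<close>, places in the cube at mutual distance \<open>r\<close>. Hence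
  uncovered points persist as long as \<open>b ^ n * cap_const n * Inf phi < d / n\<close> and vanish once the
  opposite strict inequality holds. Solving the equation for \<open>b\<close> gives the constant of the theorem.

  Above the threshold (\<open>prob_coverage_radius_gt\<close>) a union bound over a grid of spacing \<open>\<epsilon> * r\<close> is
  enough. It needs some care at heights below \<open>r\<close>, where the balls stick out of the upper half-space.
  There \<open>phi\<close> is very large (\<open>phi_blowup\<close>), so that already the cylinders of radius \<open>\<epsilon> * r\<close>
  around the same rays do the covering, and a point below height \<open>r\<close> may be replaced by one at height \<open>r\<close>.

  Below the threshold (\<open>prob_coverage_radius_less\<close>) the second moment method is applied to the number
  of uncovered points of a sparse grid in a small box where \<open>phi\<close> is close to its infimum. Two grid
  points are hit by the same ray only if the ray starts in the small shadow that one ball casts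
  through the other on the base space (\<open>hits_two_balls_shadow\<close>). This makes the events of being
  uncovered asymptotically uncorrelated, and Chebyshev's inequality shows that some grid point is
  uncovered with probability tending to 1.
\<close>

section \<open>Volume of solid cones\<close>

text \<open>
  The reflection in the hyperplane orthogonal to \<open>w\<close>; for \<open>w = 0\<close> the division by zero makes it the
  identity.
\<close>

definition mirror :: "'a::euclidean_space \<Rightarrow> 'a \<Rightarrow> 'a" where
  "mirror w z = z - (2 * (z \<bullet> w) / (w \<bullet> w)) *\<^sub>R w"

lemma inner_mirror: "mirror w x \<bullet> mirror w y = x \<bullet> y"
  by (cases "w = 0") (auto simp: mirror_def inner_diff_left inner_diff_right inner_commute field_simps)

lemma mirror_mirror [simp]: "mirror w (mirror w z) = z"
  by (cases "w = 0") (auto simp: mirror_def inner_diff_left inner_diff_right algebra_simps simp flip: scaleR_add_left)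

lemma mirror_diff: "mirror w (x - y) = mirror w x - mirror w y"
  by (simp add: mirror_def inner_diff_left algebra_simps diff_divide_distrib)

lemma mirror_scaleR: "mirror w (c *\<^sub>R x) = c *\<^sub>R mirror w x"
  by (simp add: mirror_def algebra_simps)

lemma norm_mirror [simp]: "norm (mirror w z) = norm z"
  by (simp add: norm_eq_sqrt_inner inner_mirror)

lemma mirror_swap:
  assumes "norm e = 1" "norm e' = 1"
  shows "mirror (e - e') e = e'"
proof (cases "e = e'")
  case False
  have "e \<bullet> e = 1" "e' \<bullet> e' = 1"
    using assms by (simp_all add: dot_square_norm)
  then have "(e - e') \<bullet> (e - e') = 2 * (e \<bullet> (e - e'))"
    by (simp add: inner_diff_left inner_diff_right inner_commute)
  moreover have "(e - e') \<bullet> (e - e') \<noteq> 0" using False by simp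
  ultimately show ?thesis by (simp add: mirror_def)
qed (simp add: mirror_def)

lemma measurable_mirror [measurable]: "mirror w \<in> borel \<rightarrow>\<^sub>M borel"
  unfolding mirror_def[abs_def] by measurable

lemma emeasure_lborel_translate_vimage:
  assumes [measurable]: "A \<in> sets borel"
  shows "emeasure lborel ((\<lambda>x. t + x) -` A) = emeasure lborel (A :: 'a::euclidean_space set)"
proof -
  have "emeasure lborel A = emeasure (distr lborel borel (\<lambda>x. t + x)) A"
    using lborel_affine[of 1 t] by (simp add: density_1)
  then show ?thesis by (simp add: emeasure_distr)
qed

text \<open>
  The image measure \<open>N\<close> of Lebesgue measure under a reflection is again translation invariant, and
  any two translation invariant measures that are finite on balls are proportional: integrate \<open>indicator A (x + y) * indicator B y\<close>
  over both variables and shift first \<open>x\<close>, then \<open>y\<close>; for a symmetric \<open>B\<close> this gives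
  \<open>N A * lborel B = lborel A * N B\<close>. The factor is 1 because the reflection preserves the unit ball.
\<close>

lemma emeasure_lborel_mirror:
  fixes A :: "'a::euclidean_space set"
  assumes A [measurable]: "A \<in> sets borel"
  shows "emeasure lborel (mirror w -` A) = emeasure lborel A"
proof -
  define N where "N = distr lborel borel (mirror w)"
  have [measurable_cong]: "sets N = sets borel" by (simp add: N_def)
  define B where "B = cball (0::'a) 1"
  have [measurable]: "B \<in> sets borel" by (simp add: B_def)
  \<comment> \<open>A shift by \<open>y\<close> after the reflection is a shift by the reflected \<open>y\<close> before it.\<close>
  have N_translate: "emeasure N ((\<lambda>x. x + y) -` C) = emeasure N C"
    if [measurable]: "C \<in> sets borel" for C y
  proof -
    have "mirror w -` ((\<lambda>x. x + y) -` C) = (\<lambda>x. mirror w y + x) -` (mirror w -` C)"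
      using mirror_diff[of w _ "- mirror w y"] mirror_scaleR[of w "-1"] by (auto simp: add.commute)
    moreover have "mirror w -` C \<in> sets borel"
      using measurable_sets[OF measurable_mirror that] by simp
    moreover have "(\<lambda>x. x + y) -` C \<in> sets borel"
      using measurable_sets[of "\<lambda>x. x + y" borel borel C] by simp
    ultimately show ?thesis
      using that by (simp add: N_def emeasure_distr emeasure_lborel_translate_vimage)
  qed
  have N_ball: "emeasure N (cball 0 r) = emeasure lborel (cball (0::'a) r)" for r
    by (simp add: N_def emeasure_distr) (simp add: vimage_def cball_def)
  interpret N: sigma_finite_measure N
  proof
    show "\<exists>A. countable A \<and> A \<subseteq> sets N \<and> \<Union> A = space N \<and> (\<forall>a\<in>A. emeasure N a \<noteq> \<infinity>)"
    proof (intro exI[of _ "range (\<lambda>k. cball 0 (real k))"] conjI)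
      show "\<Union> (range (\<lambda>k. cball 0 (real k))) = space N"
        by (auto simp: N_def real_arch_simple)
      show "\<forall>a\<in>range (\<lambda>k. cball 0 (real k)). emeasure N a \<noteq> \<infinity>"
        using emeasure_lborel_cball_finite[of "0::'a"] by (auto simp: N_ball less_top[symmetric])
    qed (auto simp: N_def)
  qed
  interpret P: pair_sigma_finite N "lborel :: 'a measure"
    by unfold_locales
  have "emeasure N A * emeasure lborel B = (\<integral>\<^sup>+y. emeasure N A * indicator B y \<partial>lborel)"
    by (simp add: nn_integral_cmult)
  also have "\<dots> = (\<integral>\<^sup>+y. (\<integral>\<^sup>+x. indicator A (x + y) * indicator B y \<partial>N) \<partial>lborel)"
  proof (intro nn_integral_cong)
    fix y :: 'a
    have "(\<integral>\<^sup>+x. indicator A (x + y) * indicator B y \<partial>N) =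
        (\<integral>\<^sup>+x. indicator ((\<lambda>x. x + y) -` A) x \<partial>N) * indicator B y"
      by (subst nn_integral_multc) (auto simp: indicator_def intro!: nn_integral_cong)
    also have "(\<integral>\<^sup>+x. indicator ((\<lambda>x. x + y) -` A) x \<partial>N) = emeasure N ((\<lambda>x. x + y) -` A)"
      using measurable_sets[of "\<lambda>x. x + y" borel borel A] by (intro nn_integral_indicator) simp
    finally show "emeasure N A * indicator B y = (\<integral>\<^sup>+x. indicator A (x + y) * indicator B y \<partial>N)"
      by (simp add: N_translate)
  qed
  also have "\<dots> = (\<integral>\<^sup>+x. (\<integral>\<^sup>+y. indicator A (x + y) * indicator B y \<partial>lborel) \<partial>N)"
    by (intro P.Fubini') measurable
  also have "\<dots> = (\<integral>\<^sup>+x. (\<integral>\<^sup>+y. indicator A y * indicator B (y - x) \<partial>lborel) \<partial>N)"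
  proof (rule nn_integral_cong)
    fix x :: 'a
    have "(\<integral>\<^sup>+y. indicator A y * indicator B (y - x) \<partial>lborel) =
        (\<integral>\<^sup>+y. indicator A y * indicator B (y - x) \<partial>distr lborel borel (\<lambda>y. x + y))"
      using lborel_affine[of 1 x] by (simp add: density_1)
    also have "\<dots> = (\<integral>\<^sup>+y. indicator A (x + y) * indicator B y \<partial>lborel)"
      by (subst nn_integral_distr) auto
    finally show "(\<integral>\<^sup>+y. indicator A (x + y) * indicator B y \<partial>lborel) =
        (\<integral>\<^sup>+y. indicator A y * indicator B (y - x) \<partial>lborel)" ..
  qed
  also have "\<dots> = (\<integral>\<^sup>+y. (\<integral>\<^sup>+x. indicator A y * indicator B (y - x) \<partial>N) \<partial>lborel)"
    by (intro P.Fubini'[symmetric]) measurable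
  also have "\<dots> = (\<integral>\<^sup>+y. indicator A y * emeasure N B \<partial>lborel)"
  proof (intro nn_integral_cong)
    fix y :: 'a
    have [measurable]: "(\<lambda>x. x + (- y)) -` B \<in> sets N"
      using measurable_sets[of "\<lambda>x. x + (- y)" borel borel B] by (simp add: N_def)
    have "(\<integral>\<^sup>+x. indicator A y * indicator B (y - x) \<partial>N) = indicator A y * (\<integral>\<^sup>+x. indicator ((\<lambda>x. x + (- y)) -` B) x \<partial>N)"
      by (subst nn_integral_cmult[symmetric], measurable)
        (auto simp: indicator_def B_def norm_minus_commute intro!: nn_integral_cong)
    also have "(\<integral>\<^sup>+x. indicator ((\<lambda>x. x + (- y)) -` B) x \<partial>N) = emeasure N ((\<lambda>x. x + (- y)) -` B)"
      using measurable_sets[of "\<lambda>x. x + (- y)" borel borel B] by (intro nn_integral_indicator) simp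
    finally show "(\<integral>\<^sup>+x. indicator A y * indicator B (y - x) \<partial>N) = indicator A y * emeasure N B"
      by (simp only: N_translate \<open>B \<in> sets borel\<close>)
  qed
  also have "\<dots> = emeasure lborel A * emeasure N B"
    by (simp add: nn_integral_multc)
  also have "emeasure N B = emeasure lborel B"
    by (simp add: B_def N_ball)
  finally have "emeasure N A * emeasure lborel B = emeasure lborel A * emeasure lborel B" .
  moreover have "emeasure lborel B \<noteq> 0" "emeasure lborel B \<noteq> \<infinity>"
    by (simp_all add: B_def emeasure_cball unit_ball_vol_pos[THEN less_imp_neq, symmetric])
  ultimately have "emeasure N A = emeasure lborel A"
    by (metis ennreal_mult_cancel_left mult.commute infinity_ennreal_def)
  then show ?thesis by (simp add: N_def emeasure_distr)
qed

text \<open>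
  The solid circular cone with apex 0, axis \<open>e\<close> and slope \<open>q\<close>, cut off at height \<open>c\<close>.
\<close>

definition axis_cone :: "'a::euclidean_space \<Rightarrow> real \<Rightarrow> real \<Rightarrow> 'a set" where
  "axis_cone e c q = {z. 0 < z \<bullet> e \<and> z \<bullet> e \<le> c \<and> norm (z - (z \<bullet> e) *\<^sub>R e) \<le> q * (z \<bullet> e)}"

lemma axis_cone_borel [measurable]: "axis_cone e c q \<in> sets borel"
  unfolding axis_cone_def by measurable

lemma mirror_vimage_axis_cone:
  "mirror w -` axis_cone (mirror w e) c q = axis_cone e c q"
proof -
  have "norm (mirror w z - t *\<^sub>R mirror w e) = norm (z - t *\<^sub>R e)" for z t
    by (metis norm_mirror mirror_diff mirror_scaleR)
  then show ?thesis
    by (auto simp: axis_cone_def inner_mirror)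
qed

text \<open>
  The reflection that exchanges \<open>e\<close> and \<open>e'\<close> exchanges the two cones.
\<close>

lemma emeasure_axis_cone_rotate:
  fixes e e' :: "'a::euclidean_space"
  assumes "norm e = 1" "norm e' = 1"
  shows "emeasure lborel (axis_cone e c q) = emeasure lborel (axis_cone e' c q)"
  using emeasure_lborel_mirror[of "axis_cone e' c q" "e - e'"]
    mirror_vimage_axis_cone[of "e - e'" e c q] mirror_swap[OF assms] by simp

text \<open>
  Cavalieri's principle: the slice at height \<open>t\<close> is a ball of radius \<open>q * t\<close>.
\<close>

lemma emeasure_axis_cone_vertical:
  assumes "0 \<le> c" "0 \<le> q"
  shows "emeasure lborel (axis_cone (0, 1) c q :: ('a::euclidean_space \<times> real) set) =
    ennreal (unit_ball_vol (real DIM('a)) * q ^ DIM('a) * c ^ (DIM('a) + 1) / real (DIM('a) + 1))"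
proof -
  let ?n = "DIM('a)" and ?K = "unit_ball_vol (real DIM('a))"
  have "emeasure lborel (axis_cone (0, 1) c q :: ('a \<times> real) set) =
      emeasure (lborel \<Otimes>\<^sub>M lborel) (axis_cone (0, 1) c q :: ('a \<times> real) set)"
    by (simp add: lborel_prod)
  also have "\<dots> = (\<integral>\<^sup>+t. emeasure lborel ((\<lambda>u. (u, t :: real)) -` axis_cone (0, 1) c q :: 'a set) \<partial>lborel)"
    by (rule pair_sigma_finite.emeasure_pair_measure_alt2
        [OF pair_sigma_finite.intro[OF lborel.sigma_finite_measure_axioms lborel.sigma_finite_measure_axioms]])
      (metis axis_cone_borel lborel_prod sets_lborel)
  also have "\<dots> = (\<integral>\<^sup>+t. ennreal (?K * q ^ ?n * t ^ ?n) * indicator {0..c} t \<partial>lborel)"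
  proof (intro nn_integral_cong)
    fix t :: real
    show "emeasure lborel ((\<lambda>u. (u, t)) -` axis_cone (0, 1) c q :: 'a set) =
        ennreal (?K * q ^ ?n * t ^ ?n) * indicator {0..c} t"
    proof (cases "0 < t \<and> t \<le> c")
      case True
      then have "(\<lambda>u. (u, t)) -` axis_cone (0, 1) c q = cball (0::'a) (q * t)"
        by (auto simp: axis_cone_def inner_prod_def norm_prod_def)
      with True assms show ?thesis
        by (simp add: emeasure_cball power_mult_distrib mult_ac)
    next
      case False
      then have "(\<lambda>u. (u, t)) -` axis_cone (0, 1) c q = ({} :: 'a set)"
        by (auto simp: axis_cone_def inner_prod_def)
      with False show ?thesis by (cases "t = 0") (auto simp: indicator_def power_0_left)
    qed
  qed
  also have "\<dots> = ennreal (?K * q ^ ?n * c ^ (?n + 1) / (?n + 1) - ?K * q ^ ?n * 0 ^ (?n + 1) / (?n + 1))"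
  proof (rule nn_integral_FTC_Icc)
    fix t :: real assume t: "t \<in> {0..c}"
    have "((\<lambda>t. ?K * q ^ ?n * t ^ (?n + 1) / (?n + 1)) has_real_derivative
        ?K * q ^ ?n * (real (?n + 1) * t ^ ?n) / (?n + 1)) (at t)"
      using DERIV_cdivide[OF DERIV_cmult[OF DERIV_pow[of "?n + 1" t UNIV]], of "?K * q ^ ?n" "real (?n + 1)"]
      by (simp add: mult.assoc)
    then show "((\<lambda>t. ?K * q ^ ?n * t ^ (?n + 1) / (?n + 1)) has_real_derivative ?K * q ^ ?n * t ^ ?n) (at t)"
      by (simp add: mult.assoc)
    show "0 \<le> ?K * q ^ ?n * t ^ ?n"
      using t assms by simp
  qed (use assms in auto)
  finally show ?thesis by simp
qed

lemma emeasure_axis_cone: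
  fixes e :: "'a::euclidean_space \<times> real"
  assumes "norm e = 1" "0 \<le> c" "0 \<le> q"
  shows "emeasure lborel (axis_cone e c q) =
    ennreal (unit_ball_vol (real DIM('a)) * q ^ DIM('a) * c ^ (DIM('a) + 1) / real (DIM('a) + 1))"
  using emeasure_axis_cone_rotate[OF assms(1), of "(0, 1)" c q]
    emeasure_axis_cone_vertical[OF assms(2,3), where 'a='a] by (simp add: norm_prod_def)

section \<open>The probability that a random ray hits a ball\<close>

lemma abs_snd_le_norm: "\<bar>snd v\<bar> \<le> norm (v :: 'a::euclidean_space \<times> real)"
  using norm_snd_le[of "snd v" "fst v"] by simp

lemma cone_ratio_mono:
  assumes "A \<subseteq> B" "B \<in> sets borel"
  shows "2 * (emeasure lborel A / c) \<le> 2 * (emeasure lborel B / (c :: ennreal))"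
  using emeasure_mono[of A B lborel] assms
  by (intro mult_left_mono divide_right_mono_ennreal) auto

lemma upper_half_space_borel [measurable]: "{z :: 'a::euclidean_space \<times> real. 0 \<le> snd z} \<in> sets borel"
  by (intro borel_closed closed_Collect_le continuous_intros)

text \<open>
  For a set that is a cone, the radial projection in the definition of the spherical measure can be
  dropped, because scaling changes neither membership nor the sign of the last coordinate. The only
  exception is the origin, which is a null set.
\<close>

lemma emeasure_uniform_hemisphere:
  fixes H :: "('a::euclidean_space \<times> real) set"
  assumes H [measurable]: "H \<in> sets borel"
    and cone: "\<And>c z. 0 < c \<Longrightarrow> z \<in> H \<Longrightarrow> c *\<^sub>R z \<in> H"
  shows "emeasure uniform_hemisphere H =
    2 * (emeasure lborel (cball 0 1 \<inter> {z. 0 \<le> snd z} \<inter> H) / emeasure lborel (cball (0::'a \<times> real) 1))"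
proof -
  have hemi [measurable]: "(hemisphere :: ('a \<times> real) set) \<in> sets borel"
    unfolding hemisphere_def
    by (intro borel_closed closed_Collect_conj closed_Collect_eq closed_Collect_le continuous_intros)
  have [measurable_cong]: "sets (sphere_measure :: ('a \<times> real) measure) = sets borel"
    by (simp add: sphere_measure_def)
  have "emeasure uniform_hemisphere H = (\<integral>\<^sup>+s. 2 * indicator hemisphere s * indicator H s \<partial>sphere_measure)"
    unfolding uniform_hemisphere_def by (intro emeasure_density) auto
  also have "\<dots> = (\<integral>\<^sup>+s. 2 * indicator (hemisphere \<inter> H) s \<partial>sphere_measure)"
    by (intro nn_integral_cong) (auto simp: indicator_def)
  also have "\<dots> = 2 * emeasure sphere_measure (hemisphere \<inter> H)"
    by (simp add: nn_integral_cmult)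
  also have "emeasure sphere_measure (hemisphere \<inter> H) =
      emeasure (uniform_measure lborel (cball 0 1)) (sgn -` (hemisphere \<inter> H))"
    unfolding sphere_measure_def by (subst emeasure_distr) auto
  also have "\<dots> = emeasure lborel (cball 0 1 \<inter> sgn -` (hemisphere \<inter> H)) / emeasure lborel (cball (0::'a \<times> real) 1)"
    using measurable_sets[OF borel_measurable_sgn_euclidean, of "hemisphere \<inter> H"]
    by (subst emeasure_uniform_measure) auto
  also have "emeasure lborel (cball 0 1 \<inter> sgn -` (hemisphere \<inter> H)) = emeasure lborel (cball 0 1 \<inter> {z. 0 \<le> snd z} \<inter> H)"
  proof (rule emeasure_eq_AE)
    have "z \<in> cball 0 1 \<inter> sgn -` (hemisphere \<inter> H) \<longleftrightarrow> z \<in> cball 0 1 \<inter> {z. 0 \<le> snd z} \<inter> H" if z: "z \<noteq> 0" for z :: "'a \<times> real"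
    proof -
      have "sgn z \<in> H \<longleftrightarrow> z \<in> H"
        using cone[of "norm z" "sgn z"] cone[of "inverse (norm z)" z] z
        by (auto simp: sgn_div_norm divide_inverse)
      moreover have "sgn z \<in> hemisphere \<longleftrightarrow> 0 \<le> snd z"
        using z by (simp add: hemisphere_def norm_sgn) (simp add: sgn_div_norm zero_le_mult_iff)
      ultimately show ?thesis by auto
    qed
    then show "AE z in lborel. z \<in> cball 0 1 \<inter> sgn -` (hemisphere \<inter> H) \<longleftrightarrow> z \<in> cball (0::'a \<times> real) 1 \<inter> {z. 0 \<le> snd z} \<inter> H"
      using AE_lborel_singleton[of "0 :: 'a \<times> real"] by (auto elim!: eventually_mono)
    show "cball 0 1 \<inter> sgn -` (hemisphere \<inter> H) \<in> sets lborel"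
      using measurable_sets[OF borel_measurable_sgn_euclidean, of "hemisphere \<inter> H"] by auto
  qed (use upper_half_space_borel H in auto)
  finally show ?thesis .
qed

text \<open>
  The condition on \<open>s\<close> is meaningful for vectors of any length and invariant under positive scaling,
  so that sections of this set are cones and their mass under the uniform law is a ratio of volumes.
\<close>

definition hits :: "'a::euclidean_space \<times> real \<Rightarrow> real \<Rightarrow> ('a \<times> ('a \<times> real)) set" where
  "hits x r = {(y, s). \<exists>t\<ge>0. norm ((y, 0) + t *\<^sub>R s - x) \<le> r}"

lemma closed_ray: "closed (ray y s)"
proof (cases "s = 0")
  case True
  then have "ray y s = {(y, 0)}" by (auto simp: ray_def intro: exI[of _ 0])
  then show ?thesis by simp
next
  case False
  have "ray y s = (+) (y, 0) ` ((\<lambda>t. t *\<^sub>R s) ` {0..})"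
    by (auto simp: ray_def)
  moreover have "closed ((\<lambda>t. t *\<^sub>R s) ` {0..})"
    using False by (intro closed_injective_linear_image linearI injI) (auto simp: algebra_simps)
  ultimately show ?thesis by (simp add: closed_translation)
qed

lemma hits_iff_infdist: "(y, s) \<in> hits x r \<longleftrightarrow> infdist x (ray y s) \<le> r"
proof
  assume "(y, s) \<in> hits x r"
  then obtain t where t: "t \<ge> 0" "norm ((y, 0) + t *\<^sub>R s - x) \<le> r" by (auto simp: hits_def)
  have "infdist x (ray y s) \<le> dist x ((y, 0) + t *\<^sub>R s)"
    using t(1) by (intro infdist_le) (auto simp: ray_def)
  with t(2) show "infdist x (ray y s) \<le> r" by (simp add: dist_norm norm_minus_commute)
next
  assume le: "infdist x (ray y s) \<le> r"
  have "(y, 0) + 0 *\<^sub>R s \<in> ray y s" unfolding ray_def by blast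
  then have "ray y s \<noteq> {}" by blast
  then obtain z where "z \<in> ray y s" "infdist x (ray y s) = dist x z"
    using infdist_attains_inf[OF closed_ray] by metis
  with le show "(y, s) \<in> hits x r"
    by (auto simp: hits_def ray_def dist_norm norm_minus_commute)
qed

text \<open>
  A strict inequality is open in \<open>t\<close>, so rational times suffice. This countable description makes the
  distance to a ray a measurable function of base point and direction.
\<close>

lemma infdist_ray_less_iff:
  "infdist x (ray y s) < c \<longleftrightarrow> (\<exists>t\<in>\<rat> \<inter> {0..}. norm ((y, 0) + t *\<^sub>R s - x) < c)"
proof
  assume "infdist x (ray y s) < c"
  then obtain b where "infdist x (ray y s) \<le> b" "b < c" using dense by (metis less_imp_le)
  then obtain t where t: "t \<ge> 0" "norm ((y, 0) + t *\<^sub>R s - x) < c"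
    using hits_iff_infdist[of y s x b] by (force simp: hits_def)
  have "open ((\<lambda>t. norm ((y, 0) + t *\<^sub>R s - x)) -` {..<c})"
    by (intro continuous_open_vimage continuous_intros open_lessThan)
  then obtain \<epsilon> where \<epsilon>: "\<epsilon> > 0" "ball t \<epsilon> \<subseteq> (\<lambda>t. norm ((y, 0) + t *\<^sub>R s - x)) -` {..<c}"
    using t(2) by (force simp: open_contains_ball)
  obtain q where q: "q \<in> \<rat>" "t < q" "q < t + \<epsilon>" using Rats_dense_in_real[of t "t + \<epsilon>"] \<epsilon>(1) by auto
  then have "q \<in> ball t \<epsilon>" by (auto simp: dist_real_def)
  with \<epsilon>(2) q t(1) show "\<exists>t\<in>\<rat> \<inter> {0..}. norm ((y, 0) + t *\<^sub>R s - x) < c"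
    by (intro bexI[of _ q]) auto
next
  assume "\<exists>t\<in>\<rat> \<inter> {0..}. norm ((y, 0) + t *\<^sub>R s - x) < c"
  then obtain t where t: "t \<ge> 0" "norm ((y, 0) + t *\<^sub>R s - x) < c" by auto
  have "infdist x (ray y s) \<le> dist x ((y, 0) + t *\<^sub>R s)"
    using t(1) by (intro infdist_le) (auto simp: ray_def)
  with t(2) show "infdist x (ray y s) < c" by (simp add: dist_norm norm_minus_commute)
qed

lemma measurable_infdist_ray [measurable]:
  fixes x :: "'a::euclidean_space \<times> real"
  shows "(\<lambda>(y, s). infdist x (ray y s)) \<in> borel_measurable (borel \<Otimes>\<^sub>M borel)"
proof (rule borel_measurableI_less)
  fix c :: real
  have "countable (\<rat> \<inter> {0::real..})" using countable_rat by blast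
  then have "(\<Union>t\<in>\<rat> \<inter> {0::real..}. {p \<in> space (borel \<Otimes>\<^sub>M borel). norm ((fst p, 0) + t *\<^sub>R snd p - x) < c})
      \<in> sets (borel \<Otimes>\<^sub>M borel)"
    by (intro sets.countable_UN'') measurable
  also have "(\<Union>t\<in>\<rat> \<inter> {0::real..}. {p \<in> space (borel \<Otimes>\<^sub>M borel). norm ((fst p, 0) + t *\<^sub>R snd p - x) < c}) =
      {p \<in> space (borel \<Otimes>\<^sub>M borel). (case p of (y, s) \<Rightarrow> infdist x (ray y s)) < c}"
    by (auto simp: infdist_ray_less_iff split_beta)
  finally show "{p \<in> space (borel \<Otimes>\<^sub>M borel). (case p of (y, s) \<Rightarrow> infdist x (ray y s)) < c} \<in> sets (borel \<Otimes>\<^sub>M borel)" .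
qed

lemma hits_measurable [measurable]: "hits x r \<in> sets (borel \<Otimes>\<^sub>M borel)"
proof -
  have "{p \<in> space (borel \<Otimes>\<^sub>M borel). (case p of (y, s) \<Rightarrow> infdist x (ray y s)) \<le> r} \<in> sets (borel \<Otimes>\<^sub>M borel)"
    by measurable
  also have "{p \<in> space (borel \<Otimes>\<^sub>M borel). (case p of (y, s) \<Rightarrow> infdist x (ray y s)) \<le> r} = hits x r"
    using hits_iff_infdist[of _ _ x r] by (auto simp: space_pair_measure)
  finally show ?thesis .
qed

lemma hits_section_measurable [measurable]: "Pair y -` hits x r \<in> sets borel"
  by (rule sets_Pair1[OF hits_measurable])

lemma hits_scale: "0 < c \<Longrightarrow> z \<in> Pair y -` hits x r \<Longrightarrow> c *\<^sub>R z \<in> Pair y -` hits x r"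
proof -
  assume c: "0 < c" and "z \<in> Pair y -` hits x r"
  then obtain t where "0 \<le> t" "norm ((y, 0) + t *\<^sub>R z - x) \<le> r" by (auto simp: hits_def)
  with c show "c *\<^sub>R z \<in> Pair y -` hits x r"
    by (auto simp: hits_def intro!: exI[of _ "t / c"])
qed

text \<open>
  A spherical cap of small angular radius \<open>\<alpha>\<close> inside the upper hemisphere of the unit sphere in dimension
  \<open>n + 1\<close> has mass asymptotic to \<open>cap_const n * \<alpha> ^ n\<close> under the uniform law.
\<close>

definition cap_const :: "nat \<Rightarrow> real" where
  "cap_const n = 2 * unit_ball_vol (real n) / (real (n + 1) * unit_ball_vol (real (n + 1)))"

lemma cap_const_pos: "0 < cap_const n"
  by (simp add: cap_const_def)

lemma axis_cone_ratio:
  fixes e :: "'a::euclidean_space \<times> real"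
  assumes "norm e = 1" "0 \<le> c" "0 \<le> q"
  shows "2 * (emeasure lborel (axis_cone e c q) / emeasure lborel (cball (0::'a \<times> real) 1)) =
    ennreal (cap_const DIM('a) * q ^ DIM('a) * c ^ (DIM('a) + 1))"
proof -
  have "2 * (emeasure lborel (axis_cone e c q) / emeasure lborel (cball (0::'a \<times> real) 1)) =
    ennreal (2 * (unit_ball_vol (real DIM('a)) * q ^ DIM('a) * c ^ (DIM('a) + 1) / real (DIM('a) + 1) /
      unit_ball_vol (real (DIM('a) + 1))))"
    using assms
    by (simp add: emeasure_axis_cone emeasure_cball divide_ennreal ennreal_mult' del: of_nat_add times_divide_eq_right)
  then show ?thesis by (simp add: cap_const_def mult_ac)
qed

lemma emeasure_uniform_hemisphere_eq_measure:
  fixes H :: "('a::euclidean_space \<times> real) set"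
  assumes H: "H \<in> sets borel"
    and cone: "\<And>c z. 0 < c \<Longrightarrow> z \<in> H \<Longrightarrow> c *\<^sub>R z \<in> H"
  shows "emeasure uniform_hemisphere H = ennreal (measure uniform_hemisphere H)"
proof -
  have "emeasure uniform_hemisphere H \<le>
    2 * (emeasure lborel (cball (0::'a \<times> real) 1) / emeasure lborel (cball (0::'a \<times> real) 1))"
    by (subst emeasure_uniform_hemisphere[OF H], erule (1) cone)
      (rule cone_ratio_mono, auto)
  also have "\<dots> < \<top>"
    by (simp add: emeasure_cball divide_ennreal ennreal_mult_less_top)
  finally show ?thesis by (intro emeasure_eq_ennreal_measure) simp
qed

lemma emeasure_hits:
  fixes x :: "'a::euclidean_space \<times> real"
  shows "emeasure uniform_hemisphere (Pair y -` hits x r) =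
    2 * (emeasure lborel (cball 0 1 \<inter> {z. 0 \<le> snd z} \<inter> Pair y -` hits x r) / emeasure lborel (cball (0::'a \<times> real) 1))"
  by (rule emeasure_uniform_hemisphere[OF hits_section_measurable]) (rule hits_scale)

lemma emeasure_hits_eq_measure:
  fixes x :: "'a::euclidean_space \<times> real"
  shows "emeasure uniform_hemisphere (Pair y -` hits x r) = ennreal (measure uniform_hemisphere (Pair y -` hits x r))"
  by (rule emeasure_uniform_hemisphere_eq_measure[OF hits_section_measurable]) (rule hits_scale)

text \<open>
  A vector in the cone around \<open>x - (y, 0)\<close> of slope \<open>q\<close> is at distance at most \<open>r\<close> from \<open>x\<close> once it is
  scaled to the height of \<open>x\<close> along the axis. The cutoff at \<open>1 / sqrt (1 + q\<^sup>2)\<close> keeps the cone in the unit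
  ball, and \<open>r \<le> snd x\<close> keeps it in the upper half-space.
\<close>

lemma hit_prob_ge:
  fixes x :: "'a::euclidean_space \<times> real"
  assumes r: "0 < r" "r \<le> snd x" and q: "q = r / norm ((y, 0) - x)"
  shows "cap_const DIM('a) * q ^ DIM('a) * (1 / sqrt (1 + q\<^sup>2)) ^ (DIM('a) + 1) \<le>
    measure uniform_hemisphere (Pair y -` hits x r)"
proof -
  define v where "v = x - (y, 0)"
  define V where "V = norm v"
  define e where "e = v /\<^sub>R V"
  define c where "c = 1 / sqrt (1 + q\<^sup>2)"
  have "snd v \<le> V"
    using abs_snd_le_norm[of v] by (simp add: V_def)
  then have V: "0 < V" using r by (simp add: v_def)
  then have e: "norm e = 1" "v = V *\<^sub>R e"
    by (simp_all add: e_def V_def)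
  have qV: "q = r / V" by (simp add: q V_def v_def norm_minus_commute)
  have q0: "0 \<le> q" using r V by (simp add: qV)
  have c0: "0 \<le> c" by (simp add: c_def)
  have c2: "c\<^sup>2 * (1 + q\<^sup>2) = 1"
    by (simp add: c_def power_divide add_nonneg_eq_0_iff)
  have "axis_cone e c q \<subseteq> cball 0 1 \<inter> {z. 0 \<le> snd z} \<inter> (Pair y -` hits x r)"
  proof
    fix z assume z: "z \<in> axis_cone e c q"
    define \<tau> where "\<tau> = z \<bullet> e"
    define u where "u = z - \<tau> *\<^sub>R e"
    have \<tau>: "0 < \<tau>" "\<tau> \<le> c" "norm u \<le> q * \<tau>"
      using z by (simp_all add: axis_cone_def \<tau>_def u_def)
    have "u \<bullet> e = 0"
      using e(1) by (simp add: u_def \<tau>_def inner_diff_left dot_square_norm)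
    then have orth: "orthogonal (\<tau> *\<^sub>R e) u" by (simp add: orthogonal_def inner_commute)
    have zu: "z = \<tau> *\<^sub>R e + u" by (simp add: u_def)
    have "(norm z)\<^sup>2 = \<tau>\<^sup>2 + (norm u)\<^sup>2"
      unfolding zu norm_add_Pythagorean[OF orth] using e(1) by simp
    also have "\<dots> \<le> \<tau>\<^sup>2 + (q * \<tau>)\<^sup>2"
      using \<tau>(3) by (intro add_left_mono power_mono) auto
    also have "\<dots> = \<tau>\<^sup>2 * (1 + q\<^sup>2)" by (simp add: algebra_simps power_mult_distrib)
    also have "\<dots> \<le> c\<^sup>2 * (1 + q\<^sup>2)"
      using \<tau> by (intro mult_right_mono power_mono) auto
    finally have "(norm z)\<^sup>2 \<le> 1" by (simp add: c2)
    then have norm_z: "norm z \<le> 1" by (simp add: power_le_one_iff abs_square_le_1)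
    define t where "t = V / \<tau>"
    have t: "0 < t" using \<tau> V by (simp add: t_def)
    have "t *\<^sub>R z - v = t *\<^sub>R u"
      using \<tau> by (simp add: zu e(2) t_def algebra_simps)
    then have "norm (t *\<^sub>R z - v) = t * norm u" using t by simp
    also have "\<dots> \<le> t * (q * \<tau>)" using \<tau> t by (intro mult_left_mono) auto
    also have "\<dots> = r" using \<tau> V by (simp add: t_def qV)
    finally have close: "norm (t *\<^sub>R z - v) \<le> r" .
    moreover have "(y, 0) + t *\<^sub>R z - x = t *\<^sub>R z - v" by (simp add: v_def)
    ultimately have "norm ((y, 0) + t *\<^sub>R z - x) \<le> r" by (simp only:)
    then have "(y, z) \<in> hits x r" using t by (auto simp: hits_def intro!: exI[of _ t])
    moreover have "0 \<le> snd z"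
    proof -
      have "\<bar>t * snd z - snd x\<bar> \<le> r"
        using abs_snd_le_norm[of "t *\<^sub>R z - v"] close by (simp add: v_def)
      then have "0 \<le> t * snd z" using r by linarith
      then show ?thesis using t by (simp add: zero_le_mult_iff)
    qed
    ultimately show "z \<in> cball 0 1 \<inter> {z. 0 \<le> snd z} \<inter> (Pair y -` hits x r)"
      using norm_z by simp
  qed
  then have "ennreal (cap_const DIM('a) * q ^ DIM('a) * c ^ (DIM('a) + 1)) \<le>
      emeasure uniform_hemisphere (Pair y -` hits x r)"
    unfolding axis_cone_ratio[OF e(1) c0 q0, symmetric]
    unfolding emeasure_hits by (intro cone_ratio_mono) (use upper_half_space_borel in auto)
  then show ?thesis
    by (subst (asm) emeasure_hits_eq_measure)
      (simp add: c_def)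
qed

text \<open>
  A point of the ray within \<open>r\<close> of \<open>x\<close> is within \<open>r\<close> of the axis through \<open>x\<close> and has advanced at least
  \<open>norm ((y, 0) - x) - r\<close> along it, so the direction lies in a cone whose slope is the quotient.
\<close>

lemma hit_prob_le:
  fixes x :: "'a::euclidean_space \<times> real"
  assumes r: "0 < r" "r < norm ((y, 0) - x)"
  shows "measure uniform_hemisphere (Pair y -` hits x r) \<le>
    cap_const DIM('a) * (r / (norm ((y, 0) - x) - r)) ^ DIM('a)"
proof -
  define v where "v = x - (y, 0)"
  define V where "V = norm v"
  define e where "e = v /\<^sub>R V"
  define q where "q = r / (V - r)"
  have V: "r < V" using r by (simp add: V_def v_def norm_minus_commute)
  with r have "v \<noteq> 0" by (auto simp: V_def)
  then have e: "norm e = 1" "v = V *\<^sub>R e"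
    by (simp_all add: e_def V_def)
  have q0: "0 \<le> q" using r V by (simp add: q_def)
  have "cball 0 1 \<inter> {z. 0 \<le> snd z} \<inter> (Pair y -` hits x r) \<subseteq> axis_cone e 1 q"
  proof
    fix z assume z: "z \<in> cball 0 1 \<inter> {z. 0 \<le> snd z} \<inter> (Pair y -` hits x r)"
    define \<tau> where "\<tau> = z \<bullet> e"
    obtain t where t: "0 \<le> t" "norm ((y, 0) + t *\<^sub>R z - x) \<le> r" using z by (auto simp: hits_def)
    have close: "norm (t *\<^sub>R z - v) \<le> r" using t(2) by (simp add: v_def algebra_simps)
    have "e \<bullet> e = 1" using e(1) by (simp add: dot_square_norm)
    then have "(t *\<^sub>R z - v) \<bullet> e = t * \<tau> - V"
      by (simp add: inner_diff_left \<tau>_def e(2))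
    moreover have "\<bar>(t *\<^sub>R z - v) \<bullet> e\<bar> \<le> r"
      using Cauchy_Schwarz_ineq2[of "t *\<^sub>R z - v" e] close e(1) by simp
    ultimately have tt: "V - r \<le> t * \<tau>" "0 < t * \<tau>" using V by auto
    have t_pos: "0 < t" and \<tau>_pos: "0 < \<tau>"
      using tt(2) t(1) by (auto simp: zero_less_mult_iff)
    have "\<tau> \<le> 1"
      using Cauchy_Schwarz_ineq2[of z e] z e(1) by (auto simp: \<tau>_def)
    moreover have "norm (z - \<tau> *\<^sub>R e) \<le> q * \<tau>"
    proof -
      have "t *\<^sub>R (z - \<tau> *\<^sub>R e) = (t *\<^sub>R z - v) - ((t *\<^sub>R z - v) \<bullet> e) *\<^sub>R e"
        unfolding \<open>(t *\<^sub>R z - v) \<bullet> e = t * \<tau> - V\<close>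
        by (subst e(2)) (simp add: scaleR_diff_left scaleR_diff_right)
      moreover have "norm (w - (w \<bullet> e) *\<^sub>R e) \<le> norm w" for w
      proof -
        have "(norm (w - (w \<bullet> e) *\<^sub>R e))\<^sup>2 = (norm w)\<^sup>2 - (w \<bullet> e)\<^sup>2"
          using \<open>e \<bullet> e = 1\<close> unfolding power2_norm_eq_inner
          by (simp add: inner_diff_left inner_diff_right inner_commute power2_eq_square)
        then have "(norm (w - (w \<bullet> e) *\<^sub>R e))\<^sup>2 \<le> (norm w)\<^sup>2" by simp
        then show ?thesis by (rule power2_le_imp_le) simp
      qed
      ultimately have "t * norm (z - \<tau> *\<^sub>R e) \<le> r"
        using close t_pos by (metis abs_of_pos norm_scaleR order_trans)
      then have "norm (z - \<tau> *\<^sub>R e) \<le> r / t" using t_pos by (simp add: field_simps)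
      also have "\<dots> \<le> q * \<tau>"
        using mult_left_mono[OF tt(1), of r] t_pos r V by (simp add: q_def field_simps)
      finally show ?thesis .
    qed
    ultimately show "z \<in> axis_cone e 1 q" using \<tau>_pos by (simp add: axis_cone_def \<tau>_def)
  qed
  then have "emeasure uniform_hemisphere (Pair y -` hits x r) \<le> ennreal (cap_const DIM('a) * q ^ DIM('a) * 1 ^ (DIM('a) + 1))"
    unfolding axis_cone_ratio[OF e(1) zero_le_one q0, symmetric]
    unfolding emeasure_hits by (intro cone_ratio_mono) (use upper_half_space_borel in auto)
  then show ?thesis
    using q0 cap_const_pos[of "DIM('a)"]
    by (subst (asm) emeasure_hits_eq_measure)
      (simp add: q_def V_def v_def norm_minus_commute)
qed

section \<open>Void probabilities of the marked Poisson process\<close>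

context prob_space begin

lemma poisson_pgf:
  assumes N [measurable]: "N \<in> M \<rightarrow>\<^sub>M count_space UNIV"
    and law: "\<And>k. prob {\<omega>\<in>space M. N \<omega> = k} = l ^ k / fact k * exp (- l)"
    and "0 \<le> u" "0 \<le> l"
  shows "(\<integral>\<^sup>+\<omega>. ennreal (u ^ N \<omega>) \<partial>M) = ennreal (exp (- (1 - u) * l))"
proof -
  have "(\<integral>\<^sup>+\<omega>. ennreal (u ^ N \<omega>) \<partial>M) =
      (\<integral>\<^sup>+\<omega>. (\<Sum>k. ennreal (u ^ k) * indicator {\<omega>\<in>space M. N \<omega> = k} \<omega>) \<partial>M)"
  proof (intro nn_integral_cong)
    fix \<omega> assume "\<omega> \<in> space M"
    then have "(\<lambda>k. ennreal (u ^ k) * indicator {\<omega>\<in>space M. N \<omega> = k} \<omega>) =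
        (\<lambda>k. if k = N \<omega> then ennreal (u ^ k) else 0)"
      by (auto simp: indicator_def)
    then show "ennreal (u ^ N \<omega>) = (\<Sum>k. ennreal (u ^ k) * indicator {\<omega>\<in>space M. N \<omega> = k} \<omega>)"
      using sums_unique[OF sums_single[of "N \<omega>" "\<lambda>k. ennreal (u ^ k)"]] by simp
  qed
  also have "\<dots> = (\<Sum>k. ennreal (u ^ k) * emeasure M {\<omega>\<in>space M. N \<omega> = k})"
    by (subst nn_integral_suminf) (auto simp: nn_integral_cmult)
  also have "\<dots> = (\<Sum>k. ennreal (exp (- l) * ((u * l) ^ k /\<^sub>R fact k)))"
    using assms by (intro suminf_cong)
      (simp add: emeasure_eq_measure law ennreal_mult[symmetric] power_mult_distrib field_simps)
  also have "\<dots> = ennreal (exp (- l) * exp (u * l))"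
    using assms by (intro suminf_ennreal_eq sums_mult exp_converges) auto
  also have "exp (- l) * exp (u * l) = exp (- (1 - u) * l)"
    by (simp add: algebra_simps flip: exp_add)
  finally show ?thesis .
qed

text \<open>
  The level sets of \<open>J\<close> cut \<open>C\<close> into finitely many disjoint pieces. The product over the points is a
  product of powers, one for each piece, whose exponents are independent Poisson variables.
\<close>

lemma poisson_process_pgf_discrete:
  fixes J :: "'b \<Rightarrow> nat" and m :: nat
  assumes Y: "poisson_process \<Lambda> Y"
    and C [measurable]: "C \<in> sets \<Lambda>" and fin: "emeasure \<Lambda> C < \<infinity>"
    and J [measurable]: "J \<in> \<Lambda> \<rightarrow>\<^sub>M count_space UNIV" and le: "\<And>y. y \<in> C \<Longrightarrow> J y \<le> m" and m: "0 < m"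
  shows "(\<integral>\<^sup>+\<omega>. ennreal (\<Prod>i | Y i \<omega> \<in> C. 1 - real (J (Y i \<omega>)) / real m) \<partial>M) =
    ennreal (exp (- (LINT y:C|\<Lambda>. real (J y) / real m)))"
proof -
  define B where "B j = C \<inter> J -` {j}" for j
  have B: "B j \<in> sets \<Lambda>" for j
  proof -
    have "B j = C \<inter> (J -` {j} \<inter> space \<Lambda>)"
      using sets.sets_into_space[OF C] by (auto simp: B_def)
    then show ?thesis by auto
  qed
  have finB: "emeasure \<Lambda> (B j) < \<infinity>" for j
    using fin emeasure_mono[of "B j" C \<Lambda>] by (auto simp: B_def intro: le_less_trans)
  define N where "N j \<omega> = card {i. Y i \<omega> \<in> B j}" for j \<omega>
  have [measurable]: "Y i \<in> M \<rightarrow>\<^sub>M \<Lambda>" for i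
    using Y by (simp add: poisson_process_def)
  have N: "N j \<in> M \<rightarrow>\<^sub>M count_space UNIV" for j
    unfolding N_def using B[of j] by measurable
  have law: "prob {\<omega>\<in>space M. N j \<omega> = k} = measure \<Lambda> (B j) ^ k / fact k * exp (- measure \<Lambda> (B j))" for j k
    using Y B finB unfolding poisson_process_def N_def by blast
  have "disjoint_family_on B {..<Suc m}"
    by (auto simp: disjoint_family_on_def B_def)
  then have indep: "indep_vars (\<lambda>_. count_space UNIV) N {..<Suc m}"
    using Y B finB unfolding poisson_process_def N_def[abs_def] by blast
  have AE_fin: "AE \<omega> in M. finite {i. Y i \<omega> \<in> C}"
    using Y C fin unfolding poisson_process_def by blast
  have "(\<integral>\<^sup>+\<omega>. ennreal (\<Prod>i | Y i \<omega> \<in> C. 1 - real (J (Y i \<omega>)) / real m) \<partial>M) =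
      (\<integral>\<^sup>+\<omega>. (\<Prod>j<Suc m. ennreal ((1 - real j / real m) ^ N j \<omega>)) \<partial>M)"
  proof (intro nn_integral_cong_AE, use AE_fin in eventually_elim)
    fix \<omega> assume fin: "finite {i. Y i \<omega> \<in> C}"
    have "{i. Y i \<omega> \<in> C} = (\<Union>j<Suc m. {i. Y i \<omega> \<in> B j})"
      using le by (auto simp: B_def less_Suc_eq_le)
    moreover have finj: "finite {i. Y i \<omega> \<in> B j}" for j
      by (rule finite_subset[OF _ fin]) (auto simp: B_def)
    ultimately have "(\<Prod>i | Y i \<omega> \<in> C. 1 - real (J (Y i \<omega>)) / real m) =
        (\<Prod>j<Suc m. \<Prod>i | Y i \<omega> \<in> B j. 1 - real (J (Y i \<omega>)) / real m)"
      by (simp only:) (rule prod.UNION_disjoint, auto simp: B_def)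
    also have "\<dots> = (\<Prod>j<Suc m. (1 - real j / real m) ^ N j \<omega>)"
      unfolding N_def prod_constant[symmetric]
      by (intro prod.cong refl) (auto simp: B_def)
    finally show "ennreal (\<Prod>i | Y i \<omega> \<in> C. 1 - real (J (Y i \<omega>)) / real m) =
        (\<Prod>j<Suc m. ennreal ((1 - real j / real m) ^ N j \<omega>))"
      using m by (simp only:) (intro prod_ennreal[symmetric] zero_le_power, auto simp: field_simps)
  qed
  also have "\<dots> = (\<Prod>j<Suc m. \<integral>\<^sup>+\<omega>. ennreal ((1 - real j / real m) ^ N j \<omega>) \<partial>M)"
    by (intro indep_vars_nn_integral indep_vars_compose2[OF indep]) auto
  also have "\<dots> = (\<Prod>j<Suc m. ennreal (exp (- (1 - (1 - real j / real m)) * measure \<Lambda> (B j))))"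
    using m by (intro prod.cong refl poisson_pgf N law) (auto simp: field_simps)
  also have "\<dots> = ennreal (exp (- (\<Sum>j<Suc m. real j / real m * measure \<Lambda> (B j))))"
    by (simp add: prod_ennreal exp_sum sum_negf[symmetric] del: prod.lessThan_Suc sum.lessThan_Suc)
  also have "(\<Sum>j<Suc m. real j / real m * measure \<Lambda> (B j)) = (LINT y:C|\<Lambda>. real (J y) / real m)"
  proof -
    have "(LINT y:C|\<Lambda>. real (J y) / real m) = (LINT y|\<Lambda>. (\<Sum>j<Suc m. real j / real m * indicator (B j) y))"
      unfolding set_lebesgue_integral_def
    proof (intro Bochner_Integration.integral_cong refl)
      fix y
      have "(\<Sum>j<Suc m. real j / real m * indicator (B j) y) =
          (\<Sum>j<Suc m. if j = J y then real j / real m * indicator C y else 0)"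
        by (intro sum.cong refl) (auto simp: B_def indicator_def)
      also have "\<dots> = indicator C y *\<^sub>R (real (J y) / real m)"
        using le[of y] by (subst sum.delta) (auto simp: indicator_def)
      finally show "indicator C y *\<^sub>R (real (J y) / real m) = (\<Sum>j<Suc m. real j / real m * indicator (B j) y)" ..
    qed
    also have "\<dots> = (\<Sum>j<Suc m. real j / real m * measure \<Lambda> (B j))"
      using B finB sets.sets_into_space[OF B]
      by (subst Bochner_Integration.integral_sum)
        (auto simp: Int_absorb2 simp del: sum.lessThan_Suc intro!: integrable_mult_right integrable_real_indicator)
    finally show ?thesis ..
  qed
  finally show ?thesis .
qed

text \<open>
  Rounding \<open>p\<close> down and up to multiples of \<open>1 / m\<close> brackets the left-hand side between two values known
  from the discrete case, and these differ from the right-hand side by at most a factor \<open>exp (measure \<Lambda> C / m)\<close>.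
\<close>

lemma poisson_process_pgf:
  fixes p :: "'b \<Rightarrow> real"
  assumes Y: "poisson_process \<Lambda> Y"
    and C [measurable]: "C \<in> sets \<Lambda>" and fin: "emeasure \<Lambda> C < \<infinity>"
    and p [measurable]: "p \<in> borel_measurable \<Lambda>" and p01: "\<And>y. 0 \<le> p y" "\<And>y. p y \<le> 1"
  shows "(\<integral>\<^sup>+\<omega>. ennreal (\<Prod>i | Y i \<omega> \<in> C. 1 - p (Y i \<omega>)) \<partial>M) = ennreal (exp (- (LINT y:C|\<Lambda>. p y)))"
    (is "?E = ennreal (exp (- ?I))")
proof -
  define L where "L = measure \<Lambda> C"
  have int: "set_integrable \<Lambda> C f" if "f \<in> borel_measurable \<Lambda>" "\<And>y. \<bar>f y\<bar> \<le> K" for f :: "'b \<Rightarrow> real" and K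
    unfolding set_integrable_def using that fin
    by (intro integrableI_bounded_set_indicator[where B=K]) auto
  have lower: "ennreal (exp (- ?I - L / real m)) \<le> ?E" and upper: "?E \<le> ennreal (exp (- ?I + L / real m))"
    if m: "0 < m" for m :: nat
  proof -
    define f where "f y = nat \<lfloor>m * p y\<rfloor>" for y
    define g where "g y = nat \<lceil>m * p y\<rceil>" for y
    have [measurable]: "f \<in> \<Lambda> \<rightarrow>\<^sub>M count_space UNIV" "g \<in> \<Lambda> \<rightarrow>\<^sub>M count_space UNIV"
      unfolding f_def g_def by measurable
    have mp: "0 \<le> m * p y" "m * p y \<le> m" for y
      using p01[of y] m by (auto simp: mult_left_le)
    have f: "real (f y) \<le> m * p y" "m * p y \<le> real (f y) + 1" "f y \<le> m" for y
      using mp[of y] unfolding f_def by linarith+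
    have g: "m * p y \<le> real (g y)" "real (g y) \<le> m * p y + 1" "g y \<le> m" for y
      using mp[of y] unfolding g_def by linarith+
    have f': "real (f y) / m \<le> p y" "p y \<le> real (f y) / m + 1 / m" "real (f y) / m \<le> 1" for y
      using f[of y] m by (auto simp: field_simps)
    have g': "p y \<le> real (g y) / m" "real (g y) / m \<le> p y + 1 / m" "real (g y) / m \<le> 1" for y
      using g[of y] m by (auto simp: field_simps)
    have int_f: "set_integrable \<Lambda> C (\<lambda>y. real (f y) / m)" and int_g: "set_integrable \<Lambda> C (\<lambda>y. real (g y) / m)"
      using f'(3) g'(3) by (auto intro!: int[of _ 1])
    have int_p: "set_integrable \<Lambda> C p" using p01 by (auto intro!: int[of _ 1])
    have int_c: "set_integrable \<Lambda> C (\<lambda>y. 1 / real m)" by (auto intro!: int[of _ "1 / m"])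
    have c: "(LINT y:C|\<Lambda>. 1 / real m) = L / m"
      using fin C by (simp add: set_lebesgue_integral_def L_def)
    have "?I \<le> (LINT y:C|\<Lambda>. real (f y) / m + 1 / m)"
      using f' by (intro set_integral_mono int_p set_integral_add int_f int_c) auto
    then have If: "- (LINT y:C|\<Lambda>. real (f y) / m) \<le> - ?I + L / m"
      unfolding set_integral_add(2)[OF int_f int_c] c by linarith
    have "(LINT y:C|\<Lambda>. real (g y) / m) \<le> (LINT y:C|\<Lambda>. p y + 1 / m)"
      using g' by (intro set_integral_mono int_p set_integral_add int_g int_c) auto
    then have Ig: "- ?I - L / m \<le> - (LINT y:C|\<Lambda>. real (g y) / m)"
      unfolding set_integral_add(2)[OF int_p int_c] c by linarith
    have "ennreal (exp (- ?I - L / m)) \<le> ennreal (exp (- (LINT y:C|\<Lambda>. real (g y) / m)))"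
      using Ig by (intro ennreal_leI) simp
    also have "\<dots> = (\<integral>\<^sup>+\<omega>. ennreal (\<Prod>i | Y i \<omega> \<in> C. 1 - real (g (Y i \<omega>)) / real m) \<partial>M)"
      by (rule poisson_process_pgf_discrete[OF Y C fin _ _ m, symmetric]) (auto simp: g)
    also have "\<dots> \<le> ?E"
      using g' by (intro nn_integral_mono ennreal_leI prod_mono) auto
    finally show "ennreal (exp (- ?I - L / m)) \<le> ?E" .
    have "?E \<le> (\<integral>\<^sup>+\<omega>. ennreal (\<Prod>i | Y i \<omega> \<in> C. 1 - real (f (Y i \<omega>)) / real m) \<partial>M)"
      using f' p01 by (intro nn_integral_mono ennreal_leI prod_mono) auto
    also have "\<dots> = ennreal (exp (- (LINT y:C|\<Lambda>. real (f y) / m)))"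
      by (rule poisson_process_pgf_discrete[OF Y C fin _ _ m]) (auto simp: f)
    also have "\<dots> \<le> ennreal (exp (- ?I + L / m))"
      using If by (intro ennreal_leI) simp
    finally show "?E \<le> ennreal (exp (- ?I + L / m))" .
  qed
  have lim: "(\<lambda>m. ennreal (exp (- ?I - L / real m))) \<longlonglongrightarrow> ennreal (exp (- ?I - 0))"
    "(\<lambda>m. ennreal (exp (- ?I + L / real m))) \<longlonglongrightarrow> ennreal (exp (- ?I + 0))"
    by (intro tendsto_intros tendsto_ennrealI lim_const_over_n)+
  have "(\<lambda>m::nat. ?E) \<longlonglongrightarrow> ennreal (exp (- ?I))"
  proof (rule tendsto_sandwich)
    show "\<forall>\<^sub>F m in sequentially. ennreal (exp (- ?I - L / real m)) \<le> ?E"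
      using eventually_gt_at_top[of "0::nat"] by eventually_elim (rule lower)
    show "\<forall>\<^sub>F m in sequentially. ?E \<le> ennreal (exp (- ?I + L / real m))"
      using eventually_gt_at_top[of "0::nat"] by eventually_elim (rule upper)
  qed (use lim in simp_all)
  then show ?thesis by (simp only: LIMSEQ_const_iff)
qed

end

context cylinder_model begin

lemma Y_measurable [measurable]: "Y i \<in> M \<rightarrow>\<^sub>M borel"
proof -
  have "Y i \<in> M \<rightarrow>\<^sub>M scale_measure (ennreal \<rho>) lborel"
    using poisson unfolding poisson_process_def by blast
  then show ?thesis
    using measurable_cong_sets[OF refl, of "scale_measure (ennreal \<rho>) (lborel :: 'a measure)" borel M] by simp
qed

lemma S_measurable [measurable]: "S i \<in> M \<rightarrow>\<^sub>M borel"
  by (rule direction_rv)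

lemma prob_space_Q: "prob_space Q"
  using prob_space_distr[OF direction_rv[of 0]] by (simp add: direction_law)

lemma sets_Q [measurable_cong, simp]: "sets Q = sets borel"
  using direction_law[of 0, symmetric] by simp

lemma void_probability_directions:
  assumes "finite I" and H: "\<And>i. i \<in> I \<Longrightarrow> H i \<in> sets borel"
  shows "prob {\<omega>\<in>space M. \<forall>i\<in>I. S i \<omega> \<notin> H i} = (\<Prod>i\<in>I. 1 - measure Q (H i))"
proof (cases "I = {}")
  case True
  then show ?thesis by (simp add: prob_space)
next
  case False
  interpret Q: prob_space Q by (rule prob_space_Q)
  have spQ: "space Q = UNIV" using sets_eq_imp_space_eq[OF sets_Q] by simp
  have "{\<omega>\<in>space M. \<forall>i\<in>I. S i \<omega> \<notin> H i} = (\<Inter>i\<in>I. S i -` (- H i) \<inter> space M)"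
    using False by auto
  also have "prob \<dots> = (\<Prod>i\<in>I. prob (S i -` (- H i) \<inter> space M))"
    using False assms by (intro indep_varsD[OF directions_indep]) auto
  also have "\<dots> = (\<Prod>i\<in>I. 1 - measure Q (H i))"
  proof (intro prod.cong refl)
    fix i assume i: "i \<in> I"
    have "prob (S i -` (- H i) \<inter> space M) = measure (distr M borel (S i)) (- H i)"
      using H[OF i] by (subst measure_distr) auto
    also have "\<dots> = 1 - measure Q (H i)"
      unfolding direction_law using Q.prob_compl[of "H i"] H[OF i] by (simp add: spQ Compl_eq_Diff_UNIV)
    finally show "prob (S i -` (- H i) \<inter> space M) = 1 - measure Q (H i)" .
  qed
  finally show ?thesis .
qed

text \<open>
  Independence of points and directions, in the form needed for Fubini's theorem: one may fix all
  points first and average over the directions alone.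
\<close>

lemma distr_points_directions:
  "distr M (PiM UNIV (\<lambda>_. borel) \<Otimes>\<^sub>M PiM UNIV (\<lambda>_. borel)) (\<lambda>\<omega>. ((\<lambda>i. Y i \<omega>), (\<lambda>i. S i \<omega>))) =
    distr M (PiM UNIV (\<lambda>_. borel)) (\<lambda>\<omega> i. Y i \<omega>) \<Otimes>\<^sub>M distr M (PiM UNIV (\<lambda>_. borel)) (\<lambda>\<omega> i. S i \<omega>)"
proof -
  let ?P = "PiM UNIV (\<lambda>_::nat. borel :: 'a measure)" and ?R = "PiM UNIV (\<lambda>_::nat. borel :: ('a \<times> real) measure)"
  define F where "F \<omega> = (\<lambda>i. Y i \<omega>)" for \<omega>
  define G where "G \<omega> = (\<lambda>i. S i \<omega>)" for \<omega>
  have F [measurable]: "F \<in> M \<rightarrow>\<^sub>M ?P" and G [measurable]: "G \<in> M \<rightarrow>\<^sub>M ?R"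
    unfolding F_def G_def by (auto intro!: measurable_PiM_single')
  interpret DF: prob_space "distr M ?P F" by (rule prob_space_distr[OF F])
  interpret DG: prob_space "distr M ?R G" by (rule prob_space_distr[OF G])
  have "distr M ?P F \<Otimes>\<^sub>M distr M ?R G = distr M (?P \<Otimes>\<^sub>M ?R) (\<lambda>\<omega>. (F \<omega>, G \<omega>))"
  proof (rule pair_measure_eqI)
    show "sigma_finite_measure (distr M ?P F)" "sigma_finite_measure (distr M ?R G)" by unfold_locales
    show "sets (distr M ?P F \<Otimes>\<^sub>M distr M ?R G) = sets (distr M (?P \<Otimes>\<^sub>M ?R) (\<lambda>\<omega>. (F \<omega>, G \<omega>)))"
      by (simp cong: sets_pair_measure_cong)
    fix A B assume "A \<in> sets (distr M ?P F)" "B \<in> sets (distr M ?R G)"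
    then have A [measurable]: "A \<in> sets ?P" and B [measurable]: "B \<in> sets ?R" by simp_all
    have "F -` A \<inter> space M \<in> sets (vimage_algebra (space M) (\<lambda>\<omega> i. Y i \<omega>) ?P)"
      unfolding F_def[abs_def] sets_vimage_algebra using A by (intro sigma_sets.Basic) blast
    moreover have "G -` B \<inter> space M \<in> sets (vimage_algebra (space M) (\<lambda>\<omega> i. S i \<omega>) ?R)"
      unfolding G_def[abs_def] sets_vimage_algebra using B by (intro sigma_sets.Basic) blast
    ultimately have "prob ((F -` A \<inter> space M) \<inter> (G -` B \<inter> space M)) = prob (F -` A \<inter> space M) * prob (G -` B \<inter> space M)"
      by (rule indep_setD[OF points_directions_indep])
    moreover have "(\<lambda>\<omega>. (F \<omega>, G \<omega>)) -` (A \<times> B) \<inter> space M = (F -` A \<inter> space M) \<inter> (G -` B \<inter> space M)" by auto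
    ultimately show "emeasure (distr M ?P F) A * emeasure (distr M ?R G) B =
        emeasure (distr M (?P \<Otimes>\<^sub>M ?R) (\<lambda>\<omega>. (F \<omega>, G \<omega>))) (A \<times> B)"
      by (simp add: emeasure_distr emeasure_eq_measure ennreal_mult)
  qed
  then show ?thesis unfolding F_def G_def by simp
qed

text \<open>
  Given the points, the directions are independent, so that the conditional probability that no marked
  point is in \<open>A\<close> is the product of \<open>1 - p (Y i)\<close> over the points in \<open>C\<close>, where \<open>p y\<close> is the mass of the
  section of \<open>A\<close> at \<open>y\<close>. Its mean is the generating functional of the Poisson process at \<open>p\<close>.
\<close>

lemma void_probability:
  assumes C [measurable]: "C \<in> sets borel" and fin: "emeasure lborel C < \<infinity>"
    and A [measurable]: "A \<in> sets (borel \<Otimes>\<^sub>M borel)" and \<rho>: "0 \<le> \<rho>"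
  shows "prob {\<omega>\<in>space M. \<forall>i. Y i \<omega> \<in> C \<longrightarrow> (Y i \<omega>, S i \<omega>) \<notin> A} =
    exp (- \<rho> * (LINT y:C|lborel. measure Q (Pair y -` A)))"
proof -
  let ?P = "PiM UNIV (\<lambda>_::nat. borel :: 'a measure)" and ?R = "PiM UNIV (\<lambda>_::nat. borel :: ('a \<times> real) measure)"
  let ?\<Lambda> = "scale_measure (ennreal \<rho>) lborel :: 'a measure"
  interpret Q: prob_space Q by (rule prob_space_Q)
  define F where "F \<omega> = (\<lambda>i. Y i \<omega>)" for \<omega>
  define G where "G \<omega> = (\<lambda>i. S i \<omega>)" for \<omega>
  have F [measurable]: "F \<in> M \<rightarrow>\<^sub>M ?P" and G [measurable]: "G \<in> M \<rightarrow>\<^sub>M ?R"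
    unfolding F_def G_def by (auto intro!: measurable_PiM_single')
  interpret DG: prob_space "distr M ?R G" by (rule prob_space_distr[OF G])
  define E where "E = {(y, s) \<in> space (?P \<Otimes>\<^sub>M ?R). \<forall>i. y i \<in> C \<longrightarrow> (y i, s i) \<notin> A}"
  have E [measurable]: "E \<in> sets (?P \<Otimes>\<^sub>M ?R)"
  proof -
    have "{z \<in> space (?P \<Otimes>\<^sub>M ?R). \<forall>i. fst z i \<in> C \<longrightarrow> (fst z i, snd z i) \<notin> A} \<in> sets (?P \<Otimes>\<^sub>M ?R)"
      by measurable
    also have "{z \<in> space (?P \<Otimes>\<^sub>M ?R). \<forall>i. fst z i \<in> C \<longrightarrow> (fst z i, snd z i) \<notin> A} = E"
      by (auto simp: E_def)
    finally show ?thesis .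
  qed
  have p [measurable]: "(\<lambda>y. measure Q (Pair y -` A)) \<in> borel_measurable borel"
    unfolding measure_def
    by (intro measurable_compose[OF Q.measurable_emeasure_Pair, of A borel enn2real])
      (simp_all add: sets_pair_measure_cong[OF refl sets_Q])
  have AE_fin: "AE \<omega> in M. finite {i. Y i \<omega> \<in> C}"
  proof -
    have "emeasure ?\<Lambda> C < \<infinity>" using fin by (simp add: ennreal_mult_less_top)
    then show ?thesis using poisson C unfolding poisson_process_def by auto
  qed
  have "emeasure M {\<omega>\<in>space M. \<forall>i. Y i \<omega> \<in> C \<longrightarrow> (Y i \<omega>, S i \<omega>) \<notin> A} =
      emeasure (distr M (?P \<Otimes>\<^sub>M ?R) (\<lambda>\<omega>. (F \<omega>, G \<omega>))) E"
    by (subst emeasure_distr[OF measurable_Pair[OF F G] E]) (auto simp: E_def F_def G_def space_pair_measure space_PiM intro!: arg_cong[where f="emeasure M"])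
  also have "\<dots> = emeasure (distr M ?P F \<Otimes>\<^sub>M distr M ?R G) E"
    using distr_points_directions unfolding F_def G_def by simp
  also have "\<dots> = (\<integral>\<^sup>+y. emeasure (distr M ?R G) (Pair y -` E) \<partial>distr M ?P F)"
    by (rule DG.emeasure_pair_measure_alt) (simp cong: sets_pair_measure_cong)
  also have "\<dots> = (\<integral>\<^sup>+\<omega>. emeasure (distr M ?R G) (Pair (F \<omega>) -` E) \<partial>M)"
    using DG.measurable_emeasure_Pair[of E ?P]
    by (intro nn_integral_distr[OF F]) (simp cong: sets_pair_measure_cong)
  also have "\<dots> = (\<integral>\<^sup>+\<omega>. ennreal (\<Prod>i | Y i \<omega> \<in> C. 1 - measure Q (Pair (Y i \<omega>) -` A)) \<partial>M)"
  proof (intro nn_integral_cong_AE, use AE_fin in eventually_elim)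
    fix \<omega> assume fin: "finite {i. Y i \<omega> \<in> C}"
    have "emeasure (distr M ?R G) (Pair (F \<omega>) -` E) = emeasure M (G -` (Pair (F \<omega>) -` E) \<inter> space M)"
      by (rule emeasure_distr[OF G]) (simp add: sets_Pair1)
    also have "G -` (Pair (F \<omega>) -` E) \<inter> space M =
        {\<omega>'\<in>space M. \<forall>i\<in>{i. Y i \<omega> \<in> C}. S i \<omega>' \<notin> Pair (Y i \<omega>) -` A}"
      by (auto simp: E_def F_def G_def space_pair_measure space_PiM)
    also have "emeasure M \<dots> = ennreal (\<Prod>i | Y i \<omega> \<in> C. 1 - measure Q (Pair (Y i \<omega>) -` A))"
      using void_probability_directions[OF fin, of "\<lambda>i. Pair (Y i \<omega>) -` A"]
      by (simp add: emeasure_eq_measure sets_Pair1)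
    finally show "emeasure (distr M ?R G) (Pair (F \<omega>) -` E) =
        ennreal (\<Prod>i | Y i \<omega> \<in> C. 1 - measure Q (Pair (Y i \<omega>) -` A))" .
  qed
  also have "\<dots> = ennreal (exp (- (LINT y:C|?\<Lambda>. measure Q (Pair y -` A))))"
    using fin by (intro poisson_process_pgf[OF poisson]) (auto simp: ennreal_mult_less_top cong: measurable_cong_sets)
  also have "(LINT y:C|?\<Lambda>. measure Q (Pair y -` A)) = \<rho> * (LINT y:C|lborel. measure Q (Pair y -` A))"
    unfolding set_lebesgue_integral_def
    using \<rho> by (subst (1 2) integral_eq_nn_integral)
      (auto simp: nn_integral_scale_measure enn2real_mult cong: measurable_cong_sets)
  finally show ?thesis by (simp add: emeasure_eq_measure)
qed

end

section \<open>Measurability of the coverage radius\<close>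

lemma mem_ray_plus_ball_iff:
  assumes "0 \<le> r"
  shows "x \<in> ray y s + (*\<^sub>R) r ` cball 0 1 \<longleftrightarrow> (y, s) \<in> hits x r"
proof
  assume "x \<in> ray y s + (*\<^sub>R) r ` cball 0 1"
  then obtain t u where "t \<ge> 0" "norm u \<le> 1" "x = (y, 0) + t *\<^sub>R s + r *\<^sub>R u"
    by (auto simp: ray_def set_plus_def)
  moreover from this(2) assms have "norm (r *\<^sub>R u) \<le> r" by (simp add: mult_left_le)
  ultimately show "(y, s) \<in> hits x r"
    by (auto simp: hits_def intro!: exI[of _ t])
next
  assume "(y, s) \<in> hits x r"
  then obtain t where t: "t \<ge> 0" "norm ((y, 0) + t *\<^sub>R s - x) \<le> r" by (auto simp: hits_def)
  define w where "w = x - ((y, 0) + t *\<^sub>R s)"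
  have w: "norm w \<le> r" using t(2) by (simp add: w_def norm_minus_commute)
  have "w = r *\<^sub>R (w /\<^sub>R r)" using w assms by (cases "r = 0") auto
  moreover have "norm (w /\<^sub>R r) \<le> 1" using w assms by (cases "r = 0") (auto simp: field_simps)
  ultimately have "w \<in> (*\<^sub>R) r ` cball 0 1" by (metis image_eqI mem_cball_0)
  moreover have "(y, 0) + t *\<^sub>R s \<in> ray y s" using t(1) by (auto simp: ray_def)
  moreover have "x = ((y, 0) + t *\<^sub>R s) + w" by (simp add: w_def)
  ultimately show "x \<in> ray y s + (*\<^sub>R) r ` cball 0 1" by (simp only: set_plus_intro)
qed

lemma mem_cylinders_iff:
  "0 \<le> r \<Longrightarrow> x \<in> cylinders Y S ((*\<^sub>R) r ` cball 0 1) \<omega> \<longleftrightarrow>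
    (\<exists>i<num_base_points Y \<omega>. (Y i \<omega>, S i \<omega>) \<in> hits x r)"
  by (auto simp: cylinders_def mem_ray_plus_ball_iff)

lemma hits_mono:
  assumes "(y, s) \<in> hits x r" "r + norm (x - x') \<le> r'"
  shows "(y, s) \<in> hits x' r'"
proof -
  obtain t where t: "t \<ge> 0" "norm ((y, 0) + t *\<^sub>R s - x) \<le> r" using assms by (auto simp: hits_def)
  have "norm ((y, 0) + t *\<^sub>R s - x') \<le> norm ((y, 0) + t *\<^sub>R s - x) + norm (x - x')"
    by (rule order_trans[OF _ norm_triangle_ineq]) simp
  then show ?thesis using t assms(2) by (auto simp: hits_def intro!: exI[of _ t])
qed

definition covers :: "(nat \<Rightarrow> 'w \<Rightarrow> 'a::euclidean_space) \<Rightarrow> (nat \<Rightarrow> 'w \<Rightarrow> 'a \<times> real) \<Rightarrow> real \<Rightarrow> 'w \<Rightarrow> bool" where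
  "covers Y S r \<omega> \<longleftrightarrow> (\<forall>x\<in>unit_cube. \<exists>i<num_base_points Y \<omega>. (Y i \<omega>, S i \<omega>) \<in> hits x r)"

lemma coverage_radius_eq_Inf_covers:
  "coverage_radius Y S (cball 0 1) \<omega> = Inf {ereal r | r. r \<ge> 0 \<and> covers Y S r \<omega>}"
  unfolding coverage_radius_def covers_def subset_eq
  by (intro arg_cong[where f=Inf]) (auto simp: mem_cylinders_iff)

lemma covers_mono: "covers Y S r \<omega> \<Longrightarrow> r \<le> r' \<Longrightarrow> covers Y S r' \<omega>"
  unfolding covers_def using hits_mono[where x=x and x'=x and r=r and r'=r' for x] by fastforce

lemma coverage_radius_nonneg: "0 \<le> coverage_radius Y S (cball 0 1) \<omega>"
  unfolding coverage_radius_eq_Inf_covers by (auto intro: Inf_greatest)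

lemma coverage_radius_le: "0 \<le> r \<Longrightarrow> covers Y S r \<omega> \<Longrightarrow> coverage_radius Y S (cball 0 1) \<omega> \<le> ereal r"
  unfolding coverage_radius_eq_Inf_covers by (auto intro: Inf_lower)

lemma coverage_radius_less_iff:
  "coverage_radius Y S (cball 0 1) \<omega> < c \<longleftrightarrow> (\<exists>r\<ge>0. ereal r < c \<and> covers Y S r \<omega>)"
  unfolding coverage_radius_eq_Inf_covers Inf_less_iff by blast

text \<open>
  The union of finitely many cylinders is closed, so it contains the cube as soon as it contains a dense
  subset.
\<close>

lemma covers_dense_iff:
  assumes D: "D \<subseteq> unit_cube" "unit_cube \<subseteq> closure D"
  shows "covers Y S r \<omega> \<longleftrightarrow> (\<forall>x\<in>D. \<exists>i<num_base_points Y \<omega>. (Y i \<omega>, S i \<omega>) \<in> hits x r)"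
proof
  assume "\<forall>x\<in>D. \<exists>i<num_base_points Y \<omega>. (Y i \<omega>, S i \<omega>) \<in> hits x r"
  then have "D \<subseteq> (\<Union>i<num_base_points Y \<omega>. {x. infdist x (ray (Y i \<omega>) (S i \<omega>)) \<le> r})"
    by (auto simp: hits_iff_infdist)
  moreover have "closed (\<Union>i<num_base_points Y \<omega>. {x. infdist x (ray (Y i \<omega>) (S i \<omega>)) \<le> r})"
    by (intro closed_UN finite_lessThan ballI closed_Collect_le continuous_on_const continuous_on_infdist continuous_on_id)
  ultimately have "unit_cube \<subseteq> (\<Union>i<num_base_points Y \<omega>. {x. infdist x (ray (Y i \<omega>) (S i \<omega>)) \<le> r})"
    using D(2) closure_minimal by blast
  then show "covers Y S r \<omega>" by (fastforce simp: covers_def hits_iff_infdist)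
qed (use D in \<open>auto simp: covers_def\<close>)

context cylinder_model begin

lemma num_base_points_measurable [measurable]: "num_base_points Y \<in> M \<rightarrow>\<^sub>M count_space UNIV"
proof -
  have [measurable]: "(unit_cube :: 'a set) \<in> sets borel" by (simp add: unit_cube_def)
  show ?thesis unfolding num_base_points_def[abs_def] by measurable
qed

lemma no_base_point_hits_measurable:
  assumes A: "A \<in> sets (borel \<Otimes>\<^sub>M borel)"
  shows "{\<omega>\<in>space M. \<forall>i<num_base_points Y \<omega>. (Y i \<omega>, S i \<omega>) \<notin> A} \<in> sets M"
proof -
  have "(\<lambda>\<omega>. (Y i \<omega>, S i \<omega>)) -` A \<inter> space M \<in> sets M" for i
    by (rule measurable_sets[OF measurable_Pair[OF Y_measurable S_measurable] A])
  moreover have "num_base_points Y -` {i<..} \<inter> space M \<in> sets M" for i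
    by (rule measurable_sets[OF num_base_points_measurable]) simp
  ultimately have "space M - (\<Union>i. (num_base_points Y -` {i<..} \<inter> space M) \<inter> ((\<lambda>\<omega>. (Y i \<omega>, S i \<omega>)) -` A \<inter> space M)) \<in> sets M"
    by (intro sets.Diff sets.top sets.countable_UN sets.Int) auto
  also have "space M - (\<Union>i. (num_base_points Y -` {i<..} \<inter> space M) \<inter> ((\<lambda>\<omega>. (Y i \<omega>, S i \<omega>)) -` A \<inter> space M)) =
      {\<omega>\<in>space M. \<forall>i<num_base_points Y \<omega>. (Y i \<omega>, S i \<omega>) \<notin> A}"
    by auto
  finally show ?thesis .
qed

definition uncovered :: "'a \<times> real \<Rightarrow> real \<Rightarrow> 'w set" where
  "uncovered x r = {\<omega>\<in>space M. \<forall>i<num_base_points Y \<omega>. (Y i \<omega>, S i \<omega>) \<notin> hits x r}"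

lemma uncovered_measurable [measurable]: "uncovered x r \<in> sets M"
  unfolding uncovered_def by (rule no_base_point_hits_measurable[OF hits_measurable])

text \<open>
  Since covering is monotone in the radius and can be tested on a countable dense set, the event that the
  coverage radius is less than \<open>c\<close> is a countable combination of the events \<open>uncovered x r\<close>.
\<close>

lemma coverage_radius_measurable:
  "random_variable borel (\<lambda>\<omega>. coverage_radius Y S (cball 0 1) \<omega>)"
proof (rule borel_measurableI_less)
  fix c :: ereal
  obtain D :: "('a \<times> real) set" where D: "countable D" "D \<subseteq> unit_cube" "unit_cube \<subseteq> closure D"
    using separable by blast
  let ?R = "{r\<in>\<rat>. 0 \<le> r \<and> ereal r < c}"
  have "countable ?R" by (rule countable_subset[OF _ countable_rat]) auto
  then have "(\<Union>r\<in>?R. space M - (\<Union>x\<in>D. uncovered x r)) \<in> sets M"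
    using D(1) by (intro sets.countable_UN'' sets.Diff sets.top uncovered_measurable)
  also have "(\<Union>r\<in>?R. space M - (\<Union>x\<in>D. uncovered x r)) =
      {\<omega>\<in>space M. coverage_radius Y S (cball 0 1) \<omega> < c}" 
  proof -
    have cov: "\<And>\<omega> r. \<omega> \<in> space M - (\<Union>x\<in>D. uncovered x r) \<longleftrightarrow> \<omega> \<in> space M \<and> covers Y S r \<omega>"
      unfolding covers_dense_iff[OF D(2,3)] uncovered_def by blast
    have rational: "\<exists>r\<in>?R. covers Y S r \<omega>" if r: "r \<ge> 0" "ereal r < c" "covers Y S r \<omega>" for r \<omega>
    proof -
      obtain b where b: "ereal r < ereal b" "ereal b < c" using ereal_dense2[OF r(2)] by blast
      then obtain q where q: "q \<in> \<rat>" "r < q" "q < b" using Rats_dense_in_real[of r b] by auto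
      then have "ereal q < c" using b(2) by (meson ereal_less_eq(3) less_imp_le order_le_less_trans)
      then show ?thesis using q r covers_mono[OF r(3), of q] by (intro bexI[of _ q]) auto
    qed
    have "\<omega> \<in> (\<Union>r\<in>?R. space M - (\<Union>x\<in>D. uncovered x r)) \<longleftrightarrow> \<omega> \<in> space M \<and> (\<exists>r\<in>?R. covers Y S r \<omega>)" for \<omega>
      by (simp only: UN_iff cov) blast
    moreover have "(\<exists>r\<in>?R. covers Y S r \<omega>) \<longleftrightarrow> coverage_radius Y S (cball 0 1) \<omega> < c" for \<omega>
      unfolding coverage_radius_less_iff using rational by blast
    ultimately show ?thesis by (simp only: set_eq_iff mem_Collect_eq) blast
  qed
  finally show "{\<omega>\<in>space M. coverage_radius Y S (cball 0 1) \<omega> < c} \<in> sets M" .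
qed

text \<open>
  Almost surely the indices below \<open>num_base_points Y \<omega>\<close> are exactly those of the points in the cube.
\<close>

lemma void_probability_base_points:
  assumes A [measurable]: "A \<in> sets (borel \<Otimes>\<^sub>M borel)" and \<rho>: "0 \<le> \<rho>"
  shows "prob {\<omega>\<in>space M. \<forall>i<num_base_points Y \<omega>. (Y i \<omega>, S i \<omega>) \<notin> A} =
    exp (- \<rho> * (LINT y:unit_cube|lborel. measure Q (Pair y -` A)))"
proof -
  have [measurable]: "(unit_cube :: 'a set) \<in> sets borel" by (simp add: unit_cube_def)
  note no_base_point_hits_measurable[OF A]
  moreover have "{\<omega>\<in>space M. \<forall>i. Y i \<omega> \<in> unit_cube \<longrightarrow> (Y i \<omega>, S i \<omega>) \<notin> A} \<in> sets M" by measurable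
  ultimately have "prob {\<omega>\<in>space M. \<forall>i<num_base_points Y \<omega>. (Y i \<omega>, S i \<omega>) \<notin> A} =
      prob {\<omega>\<in>space M. \<forall>i. Y i \<omega> \<in> unit_cube \<longrightarrow> (Y i \<omega>, S i \<omega>) \<notin> A}"
    using base_points_first by (intro finite_measure_eq_AE) (auto simp: set_eq_iff elim!: eventually_mono)
  also have "\<dots> = exp (- \<rho> * (LINT y:unit_cube|lborel. measure Q (Pair y -` A)))"
    using \<rho> by (intro void_probability) (auto simp: unit_cube_def emeasure_lborel_cbox_eq)
  finally show ?thesis .
qed

end

section \<open>Grids in the unit cube\<close>

lemma unit_cube_iff: "x \<in> unit_cube \<longleftrightarrow> (\<forall>b\<in>Basis. 0 \<le> x \<bullet> b \<and> x \<bullet> b \<le> 1)"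
  by (simp add: unit_cube_def mem_box)

lemma unit_cube_prod_iff: "x \<in> unit_cube \<longleftrightarrow> fst x \<in> unit_cube \<and> 0 \<le> snd x \<and> snd x \<le> (1::real)"
  for x :: "'a::euclidean_space \<times> real"
  by (cases x) (auto simp: unit_cube_iff Basis_prod_def)

lemma unit_cube_borel [measurable]: "unit_cube \<in> sets borel"
  by (simp add: unit_cube_def)

lemma emeasure_unit_cube: "emeasure lborel unit_cube = 1"
  by (simp add: unit_cube_def emeasure_lborel_cbox_eq)

lemma measure_unit_cube [simp]: "measure lborel unit_cube = 1"
  by (simp add: measure_def emeasure_unit_cube)

lemma norm_diff_unit_cube_le:
  fixes x y :: "'a::euclidean_space"
  assumes "x \<in> unit_cube" "y \<in> unit_cube"
  shows "norm (x - y) \<le> DIM('a)"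
proof -
  have "norm (x - y) \<le> (\<Sum>b\<in>Basis. \<bar>(x - y) \<bullet> b\<bar>)" by (rule norm_le_l1)
  also have "\<dots> \<le> (\<Sum>b\<in>(Basis::'a set). 1)"
    using assms by (intro sum_mono) (fastforce simp: unit_cube_iff inner_diff_left abs_le_iff)
  finally show ?thesis by simp
qed

lemma unit_cube_segment:
  assumes "x \<in> unit_cube" "y \<in> unit_cube" "0 \<le> t" "t \<le> 1"
  shows "(1 - t) *\<^sub>R x + t *\<^sub>R y \<in> unit_cube"
  using convex_box(1)[of 0 One] assms unfolding unit_cube_def by (auto simp: convex_alt)

definition grid :: "nat \<Rightarrow> 'a::euclidean_space set" where
  "grid m = (\<lambda>j. \<Sum>b\<in>Basis. (real (j b) / real m) *\<^sub>R b) ` (Basis \<rightarrow>\<^sub>E {0..m})"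

lemma inner_grid_point:
  "b \<in> Basis \<Longrightarrow> (\<Sum>b\<in>Basis. (real (j b) / real m) *\<^sub>R b) \<bullet> b = real (j b) / real m"
  by (simp add: inner_sum_left_Basis)

lemma finite_grid: "finite (grid m)"
  unfolding grid_def by (intro finite_imageI finite_PiE) auto

lemma card_grid:
  assumes m: "0 < m"
  shows "card (grid m :: 'a::euclidean_space set) = (m + 1) ^ DIM('a)"
proof -
  have "inj_on (\<lambda>j. \<Sum>b\<in>Basis. (real (j b) / real m) *\<^sub>R (b :: 'a)) (Basis \<rightarrow>\<^sub>E {0..m})"
  proof (rule inj_onI)
    fix j k assume j: "j \<in> (Basis :: 'a set) \<rightarrow>\<^sub>E {0..m}" and k: "k \<in> (Basis :: 'a set) \<rightarrow>\<^sub>E {0..m}"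
      and eq: "(\<Sum>b\<in>Basis. (real (j b) / real m) *\<^sub>R (b :: 'a)) = (\<Sum>b\<in>Basis. (real (k b) / real m) *\<^sub>R b)"
    show "j = k"
    proof (rule PiE_ext[OF j k])
      fix b :: 'a assume "b \<in> Basis"
      then have "real (j b) / real m = real (k b) / real m"
        using arg_cong[OF eq, of "\<lambda>v. v \<bullet> b"] by (simp add: inner_grid_point)
      then show "j b = k b" using m by simp
    qed
  qed
  then show ?thesis unfolding grid_def by (simp add: card_image card_PiE)
qed

lemma grid_subset_unit_cube: "grid m \<subseteq> unit_cube"
proof
  fix x assume "x \<in> grid m"
  then obtain j where j: "j \<in> Basis \<rightarrow>\<^sub>E {0..m}" "x = (\<Sum>b\<in>Basis. (real (j b) / real m) *\<^sub>R b)"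
    by (auto simp: grid_def)
  have "real (j b) / real m \<le> 1" if "b \<in> Basis" for b
    using j(1) that by (auto simp: divide_le_eq_1)
  then show "x \<in> unit_cube" by (auto simp: unit_cube_iff j(2) inner_grid_point)
qed

lemma grid_separated:
  assumes "0 < m" "x \<in> grid m" "x' \<in> grid m" "x \<noteq> x'"
  shows "1 / real m \<le> norm (x - x')"
proof -
  obtain j where j: "x = (\<Sum>b\<in>Basis. (real (j b) / real m) *\<^sub>R b)" using assms by (auto simp: grid_def)
  obtain k where k: "x' = (\<Sum>b\<in>Basis. (real (k b) / real m) *\<^sub>R b)" using assms by (auto simp: grid_def)
  obtain b where b: "b \<in> Basis" "x \<bullet> b \<noteq> x' \<bullet> b"
    using assms(4) euclidean_eqI by blast
  then have "j b \<noteq> k b" by (auto simp: j k inner_grid_point)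
  then have "1 \<le> \<bar>real (j b) - real (k b)\<bar>" by linarith
  then have "1 / real m \<le> \<bar>(x - x') \<bullet> b\<bar>"
    using b(1) assms(1) by (simp add: j k inner_diff_left inner_grid_point divide_right_mono flip: diff_divide_distrib)
  also have "\<dots> \<le> norm (x - x')" using b(1) by (rule Basis_le_norm)
  finally show ?thesis .
qed

text \<open>
  Coordinates are rounded up, so that the last coordinate of the grid point stays bounded below. The union
  bound uses this near the bottom face of the cube.
\<close>

lemma grid_dense_above:
  fixes z :: "'a::euclidean_space"
  assumes m: "0 < m" and z: "z \<in> unit_cube"
  shows "\<exists>x\<in>grid m. norm (x - z) \<le> DIM('a) / m \<and> (\<forall>b\<in>Basis. z \<bullet> b \<le> x \<bullet> b)"
proof
  define j where "j = restrict (\<lambda>b. nat \<lceil>m * (z \<bullet> b)\<rceil>) Basis"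
  define x where "x = (\<Sum>b\<in>Basis. (real (j b) / real m) *\<^sub>R b)"
  have z01: "0 \<le> m * (z \<bullet> b)" "m * (z \<bullet> b) \<le> m" if "b \<in> Basis" for b
    using z that m by (auto simp: unit_cube_iff mult_left_le)
  have j: "m * (z \<bullet> b) \<le> real (j b)" "real (j b) \<le> m * (z \<bullet> b) + 1" "j b \<le> m" if "b \<in> Basis" for b
  proof -
    have "j b = nat \<lceil>m * (z \<bullet> b)\<rceil>" using that by (simp add: j_def)
    then show "m * (z \<bullet> b) \<le> real (j b)" "real (j b) \<le> m * (z \<bullet> b) + 1" "j b \<le> m"
      using z01[OF that] by linarith+
  qed
  have xb: "x \<bullet> b = real (j b) / m" if "b \<in> Basis" for b
    using that by (simp add: x_def inner_grid_point)
  have "j \<in> Basis \<rightarrow>\<^sub>E {0..m}" using j(3) by (auto simp: j_def)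
  then show "x \<in> grid m" by (auto simp: grid_def x_def)
  have ge: "z \<bullet> b \<le> x \<bullet> b" if "b \<in> Basis" for b
    using j(1)[OF that] m by (simp add: xb[OF that] field_simps)
  have le: "x \<bullet> b - z \<bullet> b \<le> 1 / m" if "b \<in> Basis" for b
  proof -
    have "x \<bullet> b - z \<bullet> b = (real (j b) - m * (z \<bullet> b)) / m" using m by (simp add: xb[OF that] field_simps)
    also have "\<dots> \<le> 1 / m" using j(2)[OF that] m by (intro divide_right_mono) auto
    finally show ?thesis .
  qed
  have "norm (x - z) \<le> (\<Sum>b\<in>Basis. \<bar>(x - z) \<bullet> b\<bar>)" by (rule norm_le_l1)
  also have "\<dots> \<le> (\<Sum>b\<in>(Basis::'a set). 1 / m)"
    using ge le by (intro sum_mono) (simp add: inner_diff_left)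
  finally show "norm (x - z) \<le> DIM('a) / m \<and> (\<forall>b\<in>Basis. z \<bullet> b \<le> x \<bullet> b)"
    using ge by simp
qed

section \<open>The function phi\<close>

lemma snd_le_norm_base: "snd x \<le> norm ((y, 0) - x)" for x :: "'a::euclidean_space \<times> real"
  using abs_snd_le_norm[of "(y, 0) - x"] by simp

lemma norm_base_le:
  fixes x :: "'a::euclidean_space \<times> real"
  assumes "x \<in> unit_cube" "y \<in> unit_cube"
  shows "norm ((y, 0) - x) \<le> DIM('a) + 1"
  using norm_diff_unit_cube_le[of "(y, 0)" x] assms by (simp add: unit_cube_prod_iff)

lemma one_div_power_antimono: "0 < a \<Longrightarrow> a \<le> b \<Longrightarrow> 1 / b ^ n \<le> 1 / (a::real) ^ n"
  by (intro divide_left_mono power_mono) auto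

lemma phi_integrable:
  fixes x :: "'a::euclidean_space \<times> real"
  assumes "0 < snd x"
  shows "set_integrable lborel unit_cube (\<lambda>y. 1 / norm ((y, 0) - x) ^ DIM('a))"
  unfolding set_integrable_def
proof (rule integrableI_bounded_set_indicator[where B="1 / snd x ^ DIM('a)"])
  show "AE y in lborel. y \<in> unit_cube \<longrightarrow> norm (1 / norm ((y, 0) - x) ^ DIM('a)) \<le> 1 / snd x ^ DIM('a)"
    using assms snd_le_norm_base[of x]
    by (intro AE_I2) (auto intro: one_div_power_antimono[of "snd x"])
qed (auto simp: emeasure_unit_cube)

lemma phi_ge:
  fixes x :: "'a::euclidean_space \<times> real"
  assumes x: "x \<in> unit_cube" "0 < snd x"
  shows "1 / (real DIM('a) + 1) ^ DIM('a) \<le> phi x"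
proof -
  have "(LINT y:(unit_cube :: 'a set)|lborel. 1 / (real DIM('a) + 1) ^ DIM('a)) \<le> phi x"
    unfolding phi_def
  proof (intro set_integral_mono phi_integrable)
    fix y :: 'a assume y: "y \<in> unit_cube"
    have "0 < norm ((y, 0) - x)" using snd_le_norm_base[of x y] x by linarith
    then show "1 / (real DIM('a) + 1) ^ DIM('a) \<le> 1 / norm ((y, 0) - x) ^ DIM('a)"
      using norm_base_le[OF x(1) y] by (intro one_div_power_antimono) auto
  qed (use x in \<open>auto simp: set_integrable_def emeasure_unit_cube\<close>)
  then show ?thesis by (simp add: set_lebesgue_integral_def)
qed

text \<open>
  All points of the base space are at distance at least \<open>snd x\<close> from \<open>x\<close>, so a displacement of \<open>x\<close> by at most
  \<open>\<delta> * snd x\<close> shortens each of these distances at most by the factor \<open>1 - \<delta>\<close>.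
\<close>

lemma phi_nearby:
  fixes x x' :: "'a::euclidean_space \<times> real"
  assumes x: "0 < snd x" and near: "norm (x' - x) \<le> \<delta> * snd x" and \<delta>: "\<delta> < 1"
  shows "(1 - \<delta>) * snd x \<le> snd x'" and "phi x' \<le> phi x / (1 - \<delta>) ^ DIM('a)"
proof -
  have "\<bar>snd (x' - x)\<bar> \<le> \<delta> * snd x" using abs_snd_le_norm[of "x' - x"] near by linarith
  then show h: "(1 - \<delta>) * snd x \<le> snd x'" by (simp add: algebra_simps)
  have "0 \<le> \<delta> * snd x" using near norm_ge_zero order_trans by blast
  then have \<delta>0: "0 \<le> \<delta>" using x by (simp add: zero_le_mult_iff)
  have x': "0 < snd x'" using h x \<delta> by (intro less_le_trans[OF _ h]) simp
  have "phi x' \<le> (LINT y:unit_cube|lborel. (1 / norm ((y, 0) - x) ^ DIM('a)) * (1 / (1 - \<delta>) ^ DIM('a)))"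
    unfolding phi_def
  proof (intro set_integral_mono phi_integrable set_integrable_mult_left x x')
    fix y :: 'a
    have V: "snd x \<le> norm ((y, 0) - x)" by (rule snd_le_norm_base)
    have "norm ((y, 0) - x) \<le> norm ((y, 0) - x') + norm (x' - x)"
      by (rule order_trans[OF _ norm_triangle_ineq]) simp
    moreover have "norm (x' - x) \<le> \<delta> * norm ((y, 0) - x)"
      using near mult_left_mono[OF V \<delta>0] by linarith
    ultimately have "norm ((y, 0) - x) * (1 - \<delta>) \<le> norm ((y, 0) - x')" by (simp add: algebra_simps)
    moreover have "0 < norm ((y, 0) - x) * (1 - \<delta>)" using V x \<delta> by (intro mult_pos_pos) linarith+
    ultimately have "1 / norm ((y, 0) - x') ^ DIM('a) \<le> 1 / (norm ((y, 0) - x) * (1 - \<delta>)) ^ DIM('a)"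
      by (intro one_div_power_antimono)
    then show "1 / norm ((y, 0) - x') ^ DIM('a) \<le> (1 / norm ((y, 0) - x) ^ DIM('a)) * (1 / (1 - \<delta>) ^ DIM('a))"
      by (simp add: power_mult_distrib)
  qed
  also have "\<dots> = phi x * (1 / (1 - \<delta>) ^ DIM('a))"
    unfolding phi_def by (rule set_integral_mult_left)
  finally show "phi x' \<le> phi x / (1 - \<delta>) ^ DIM('a)" by simp
qed

text \<open>
  The nonzero terms are those with \<open>w k\<close> at least \<open>V\<close>. They at least double from one to the next, so that the
  sum is at most twice the last of them, and that one is at most \<open>1 / V ^ n\<close>.
\<close>

lemma sum_dyadic_le:
  fixes V a :: real
  assumes V: "0 < V" and a: "0 < a" and n: "0 < n"
  defines "w \<equiv> \<lambda>k. a / 2 ^ k"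
  shows "(\<Sum>k\<le>K. of_bool (V \<le> w k) / w k ^ n) \<le> 2 / V ^ n"
proof -
  have w: "0 < w k" for k using a by (simp add: w_def)
  have half: "1 / w k ^ n \<le> (1 / w (Suc k) ^ n) / 2" for k
  proof -
    have "1 / w (Suc k) ^ n = 2 ^ n * (1 / w k ^ n)"
      using a by (simp add: w_def power_divide power_mult_distrib field_simps)
    moreover have "(2::real) ^ 1 \<le> 2 ^ n" using n by (intro power_increasing) auto
    ultimately show ?thesis using mult_right_mono[of 2 "2 ^ n" "1 / w k ^ n"] w[of k] by simp
  qed
  have "(\<Sum>k\<le>K. of_bool (V \<le> w k) / w k ^ n) \<le> 2 / V ^ n \<and> (\<Sum>k\<le>K. of_bool (V \<le> w k) / w k ^ n) \<le> 2 / w K ^ n"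
  proof (induction K)
    case 0
    show ?case
    proof (cases "V \<le> w 0")
      case True
      then have "1 / w 0 ^ n \<le> 1 / V ^ n" using V by (intro one_div_power_antimono)
      moreover have "0 \<le> 1 / V ^ n" "0 \<le> 1 / w 0 ^ n" using V w[of 0] by simp_all
      moreover have "2 / V ^ n = 2 * (1 / V ^ n)" "2 / w 0 ^ n = 2 * (1 / w 0 ^ n)" by simp_all
      moreover have "(\<Sum>k\<le>0. of_bool (V \<le> w k) / w k ^ n) = 1 / w 0 ^ n" using True by simp
      ultimately show ?thesis by linarith
    next
      case False
      moreover have "0 \<le> 2 / V ^ n" "0 \<le> 2 / w 0 ^ n" using V w[of 0] by simp_all
      ultimately show ?thesis by simp
    qed
  next
    case (Suc K)
    let ?f = "\<Sum>k\<le>K. of_bool (V \<le> w k) / w k ^ n"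
    have b: "?f + 1 / w (Suc K) ^ n \<le> 2 / w (Suc K) ^ n"
      using Suc.IH half[of K] by simp
    show ?case
    proof (cases "V \<le> w (Suc K)")
      case True
      then have "1 / w (Suc K) ^ n \<le> 1 / V ^ n" using V w by (intro divide_left_mono power_mono) auto
      with b True show ?thesis by simp
    next
      case False
      moreover have "0 \<le> 1 / w (Suc K) ^ n" using w[of "Suc K"] by simp
      moreover have "(\<Sum>k\<le>Suc K. of_bool (V \<le> w k) / w k ^ n) = ?f" using False by simp
      ultimately show ?thesis using b Suc.IH by linarith
    qed
  qed
  then show ?thesis by blast
qed

text \<open>
  The divergence of \<open>phi\<close> at the bottom face is logarithmic: every dyadic scale between the height of \<open>x\<close>
  and 1 contributes at least a fixed amount. The copy of the cube shrunk by \<open>2 ^ k\<close> towards the foot of \<open>x\<close>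
  stays in the cube by convexity and supplies the volume at scale \<open>k\<close>.
\<close>

lemma phi_blowup:
  fixes x :: "'a::euclidean_space \<times> real"
  assumes x: "x \<in> unit_cube" "0 < snd x" "snd x \<le> 1 / 2 ^ K"
  shows "(real K + 1) / (2 * (real DIM('a) + 1) ^ DIM('a)) \<le> phi x"
proof -
  let ?n = "DIM('a)"
  define w where "w k = (real ?n + 1) / 2 ^ k" for k :: nat
  define B where "B k = {y \<in> unit_cube. norm ((y, 0) - x) \<le> w k}" for k
  have B [measurable]: "B k \<in> sets borel" for k unfolding B_def by measurable
  have w: "0 < w k" for k by (simp add: w_def)
  have vol: "1 / (2 ^ k) ^ ?n \<le> measure lborel (B k)" if k: "k \<le> K" for k
  proof -
    define t where "t = 1 / (2::real) ^ k"
    have t: "0 \<le> t" "t \<le> 1" by (simp_all add: t_def)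
    have xt: "snd x \<le> t"
      using x(3) k by (simp add: t_def) (smt (verit, best) frac_le power_increasing_iff zero_less_power)
    define a where "a = (1 - t) *\<^sub>R fst x"
    have "cbox a (a + t *\<^sub>R One) \<subseteq> B k"
    proof
      fix y assume y: "y \<in> cbox a (a + t *\<^sub>R One)"
      define z where "z = (y - a) /\<^sub>R t"
      have tpos: "0 < t" by (simp add: t_def)
      have z: "z \<in> unit_cube"
        using y tpos by (auto simp: unit_cube_iff z_def mem_box inner_diff_left inner_add_left field_simps)
      have y_eq: "y = (1 - t) *\<^sub>R fst x + t *\<^sub>R z" using tpos by (simp add: z_def a_def)
      have fx: "fst x \<in> unit_cube" using x by (simp add: unit_cube_prod_iff)
      have "y - fst x = t *\<^sub>R (z - fst x)" by (simp add: y_eq algebra_simps)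
      then have "norm (y - fst x) = t * norm (z - fst x)" using tpos by simp
      also have "\<dots> \<le> t * ?n"
        using t norm_diff_unit_cube_le[OF z fx] by (intro mult_left_mono) auto
      finally have "norm ((y, 0) - x) \<le> t * ?n + t"
        using norm_Pair_le[of "y - fst x" "0 - snd x"] xt x(2) by (cases x) simp
      also have "\<dots> = w k" by (simp add: w_def t_def field_simps)
      finally show "y \<in> B k"
        using unit_cube_segment[OF fx z t] by (simp add: B_def y_eq)
    qed
    then have "measure lborel (cbox a (a + t *\<^sub>R One)) \<le> measure lborel (B k)"
      using emeasure_mono[of "B k" unit_cube lborel]
      by (intro measure_mono_fmeasurable fmeasurableI) (auto simp: B_def emeasure_unit_cube intro: le_less_trans)
    moreover have "measure lborel (cbox a (a + t *\<^sub>R One)) = t ^ ?n"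
      using t by (simp add: measure_lborel_cbox_eq inner_add_left)
    ultimately show ?thesis by (simp add: t_def power_divide)
  qed
  have fin: "emeasure lborel (B k) < \<infinity>" for k
    using emeasure_mono[of "B k" unit_cube lborel] by (auto simp: B_def emeasure_unit_cube intro: le_less_trans)
  have "(real K + 1) / (real ?n + 1) ^ ?n = (\<Sum>k\<le>K. (1 / w k ^ ?n) * (1 / (2 ^ k) ^ ?n))"
    by (simp add: w_def power_divide)
  also have "\<dots> \<le> (\<Sum>k\<le>K. (1 / w k ^ ?n) * measure lborel (B k))"
    using vol w by (intro sum_mono mult_left_mono) (auto simp: less_imp_le)
  also have "\<dots> = (LINT y|lborel. (\<Sum>k\<le>K. (1 / w k ^ ?n) * indicator (B k) y))"
    using fin by (subst Bochner_Integration.integral_sum) (auto intro!: integrable_real_indicator)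
  also have "\<dots> \<le> (LINT y|lborel. 2 * (indicator unit_cube y *\<^sub>R (1 / norm ((y, 0) - x) ^ ?n)))"
  proof (rule integral_mono)
    show "integrable lborel (\<lambda>y. \<Sum>k\<le>K. (1 / w k ^ ?n) * indicator (B k) y)"
      using fin by (auto intro!: integrable_sum integrable_real_indicator)
    show "integrable lborel (\<lambda>y. 2 * (indicator unit_cube y *\<^sub>R (1 / norm ((y, 0) - x) ^ ?n)))"
      using phi_integrable[OF x(2)] unfolding set_integrable_def by (intro integrable_mult_right)
    fix y :: 'a
    have V: "0 < norm ((y, 0) - x)" using snd_le_norm_base[of x y] x by linarith
    have "(\<Sum>k\<le>K. (1 / w k ^ ?n) * indicator (B k) y) =
        indicator unit_cube y * (\<Sum>k\<le>K. of_bool (norm ((y, 0) - x) \<le> w k) / w k ^ ?n)"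
      by (auto simp: B_def indicator_def intro!: sum.cong)
    also have "\<dots> \<le> indicator unit_cube y * (2 / norm ((y, 0) - x) ^ ?n)"
      unfolding w_def by (intro mult_left_mono sum_dyadic_le V) auto
    also have "\<dots> = 2 * (indicator unit_cube y *\<^sub>R (1 / norm ((y, 0) - x) ^ ?n))" by simp
    finally show "(\<Sum>k\<le>K. (1 / w k ^ ?n) * indicator (B k) y) \<le>
        2 * (indicator unit_cube y *\<^sub>R (1 / norm ((y, 0) - x) ^ ?n))" .
  qed
  also have "\<dots> = 2 * phi x"
    unfolding phi_def set_lebesgue_integral_def by (rule integral_mult_right_zero)
  finally show ?thesis by (simp add: field_simps)
qed

text \<open>
  The argument only fixes the space, which does not occur in the type of the value.
\<close>

definition phi_inf :: "'a::euclidean_space itself \<Rightarrow> real" where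
  "phi_inf _ = (INF x \<in> (unit_cube :: 'a set) \<times> {0<..1}. phi x)"

lemma phi_inf_pos: "0 < phi_inf TYPE('a::euclidean_space)"
  and phi_inf_le: "x \<in> unit_cube \<Longrightarrow> 0 < snd x \<Longrightarrow> phi_inf TYPE('a) \<le> phi (x :: 'a \<times> real)"
  and phi_inf_approx: "phi_inf TYPE('a) < c \<Longrightarrow> \<exists>x::'a \<times> real. x \<in> unit_cube \<and> 0 < snd x \<and> phi x < c"
proof -
  let ?X = "(unit_cube :: 'a set) \<times> {0<..1::real}"
  have X: "x \<in> ?X \<longleftrightarrow> x \<in> unit_cube \<and> 0 < snd x" for x
    by (cases x) (auto simp: unit_cube_prod_iff)
  have "(0, 1) \<in> ?X" by (auto simp: unit_cube_iff)
  then have ne: "?X \<noteq> {}" by blast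
  have low: "1 / (real DIM('a) + 1) ^ DIM('a) \<le> phi x" if "x \<in> ?X" for x
    using that X by (intro phi_ge) auto
  then have bdd: "bdd_below (phi ` ?X)" by (auto simp: bdd_below_def)
  have "0 < 1 / (real DIM('a) + 1) ^ DIM('a)" by simp
  also have "\<dots> \<le> phi_inf TYPE('a)" unfolding phi_inf_def by (intro cINF_greatest ne low)
  finally show "0 < phi_inf TYPE('a)" .
  show "phi_inf TYPE('a) \<le> phi x" if "x \<in> unit_cube" "0 < snd x" for x :: "'a \<times> real"
    unfolding phi_inf_def using that X by (intro cINF_lower bdd) blast
  show "\<exists>x::'a \<times> real. x \<in> unit_cube \<and> 0 < snd x \<and> phi x < c" if "phi_inf TYPE('a) < c"
    using that X unfolding phi_inf_def cINF_less_iff[OF ne bdd] by blast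
qed

section \<open>Rays through two balls\<close>

lemma norm_fst_le_norm: "norm (fst v) \<le> norm (v :: 'a::euclidean_space \<times> real)"
  using norm_fst_le[of "fst v" "snd v"] by simp

lemma norm_le_fst_snd: "norm v \<le> norm (fst v) + \<bar>snd (v :: 'a::euclidean_space \<times> real)\<bar>"
  using norm_Pair_le[of "fst v" "snd v"] by simp

text \<open>
  A ray from the cube to a small ball whose centre has height at least \<open>h\<close> cannot be too flat. Its horizontal displacement per unit
  of height is therefore bounded by \<open>C\<close>, and its horizontal position at the height of the centre is still
  within \<open>r * (1 + C)\<close> of the centre.
\<close>

lemma hit_slope:
  fixes x :: "'a::euclidean_space \<times> real"
  assumes x: "x \<in> unit_cube" "h \<le> snd x" and r: "0 < r" "r \<le> h / 2"
    and y: "y \<in> unit_cube" and hit: "(y, s) \<in> hits x r"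
  defines "C \<equiv> 2 * (real DIM('a) + 1) / h"
  shows "0 < snd s" "norm (fst s /\<^sub>R snd s) \<le> C" "norm (y + snd x *\<^sub>R (fst s /\<^sub>R snd s) - fst x) \<le> r * (1 + C)"
proof -
  obtain t where t: "0 \<le> t" and "norm ((y, 0) + t *\<^sub>R s - x) \<le> r" using hit by (auto simp: hits_def)
  then have fst_le: "norm (y + t *\<^sub>R fst s - fst x) \<le> r" and snd_le: "\<bar>t * snd s - snd x\<bar> \<le> r"
    using norm_fst_le_norm[of "(y, 0) + t *\<^sub>R s - x"] abs_snd_le_norm[of "(y, 0) + t *\<^sub>R s - x"]
    by simp_all
  have h: "0 < h" "h \<le> 1" using r x by (auto simp: unit_cube_prod_iff)
  have ts: "h / 2 \<le> t * snd s" using snd_le x(2) r(2) by linarith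
  then have "0 < t * snd s" using h by linarith
  then have "t \<noteq> 0" by auto
  with t have tpos: "0 < t" by simp
  with \<open>0 < t * snd s\<close> show spos: "0 < snd s" by (simp add: zero_less_mult_iff)
  define \<sigma> where "\<sigma> = fst s /\<^sub>R snd s"
  have ts\<sigma>: "(t * snd s) *\<^sub>R \<sigma> = t *\<^sub>R fst s" using spos by (simp add: \<sigma>_def)
  have "norm (t *\<^sub>R fst s) \<le> norm (y + t *\<^sub>R fst s - fst x) + norm (fst x - y)"
    by (rule order_trans[OF _ norm_triangle_ineq]) simp
  also have "\<dots> \<le> r + real DIM('a)"
    using fst_le norm_diff_unit_cube_le[of "fst x" y] x(1) y by (simp add: unit_cube_prod_iff)
  also have "\<dots> \<le> real DIM('a) + 1" using r h by simp
  finally have "(t * snd s) * norm \<sigma> \<le> real DIM('a) + 1"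
    using ts\<sigma> \<open>0 < t * snd s\<close> by (metis abs_of_pos norm_scaleR)
  moreover have "(h / 2) * norm \<sigma> \<le> (t * snd s) * norm \<sigma>" using ts by (intro mult_right_mono) auto
  ultimately have "(h / 2) * norm \<sigma> \<le> real DIM('a) + 1" by linarith
  then have "norm \<sigma> \<le> C"
    using h by (simp add: C_def field_simps)
  then show \<sigma>_le: "norm (fst s /\<^sub>R snd s) \<le> C" by (simp only: \<sigma>_def)
  have "norm (y + snd x *\<^sub>R \<sigma> - fst x) \<le> norm (y + t *\<^sub>R fst s - fst x) + norm ((snd x - t * snd s) *\<^sub>R \<sigma>)"
    by (rule order_trans[OF _ norm_triangle_ineq]) (simp add: scaleR_diff_left ts\<sigma> algebra_simps)
  also have "\<dots> \<le> r + r * C"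
    using fst_le snd_le \<sigma>_le unfolding norm_scaleR \<sigma>_def
    by (intro add_mono mult_mono) auto
  finally show "norm (y + snd x *\<^sub>R (fst s /\<^sub>R snd s) - fst x) \<le> r * (1 + C)"
    by (simp add: \<sigma>_def algebra_simps)
qed

text \<open>
  The horizontal position of a ray is an affine function of the height. It is known up to \<open>r * (1 + C)\<close> at the
  heights of \<open>x\<close> and \<open>x'\<close>, hence by extrapolation also at height 0, where it is the base point \<open>y\<close>. Because
  of the bounded slope, two distant centres near the ray have heights that differ by at least
  \<open>D / (2 * (1 + C))\<close>, and this controls the extrapolation error.
\<close>

lemma hits_two_balls_shadow:
  fixes x x' :: "'a::euclidean_space \<times> real"
  assumes x: "x \<in> unit_cube" "h \<le> snd x" and x': "x' \<in> unit_cube" "h \<le> snd x'" and r: "0 < r" "r \<le> h / 2"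
    and y: "y \<in> unit_cube" and hit: "(y, s) \<in> hits x r" "(y, s) \<in> hits x' r"
  defines "C \<equiv> 2 * (real DIM('a) + 1) / h"
  assumes D: "D \<le> norm (x - x')" "4 * (r * (1 + C)) \<le> D"
  shows "norm (y - (snd x' *\<^sub>R fst x - snd x *\<^sub>R fst x') /\<^sub>R (snd x' - snd x)) \<le> 4 * r * (1 + C)\<^sup>2 / D"
proof -
  define \<sigma> where "\<sigma> = fst s /\<^sub>R snd s"
  define E where "E = r * (1 + C)"
  define u where "u = y + snd x *\<^sub>R \<sigma> - fst x"
  define u' where "u' = y + snd x' *\<^sub>R \<sigma> - fst x'"
  define \<Delta> where "\<Delta> = snd x' - snd x"
  have h: "0 < h" using r by linarith
  then have C: "0 \<le> C" by (simp add: C_def)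
  have E: "0 < E" using r C by (simp add: E_def)
  have Dpos: "0 < D" using D(2) E by (simp add: E_def)
  have \<sigma>: "norm \<sigma> \<le> C" and u: "norm u \<le> E" and u': "norm u' \<le> E"
    using hit_slope[OF x r y hit(1)] hit_slope[OF x' r y hit(2)] by (simp_all add: \<sigma>_def u_def u'_def C_def E_def)
  have "norm (x - x') \<le> norm (fst (x' - x)) + \<bar>snd (x' - x)\<bar>"
    unfolding norm_minus_commute[of x] by (rule norm_le_fst_snd)
  also have "fst (x' - x) = \<Delta> *\<^sub>R \<sigma> + (u - u')" by (simp add: \<Delta>_def u_def u'_def algebra_simps)
  also have "norm (\<Delta> *\<^sub>R \<sigma> + (u - u')) \<le> \<bar>\<Delta>\<bar> * C + (E + E)"
    using \<sigma> u u' by (intro order_trans[OF norm_triangle_ineq] add_mono order_trans[OF norm_triangle_ineq4])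
      (auto intro: mult_left_mono)
  also have "\<bar>snd (x' - x)\<bar> = \<bar>\<Delta>\<bar>" by (simp add: \<Delta>_def)
  finally have "D \<le> \<bar>\<Delta>\<bar> * (1 + C) + 2 * E" using D(1) by (simp add: algebra_simps)
  then have \<Delta>: "D / 2 \<le> \<bar>\<Delta>\<bar> * (1 + C)" using D(2) by (simp add: E_def)
  have "\<bar>\<Delta>\<bar> \<noteq> 0"
  proof
    assume "\<bar>\<Delta>\<bar> = 0"
    then show False using \<Delta> Dpos by simp
  qed
  then have \<Delta>pos: "0 < \<bar>\<Delta>\<bar>" by linarith
  have "snd x' *\<^sub>R u - snd x *\<^sub>R u' = \<Delta> *\<^sub>R y - (snd x' *\<^sub>R fst x - snd x *\<^sub>R fst x')"
    by (simp add: \<Delta>_def u_def u'_def algebra_simps)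
  moreover have "\<Delta> *\<^sub>R (y - w /\<^sub>R \<Delta>) = \<Delta> *\<^sub>R y - w" for w
    using \<Delta>pos by (simp add: scaleR_diff_right)
  ultimately have "\<bar>\<Delta>\<bar> * norm (y - (snd x' *\<^sub>R fst x - snd x *\<^sub>R fst x') /\<^sub>R \<Delta>) = norm (snd x' *\<^sub>R u - snd x *\<^sub>R u')"
    by (metis norm_scaleR)
  also have "\<dots> \<le> norm (snd x' *\<^sub>R u) + norm (snd x *\<^sub>R u')" by (rule norm_triangle_ineq4)
  also have "\<dots> \<le> 1 * E + 1 * E"
    using u u' x x' unfolding norm_scaleR by (intro add_mono mult_mono) (auto simp: unit_cube_prod_iff)
  finally have "\<bar>\<Delta>\<bar> * norm (y - (snd x' *\<^sub>R fst x - snd x *\<^sub>R fst x') /\<^sub>R \<Delta>) \<le> 2 * E" by simp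
  then have "norm (y - (snd x' *\<^sub>R fst x - snd x *\<^sub>R fst x') /\<^sub>R \<Delta>) \<le> 2 * E / \<bar>\<Delta>\<bar>"
    using \<Delta>pos by (simp add: field_simps)
  also have "\<dots> \<le> 2 * E / (D / (2 * (1 + C)))"
  proof (rule divide_left_mono)
    show "D / (2 * (1 + C)) \<le> \<bar>\<Delta>\<bar>" using \<Delta> C by (simp add: field_simps)
    show "0 < \<bar>\<Delta>\<bar> * (D / (2 * (1 + C)))" using \<Delta>pos Dpos C by simp
  qed (use E in simp)
  also have "\<dots> = 4 * r * (1 + C)\<^sup>2 / D" by (simp add: E_def power2_eq_square)
  finally show ?thesis by (simp add: \<Delta>_def)
qed

section \<open>Uncovered points under the uniform law of directions\<close>

locale uniform_cylinder_model = cylinder_model M uniform_hemisphere \<rho> Y S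
  for M :: "'w measure" and \<rho> and Y :: "nat \<Rightarrow> 'w \<Rightarrow> 'a::euclidean_space" and S +
  assumes rho_pos: "0 < \<rho>"
begin

sublocale UH: prob_space "uniform_hemisphere :: ('a \<times> real) measure"
  by (rule prob_space_Q)

lemma hit_prob_integrable:
  fixes A :: "('a \<times> ('a \<times> real)) set"
  assumes A: "A \<in> sets (borel \<Otimes>\<^sub>M borel)"
  shows "set_integrable lborel unit_cube (\<lambda>y::'a. measure uniform_hemisphere (Pair y -` A))"
  unfolding set_integrable_def
proof (rule integrableI_bounded_set_indicator[where B=1])
  show "(\<lambda>y. measure uniform_hemisphere (Pair y -` A)) \<in> borel_measurable lborel"
    unfolding measure_def
    using A by (intro measurable_compose[OF UH.measurable_emeasure_Pair, of A lborel enn2real])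
      (simp_all add: sets_pair_measure_cong[OF sets_lborel sets_Q])
qed (auto simp: emeasure_unit_cube)

lemma prob_uncovered:
  "prob (uncovered x r) = exp (- \<rho> * (LINT y:unit_cube|lborel. measure uniform_hemisphere (Pair y -` hits x r)))"
  unfolding uncovered_def using rho_pos by (intro void_probability_base_points hits_measurable) simp

lemma prob_uncovered_le:
  assumes r: "0 < r" "r \<le> snd x" "r \<le> \<epsilon> * snd x"
  shows "prob (uncovered x r) \<le>
    exp (- \<rho> * (cap_const DIM('a) * r ^ DIM('a) * (1 / sqrt (1 + \<epsilon>\<^sup>2)) ^ (DIM('a) + 1) * phi x))"
proof -
  let ?n = "DIM('a)" and ?c = "(1 / sqrt (1 + \<epsilon>\<^sup>2)) ^ (DIM('a) + 1)"
  have xpos: "0 < snd x" using r by linarith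
  have \<epsilon>: "0 \<le> \<epsilon>" using r(1,3) xpos by (smt (verit) mult_nonpos_nonneg)
  have "cap_const ?n * r ^ ?n * ?c * phi x =
      (LINT y:unit_cube|lborel. (cap_const ?n * r ^ ?n * ?c) * (1 / norm ((y, 0) - x) ^ ?n))"
    unfolding phi_def by (rule set_integral_mult_right[symmetric])
  also have "\<dots> \<le> (LINT y:unit_cube|lborel. measure uniform_hemisphere (Pair y -` hits x r))"
  proof (intro set_integral_mono set_integrable_mult_right phi_integrable xpos hit_prob_integrable hits_measurable)
    fix y :: 'a
    define q where "q = r / norm ((y, 0) - x)"
    have V: "snd x \<le> norm ((y, 0) - x)" by (rule snd_le_norm_base)
    have q0: "0 \<le> q" using r by (simp add: q_def)
    have "q \<le> r / snd x" unfolding q_def using V xpos r by (intro divide_left_mono mult_pos_pos) auto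
    also have "\<dots> \<le> \<epsilon>" using r xpos by (simp add: field_simps)
    finally have "q\<^sup>2 \<le> \<epsilon>\<^sup>2" using q0 by (intro power_mono)
    then have "1 / sqrt (1 + \<epsilon>\<^sup>2) \<le> 1 / sqrt (1 + q\<^sup>2)"
      by (intro divide_left_mono mult_pos_pos) (auto simp: add_pos_nonneg)
    then have "cap_const ?n * q ^ ?n * ?c \<le> cap_const ?n * q ^ ?n * (1 / sqrt (1 + q\<^sup>2)) ^ (?n + 1)"
      using cap_const_pos[of ?n] q0 by (intro mult_left_mono power_mono) auto
    also have "\<dots> \<le> measure uniform_hemisphere (Pair y -` hits x r)"
      by (rule hit_prob_ge[OF r(1,2) q_def])
    also have "cap_const ?n * q ^ ?n * ?c = cap_const ?n * r ^ ?n * ?c * (1 / norm ((y, 0) - x) ^ ?n)"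
      unfolding q_def power_divide[of r] by (simp only: mult_ac times_divide_eq_left times_divide_eq_right mult_1_left mult_1_right)
    finally show "cap_const ?n * r ^ ?n * ?c * (1 / norm ((y, 0) - x) ^ ?n) \<le> measure uniform_hemisphere (Pair y -` hits x r)" .
  qed
  finally show ?thesis
    unfolding prob_uncovered exp_le_cancel_iff using rho_pos by (intro mult_left_mono_neg) auto
qed

lemma prob_uncovered_ge:
  assumes r: "0 < r" "r \<le> \<delta> * snd x" and \<delta>: "\<delta> < 1" and x: "0 < snd x"
  shows "exp (- \<rho> * (cap_const DIM('a) * r ^ DIM('a) / (1 - \<delta>) ^ DIM('a) * phi x)) \<le> prob (uncovered x r)"
proof -
  let ?n = "DIM('a)"
  have \<delta>0: "0 \<le> \<delta>" using r x by (smt (verit) mult_nonpos_nonneg)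
  have "(LINT y:unit_cube|lborel. measure uniform_hemisphere (Pair y -` hits x r)) \<le>
      (LINT y:unit_cube|lborel. (cap_const ?n * r ^ ?n / (1 - \<delta>) ^ ?n) * (1 / norm ((y, 0) - x) ^ ?n))"
  proof (intro set_integral_mono set_integrable_mult_right phi_integrable x hit_prob_integrable hits_measurable)
    fix y :: 'a
    let ?V = "norm ((y, 0) - x)"
    have V: "snd x \<le> ?V" by (rule snd_le_norm_base)
    have rV: "r \<le> \<delta> * ?V" using r(2) mult_left_mono[OF V \<delta>0] by linarith
    have Vpos: "0 < (1 - \<delta>) * ?V" using V x \<delta> by (intro mult_pos_pos) auto
    moreover have le: "(1 - \<delta>) * ?V \<le> ?V - r" using rV by (simp add: algebra_simps)
    ultimately have "r < ?V" by linarith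
    then have "measure uniform_hemisphere (Pair y -` hits x r) \<le> cap_const ?n * (r / (?V - r)) ^ ?n"
      by (rule hit_prob_le[OF r(1)])
    also have "\<dots> \<le> cap_const ?n * (r / ((1 - \<delta>) * ?V)) ^ ?n"
      using cap_const_pos[of ?n] r le Vpos \<open>r < ?V\<close> \<delta> by (intro mult_left_mono power_mono divide_left_mono mult_pos_pos) auto
    finally show "measure uniform_hemisphere (Pair y -` hits x r) \<le> cap_const ?n * r ^ ?n / (1 - \<delta>) ^ ?n * (1 / ?V ^ ?n)"
      by (simp add: power_divide power_mult_distrib)
  qed
  also have "\<dots> = cap_const ?n * r ^ ?n / (1 - \<delta>) ^ ?n * phi x"
    unfolding phi_def by (rule set_integral_mult_right)
  finally show ?thesis
    unfolding prob_uncovered exp_le_cancel_iff using rho_pos by (intro mult_left_mono_neg) auto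
qed

text \<open>
  Inclusion and exclusion in the exponent: marked points that lie in both sets are counted only once.
\<close>

lemma prob_uncovered_both:
  "prob (uncovered x r \<inter> uncovered x' r) = prob (uncovered x r) * prob (uncovered x' r) *
    exp (\<rho> * (LINT y:unit_cube|lborel. measure uniform_hemisphere (Pair y -` (hits x r \<inter> hits x' r))))"
proof -
  have un: "hits x r \<union> hits x' r \<in> sets (borel \<Otimes>\<^sub>M borel)" and int: "hits x r \<inter> hits x' r \<in> sets (borel \<Otimes>\<^sub>M borel)"
    using hits_measurable by (auto intro: sets.Un sets.Int)
  let ?p = "\<lambda>A. (LINT y:unit_cube|lborel. measure uniform_hemisphere (Pair (y::'a) -` A))"
  have "uncovered x r \<inter> uncovered x' r = {\<omega>\<in>space M. \<forall>i<num_base_points Y \<omega>. (Y i \<omega>, S i \<omega>) \<notin> hits x r \<union> hits x' r}"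
    by (auto simp: uncovered_def)
  then have union: "prob (uncovered x r \<inter> uncovered x' r) = exp (- \<rho> * ?p (hits x r \<union> hits x' r))"
    using void_probability_base_points[OF un] rho_pos by simp
  have "?p (hits x r \<union> hits x' r) + ?p (hits x r \<inter> hits x' r) = ?p (hits x r) + ?p (hits x' r)"
  proof -
    have sec: "measure uniform_hemisphere (Pair y -` (hits x r \<union> hits x' r)) + measure uniform_hemisphere (Pair y -` (hits x r \<inter> hits x' r)) =
        measure uniform_hemisphere (Pair y -` hits x r) + measure uniform_hemisphere (Pair y -` hits x' r)" for y
    proof -
      have m: "Pair y -` hits x r \<in> UH.events" "Pair y -` hits x' r \<in> UH.events"
        using hits_section_measurable by simp_all
      have "UH.prob (Pair y -` hits x r \<union> Pair y -` hits x' r) = UH.prob (Pair y -` hits x r) + UH.prob (Pair y -` hits x' r - Pair y -` hits x r)"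
        by (rule UH.finite_measure_Union'[OF m])
      moreover have "UH.prob (Pair y -` hits x' r - Pair y -` hits x r) = UH.prob (Pair y -` hits x' r) - UH.prob (Pair y -` hits x' r \<inter> Pair y -` hits x r)"
        by (rule UH.finite_measure_Diff'[OF m(2,1)])
      ultimately show ?thesis unfolding vimage_Un vimage_Int by (simp only: Int_commute)
    qed
    have "?p (hits x r \<union> hits x' r) + ?p (hits x r \<inter> hits x' r) =
        (LINT y:unit_cube|lborel. measure uniform_hemisphere (Pair y -` (hits x r \<union> hits x' r)) + measure uniform_hemisphere (Pair y -` (hits x r \<inter> hits x' r)))"
      by (rule set_integral_add(2)[symmetric, OF hit_prob_integrable[OF un] hit_prob_integrable[OF int]])
    also have "\<dots> = ?p (hits x r) + ?p (hits x' r)"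
      unfolding sec by (intro set_integral_add hit_prob_integrable hits_measurable)
    finally show ?thesis .
  qed
  then have "?p (hits x r \<union> hits x' r) = ?p (hits x r) + ?p (hits x' r) - ?p (hits x r \<inter> hits x' r)"
    by linarith
  moreover have "exp (- \<rho> * (a + b - c)) = exp (- \<rho> * a) * exp (- \<rho> * b) * exp (\<rho> * c)" for a b c
    by (simp add: algebra_simps flip: exp_add)
  ultimately show ?thesis
    unfolding prob_uncovered union by (simp only:)
qed

text \<open>
  Only base points in the shadow contribute. Its volume is of order \<open>(r / D) ^ n\<close>, and each of them hits
  the first ball with probability of order \<open>r ^ n\<close>.
\<close>

lemma overlap_le:
  fixes x x' :: "'a \<times> real"
  assumes x: "x \<in> unit_cube" "h \<le> snd x" and x': "x' \<in> unit_cube" "h \<le> snd x'" and r: "0 < r" "r \<le> h / 2"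
  defines "C \<equiv> 2 * (real DIM('a) + 1) / h"
  assumes D: "D \<le> norm (x - x')" "4 * (r * (1 + C)) \<le> D"
  shows "(LINT y:unit_cube|lborel. measure uniform_hemisphere (Pair y -` (hits x r \<inter> hits x' r))) \<le>
    cap_const DIM('a) * (2 * r / h) ^ DIM('a) * (unit_ball_vol DIM('a) * (4 * r * (1 + C)\<^sup>2 / D) ^ DIM('a))"
proof -
  let ?n = "DIM('a)"
  define y0 where "y0 = (snd x' *\<^sub>R fst x - snd x *\<^sub>R fst x') /\<^sub>R (snd x' - snd x)"
  define R where "R = 4 * r * (1 + C)\<^sup>2 / D"
  have h: "0 < h" using r by linarith
  then have C: "0 \<le> C" by (simp add: C_def)
  have Dpos: "0 < D" using D(2) r C by (smt (verit) mult_pos_pos)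
  have R: "0 \<le> R" using r Dpos by (simp add: R_def)
  have int: "hits x r \<inter> hits x' r \<in> sets (borel \<Otimes>\<^sub>M borel)" by (intro sets.Int hits_measurable)
  have "(LINT y:unit_cube|lborel. measure uniform_hemisphere (Pair y -` (hits x r \<inter> hits x' r))) \<le>
      (LINT y|lborel. cap_const ?n * (2 * r / h) ^ ?n * indicator (cball y0 R) y)"
    unfolding set_lebesgue_integral_def
  proof (rule integral_mono)
    show "integrable lborel (\<lambda>y. indicator unit_cube y *\<^sub>R measure uniform_hemisphere (Pair y -` (hits x r \<inter> hits x' r)))"
      using hit_prob_integrable[OF int] by (simp only: set_integrable_def)
    show "integrable lborel (\<lambda>y. cap_const ?n * (2 * r / h) ^ ?n * indicator (cball y0 R) y)"
      using emeasure_lborel_cball_finite[of y0 R] by (intro integrable_mult_right integrable_real_indicator) auto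
    fix y :: 'a
    show "indicator unit_cube y *\<^sub>R measure uniform_hemisphere (Pair y -` (hits x r \<inter> hits x' r)) \<le>
        cap_const ?n * (2 * r / h) ^ ?n * indicator (cball y0 R) y"
    proof (cases "y \<in> unit_cube \<and> Pair y -` (hits x r \<inter> hits x' r) \<noteq> {}")
      case True
      then obtain s where s: "(y, s) \<in> hits x r" "(y, s) \<in> hits x' r" by auto
      have "norm (y - y0) \<le> R"
        unfolding y0_def R_def C_def using True
        by (intro hits_two_balls_shadow[OF x x' r _ s] D[unfolded C_def]) auto
      then have "y \<in> cball y0 R" by (simp add: dist_norm norm_minus_commute)
      moreover have "measure uniform_hemisphere (Pair y -` (hits x r \<inter> hits x' r)) \<le> cap_const ?n * (2 * r / h) ^ ?n"
      proof -
        let ?V = "norm ((y, 0) - x)"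
        have V: "h \<le> ?V" using snd_le_norm_base[of x y] x(2) by linarith
        then have V2: "h / 2 \<le> ?V - r" using r by linarith
        then have rV: "r < ?V" using h by linarith
        have "measure uniform_hemisphere (Pair y -` (hits x r \<inter> hits x' r)) \<le> measure uniform_hemisphere (Pair y -` hits x r)"
          using hits_section_measurable[of y x r] by (intro UH.finite_measure_mono) auto
        also have "\<dots> \<le> cap_const ?n * (r / (?V - r)) ^ ?n" by (rule hit_prob_le[OF r(1) rV])
        also have "\<dots> \<le> cap_const ?n * (r / (h / 2)) ^ ?n"
          using cap_const_pos[of ?n] r h V2 by (intro mult_left_mono power_mono divide_left_mono mult_pos_pos) auto
        finally show ?thesis by (simp add: mult.commute)
      qed
      ultimately show ?thesis using True by simp
    next
      case False
      then have "indicator unit_cube y *\<^sub>R measure uniform_hemisphere (Pair y -` (hits x r \<inter> hits x' r)) = 0"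
        by (auto simp: indicator_def)
      moreover have "0 \<le> cap_const ?n * (2 * r / h) ^ ?n * indicator (cball y0 R) y"
        using cap_const_pos[of ?n] r h by (intro mult_nonneg_nonneg) auto
      ultimately show ?thesis by (simp only:)
    qed
  qed
  also have "\<dots> = cap_const ?n * (2 * r / h) ^ ?n * (unit_ball_vol ?n * R ^ ?n)"
    using R by (simp add: content_cball)
  finally show ?thesis by (simp add: R_def)
qed

end

section \<open>Bounds for the coverage radius at fixed intensity\<close>

text \<open>
  Chebyshev's inequality for the number of events \<open>U x\<close> that occur; the diagonal of its second moment
  accounts for \<open>1 / \<mu>\<close> and the other pairs for \<open>c\<close>.
\<close>

lemma (in prob_space) second_moment_bound:
  assumes fin: "finite G" and U [measurable]: "\<And>x. x \<in> G \<Longrightarrow> U x \<in> events"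
    and \<mu>: "0 < \<mu>" "\<mu> \<le> (\<Sum>x\<in>G. prob (U x))" and c: "0 \<le> c"
    and corr: "\<And>x x'. x \<in> G \<Longrightarrow> x' \<in> G \<Longrightarrow> x \<noteq> x' \<Longrightarrow> prob (U x \<inter> U x') \<le> (1 + c) * (prob (U x) * prob (U x'))"
  shows "prob (space M - (\<Union>x\<in>G. U x)) \<le> 1 / \<mu> + c"
proof -
  define W where "W \<omega> = (\<Sum>x\<in>G. indicator (U x) \<omega> :: real)" for \<omega>
  define m where "m = (\<Sum>x\<in>G. prob (U x))"
  have W_meas [measurable]: "random_variable borel W"
    unfolding W_def using U by (intro borel_measurable_sum borel_measurable_indicator)
  have W2: "(W \<omega>)\<^sup>2 = (\<Sum>x\<in>G. \<Sum>x'\<in>G. indicator (U x \<inter> U x') \<omega>)" for \<omega>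
    by (simp add: W_def power2_eq_square sum_product indicator_inter_arith)
  have int1: "integrable M (\<lambda>\<omega>. indicator (U x \<inter> U x') \<omega> :: real)" if "x \<in> G" "x' \<in> G" for x x'
    using U that by (intro integrable_real_indicator) (auto simp: emeasure_eq_measure)
  have int0: "integrable M (\<lambda>\<omega>. indicator (U x) \<omega> :: real)" if "x \<in> G" for x
    using int1[OF that that] by simp
  have "expectation W = m"
    unfolding W_def m_def using int0 U sets.sets_into_space[OF U]
    by (subst Bochner_Integration.integral_sum) (auto intro!: sum.cong arg_cong[where f=prob])
  have EW2: "expectation (\<lambda>\<omega>. (W \<omega>)\<^sup>2) = (\<Sum>x\<in>G. \<Sum>x'\<in>G. prob (U x \<inter> U x'))"
    unfolding W2 using int1 U sets.sets_into_space[OF U]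
    by (subst Bochner_Integration.integral_sum, force)
      (intro sum.cong refl, subst Bochner_Integration.integral_sum, auto intro!: sum.cong arg_cong[where f=prob])
  have int2: "integrable M (\<lambda>\<omega>. (W \<omega>)\<^sup>2)"
    unfolding W2 by (intro Bochner_Integration.integrable_sum int1)
  have intW: "integrable M W"
    unfolding W_def by (intro Bochner_Integration.integrable_sum int0)
  have "(\<Sum>x\<in>G. \<Sum>x'\<in>G. prob (U x \<inter> U x')) \<le> (\<Sum>x\<in>G. \<Sum>x'\<in>G. (1 + c) * (prob (U x) * prob (U x')) + (if x = x' then prob (U x) else 0))"
  proof (intro sum_mono)
    fix x x' assume "x \<in> G" "x' \<in> G"
    then show "prob (U x \<inter> U x') \<le> (1 + c) * (prob (U x) * prob (U x')) + (if x = x' then prob (U x) else 0)"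
      using corr[of x x'] c by auto
  qed
  also have "\<dots> = (1 + c) * (\<Sum>x\<in>G. \<Sum>x'\<in>G. prob (U x) * prob (U x')) + (\<Sum>x\<in>G. prob (U x))"
    using fin by (simp add: sum.distrib sum_distrib_left)
  also have "\<dots> = (1 + c) * m\<^sup>2 + m"
    by (simp add: m_def power2_eq_square sum_product)
  finally have var: "variance W \<le> c * m\<^sup>2 + m"
    using \<open>expectation W = m\<close> variance_eq[OF intW int2] EW2 by (simp add: algebra_simps)
  have m: "0 < m" using \<mu> by (simp add: m_def)
  have "prob (space M - (\<Union>x\<in>G. U x)) \<le> prob {\<omega>\<in>space M. m \<le> \<bar>W \<omega> - expectation W\<bar>}"
  proof (rule finite_measure_mono)
    have "W \<omega> = 0" if "\<omega> \<in> space M - (\<Union>x\<in>G. U x)" for \<omega>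
      using that unfolding W_def by (intro sum.neutral) (auto simp: indicator_def)
    then show "space M - (\<Union>x\<in>G. U x) \<subseteq> {\<omega>\<in>space M. m \<le> \<bar>W \<omega> - expectation W\<bar>}"
      using \<open>expectation W = m\<close> by auto
  qed measurable
  also have "\<dots> \<le> variance W / m\<^sup>2"
    using Chebyshev_inequality[OF W_meas int2 m] .
  also have "\<dots> \<le> (c * m\<^sup>2 + m) / m\<^sup>2"
    using var by (intro divide_right_mono) auto
  also have "\<dots> = 1 / m + c"
    using m by (simp add: field_simps power2_eq_square)
  also have "\<dots> \<le> 1 / \<mu> + c"
    using \<mu> by (intro add_right_mono divide_left_mono mult_pos_pos) (auto simp: m_def)
  finally show ?thesis .
qed

context uniform_cylinder_model begin

text \<open>
  Union bound over the grid points of height at least \<open>r\<close>. Those above \<open>r / \<epsilon>\<close> are tested with balls of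
  radius \<open>r\<close>, seen from the base under a small angle. The others are tested with balls of radius \<open>\<epsilon> * r\<close>; the
  loss of the factor \<open>\<epsilon> ^ n\<close> in the exponent is made up by the hypothesis that \<open>phi\<close> is large at low heights.
\<close>

lemma prob_coverage_radius_gt:
  assumes r: "0 < r" "r \<le> 1" and \<epsilon>: "0 < \<epsilon>" "\<epsilon> \<le> 1 / 2"
    and low: "\<And>x::'a \<times> real. x \<in> unit_cube \<Longrightarrow> 0 < snd x \<Longrightarrow> snd x \<le> r / \<epsilon> \<Longrightarrow> phi_inf TYPE('a) / \<epsilon> ^ DIM('a) \<le> phi x"
    and m: "0 < m" "(real DIM('a) + 1) / real m \<le> \<epsilon> * r"
  shows "prob {\<omega>\<in>space M. ereal ((1 + 2 * \<epsilon>) * r) < coverage_radius Y S (cball 0 1) \<omega>} \<le>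
    real (m + 1) ^ (DIM('a) + 1) *
    exp (- \<rho> * (cap_const DIM('a) * r ^ DIM('a) * (1 / sqrt (1 + \<epsilon>\<^sup>2)) ^ (DIM('a) + 1) * phi_inf TYPE('a)))"
proof -
  let ?n = "DIM('a)" and ?c = "(1 / sqrt (1 + \<epsilon>\<^sup>2)) ^ (DIM('a) + 1)"
  let ?B = "exp (- \<rho> * (cap_const ?n * r ^ ?n * ?c * phi_inf TYPE('a)))"
  define F where "F = {x \<in> grid m :: ('a \<times> real) set. r \<le> snd x}"
  define R where "R x = (if r / \<epsilon> \<le> snd x then r else \<epsilon> * r)" for x :: "'a \<times> real"
  have finF: "finite F" unfolding F_def by (rule finite_subset[OF _ finite_grid[of m]]) auto
  have cF: "card F \<le> (m + 1) ^ (?n + 1)"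
    using card_mono[OF finite_grid, of F m] card_grid[OF m(1), where 'a="'a \<times> real"] unfolding F_def by auto
  have c0: "0 \<le> cap_const ?n * r ^ ?n * ?c" using cap_const_pos[of ?n] r by simp
  have each: "prob (uncovered x (R x)) \<le> ?B" if x: "x \<in> F" for x
  proof -
    have xc: "x \<in> unit_cube" "r \<le> snd x" using x grid_subset_unit_cube by (auto simp: F_def)
    then have xpos: "0 < snd x" using r by linarith
    show ?thesis
    proof (cases "r / \<epsilon> \<le> snd x")
      case True
      then have "r \<le> \<epsilon> * snd x" using \<epsilon> by (simp add: field_simps)
      then have "prob (uncovered x r) \<le> exp (- \<rho> * (cap_const ?n * r ^ ?n * ?c * phi x))"
        using r xc by (intro prob_uncovered_le) auto
      also have "\<dots> \<le> ?B"
        unfolding exp_le_cancel_iff using rho_pos c0 phi_inf_le[OF xc(1) xpos]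
        by (intro mult_left_mono_neg mult_left_mono) auto
      finally show ?thesis using True by (simp add: R_def)
    next
      case False
      have "\<epsilon> * r \<le> r" using \<epsilon> r by simp
      have "prob (uncovered x (\<epsilon> * r)) \<le> exp (- \<rho> * (cap_const ?n * (\<epsilon> * r) ^ ?n * ?c * phi x))"
        using r xc \<epsilon> order_trans[OF \<open>\<epsilon> * r \<le> r\<close> xc(2)] by (intro prob_uncovered_le mult_left_mono) auto
      also have "\<dots> \<le> ?B"
      proof -
        have "phi_inf TYPE('a) / \<epsilon> ^ ?n \<le> phi x" using False by (intro low xc xpos) auto
        then have "phi_inf TYPE('a) \<le> \<epsilon> ^ ?n * phi x" using \<epsilon> by (simp add: field_simps)
        then have "(cap_const ?n * r ^ ?n * ?c) * phi_inf TYPE('a) \<le> (cap_const ?n * r ^ ?n * ?c) * (\<epsilon> ^ ?n * phi x)"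
          by (rule mult_left_mono[OF _ c0])
        also have "\<dots> = cap_const ?n * (\<epsilon> * r) ^ ?n * ?c * phi x"
          unfolding power_mult_distrib by (simp only: mult_ac)
        finally show ?thesis
          unfolding exp_le_cancel_iff using rho_pos by (intro mult_left_mono_neg) auto
      qed
      finally show ?thesis using False by (simp add: R_def)
    qed
  qed
  have "{\<omega>\<in>space M. ereal ((1 + 2 * \<epsilon>) * r) < coverage_radius Y S (cball 0 1) \<omega>} \<subseteq> (\<Union>x\<in>F. uncovered x (R x))"
  proof
    fix \<omega> assume \<omega>: "\<omega> \<in> {\<omega>\<in>space M. ereal ((1 + 2 * \<epsilon>) * r) < coverage_radius Y S (cball 0 1) \<omega>}"
    show "\<omega> \<in> (\<Union>x\<in>F. uncovered x (R x))"
    proof (rule ccontr)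
      assume not: "\<omega> \<notin> (\<Union>x\<in>F. uncovered x (R x))"
      have "covers Y S ((1 + 2 * \<epsilon>) * r) \<omega>"
        unfolding covers_def
      proof
        fix z :: "'a \<times> real" assume z: "z \<in> unit_cube"
        \<comment> \<open>Lift \<open>z\<close> to height at least \<open>r\<close>; the distance \<open>r\<close> that this may cost is affordable because then \<open>R x = \<epsilon> * r\<close>.\<close>
        define z' where "z' = (fst z, max (snd z) r)"
        have z': "z' \<in> unit_cube" using z r by (auto simp: unit_cube_prod_iff z'_def)
        obtain x where x: "x \<in> grid m" "norm (x - z') \<le> DIM('a \<times> real) / m" "\<And>b. b \<in> Basis \<Longrightarrow> z' \<bullet> b \<le> x \<bullet> b"
          using grid_dense_above[OF m(1) z'] by blast
        have near: "norm (x - z') \<le> \<epsilon> * r" using x(2) m(2) by (simp add: add.commute)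
        have "snd z' \<le> snd x"
          using x(3)[of "(0, 1)"] by (auto simp: Basis_prod_def inner_prod_def)
        then have rx: "r \<le> snd x" by (simp add: z'_def)
        then have "x \<in> F" using x(1) by (simp add: F_def)
        with not \<omega> obtain i where i: "i < num_base_points Y \<omega>" "(Y i \<omega>, S i \<omega>) \<in> hits x (R x)"
          by (auto simp: uncovered_def)
        have "R x + norm (x - z) \<le> (1 + 2 * \<epsilon>) * r"
        proof (cases "r \<le> snd z")
          case True
          then have "z' = z" by (simp add: z'_def prod_eq_iff)
          moreover have "R x \<le> r" using \<epsilon> r by (simp add: R_def)
          moreover have "0 \<le> \<epsilon> * r" using \<epsilon> r by simp
          ultimately show ?thesis using near by (simp add: algebra_simps)
        next
          case False
          then have snd_z': "snd z' = r" by (simp add: z'_def)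
          have "\<bar>snd (x - z')\<bar> \<le> \<epsilon> * r" using abs_snd_le_norm[of "x - z'"] near by linarith
          then have "snd x \<le> (1 + \<epsilon>) * r" using snd_z' by (simp add: algebra_simps)
          also have "\<dots> < r / \<epsilon>"
          proof -
            have "(1 + \<epsilon>) * \<epsilon> \<le> (1 + 1 / 2) * (1 / 2)" using \<epsilon> by (intro mult_mono) auto
            then have "(1 + \<epsilon>) * \<epsilon> < 1" by simp
            then have "(1 + \<epsilon>) * \<epsilon> * r < 1 * r" using r by (intro mult_strict_right_mono)
            then show ?thesis using \<epsilon> by (simp add: pos_less_divide_eq mult_ac)
          qed
          finally have Rx: "R x = \<epsilon> * r" by (simp add: R_def)
          have "norm (z' - z) \<le> norm (fst (z' - z)) + \<bar>snd (z' - z)\<bar>" by (rule norm_le_fst_snd)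
          also have "\<dots> \<le> r" using False z by (simp add: z'_def unit_cube_prod_iff)
          finally have "norm (z' - z) \<le> r" .
          moreover have "norm (x - z) \<le> norm (x - z') + norm (z' - z)"
            by (rule order_trans[OF _ norm_triangle_ineq]) simp
          ultimately show ?thesis using near Rx by (simp add: algebra_simps)
        qed
        then have "(Y i \<omega>, S i \<omega>) \<in> hits z ((1 + 2 * \<epsilon>) * r)" by (rule hits_mono[OF i(2)])
        then show "\<exists>i<num_base_points Y \<omega>. (Y i \<omega>, S i \<omega>) \<in> hits z ((1 + 2 * \<epsilon>) * r)" using i(1) by blast
      qed
      then have "coverage_radius Y S (cball 0 1) \<omega> \<le> ereal ((1 + 2 * \<epsilon>) * r)"
        using \<epsilon> r by (intro coverage_radius_le) auto
      then have "\<not> ereal ((1 + 2 * \<epsilon>) * r) < coverage_radius Y S (cball 0 1) \<omega>"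
        by (simp only: not_less)
      with \<omega> show False by blast
    qed
  qed
  then have "prob {\<omega>\<in>space M. ereal ((1 + 2 * \<epsilon>) * r) < coverage_radius Y S (cball 0 1) \<omega>} \<le> prob (\<Union>x\<in>F. uncovered x (R x))"
    using finF by (intro finite_measure_mono sets.finite_UN uncovered_measurable)
  also have "\<dots> \<le> (\<Sum>x\<in>F. prob (uncovered x (R x)))"
    using finF by (intro finite_measure_subadditive_finite) auto
  also have "\<dots> \<le> (\<Sum>x\<in>F. ?B)" by (intro sum_mono each)
  also have "\<dots> \<le> real (m + 1) ^ (?n + 1) * ?B"
    using cF by (simp add: mult_right_mono flip: of_nat_Suc of_nat_power of_nat_mult)
  finally show ?thesis .
qed

text \<open>
  The second moment bound for the images of the grid points in the copy of the cube shrunk by \<open>\<tau>\<close> towards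
  \<open>x0\<close>. The choice of \<open>\<tau>\<close> places this copy within \<open>\<delta> * snd x0\<close> of \<open>x0\<close>, so that \<open>phi\<close> exceeds \<open>phi x0\<close> at
  most by a factor close to 1 there. Here \<open>L\<close> bounds below the probability that a single point is uncovered,
  and \<open>\<eta>\<close> bounds the overlap of two of them.
\<close>

lemma prob_coverage_radius_less:
  fixes x0 :: "'a \<times> real"
  assumes x0: "x0 \<in> unit_cube" "0 < snd x0" and \<delta>: "0 < \<delta>" "\<delta> \<le> 1 / 2"
  defines "h \<equiv> (1 - \<delta>) * snd x0" and "\<tau> \<equiv> \<delta> * snd x0 / (real DIM('a) + 1)"
  defines "C \<equiv> 2 * (real DIM('a) + 1) / h"
  assumes r: "0 < r" "r \<le> \<delta> * h" and D: "4 * (r * (1 + C)) \<le> D" "0 < D" and m: "0 < m" "D \<le> \<tau> / real m"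
  defines "\<eta> \<equiv> \<rho> * (cap_const DIM('a) * (2 * r / h) ^ DIM('a) * (unit_ball_vol DIM('a) * (4 * r * (1 + C)\<^sup>2 / D) ^ DIM('a)))"
    and "L \<equiv> exp (- \<rho> * (cap_const DIM('a) * r ^ DIM('a) / (1 - \<delta>) ^ DIM('a) * (phi x0 / (1 - \<delta>) ^ DIM('a))))"
  shows "prob {\<omega>\<in>space M. coverage_radius Y S (cball 0 1) \<omega> < ereal r} \<le>
    1 / (real (m + 1) ^ (DIM('a) + 1) * L) + (exp \<eta> - 1)"
proof -
  let ?n = "DIM('a)"
  define G where "G = (\<lambda>g. (1 - \<tau>) *\<^sub>R x0 + \<tau> *\<^sub>R g) ` (grid m :: ('a \<times> real) set)"
  have snd_x0: "snd x0 \<le> 1" using x0 by (simp add: unit_cube_prod_iff)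
  have h: "0 < h" using x0 \<delta> by (simp add: h_def)
  have "\<delta> * snd x0 \<le> 1 * 1" using \<delta> x0 snd_x0 by (intro mult_mono) auto
  then have \<tau>: "0 < \<tau>" "\<tau> \<le> 1" using x0 \<delta> by (simp_all add: \<tau>_def divide_le_eq)
  have r2: "r \<le> h / 2" using r(2) \<delta> h mult_right_mono[of \<delta> "1/2" h] by linarith
  have G_props: "x \<in> unit_cube \<and> h \<le> snd x \<and> phi x \<le> phi x0 / (1 - \<delta>) ^ ?n" if x: "x \<in> G" for x
  proof -
    obtain g where g: "g \<in> grid m" "x = (1 - \<tau>) *\<^sub>R x0 + \<tau> *\<^sub>R g" using x unfolding G_def by blast
    have gc: "g \<in> unit_cube" using g(1) grid_subset_unit_cube by blast
    have "x - x0 = \<tau> *\<^sub>R (g - x0)" by (simp add: g(2) algebra_simps)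
    then have "norm (x - x0) = \<tau> * norm (g - x0)" using \<tau> by simp
    also have "\<dots> \<le> \<tau> * (real ?n + 1)"
      using norm_diff_unit_cube_le[OF gc x0(1)] \<tau> by (intro mult_left_mono) auto
    also have "\<dots> = \<delta> * snd x0" by (simp add: \<tau>_def)
    finally have "norm (x - x0) \<le> \<delta> * snd x0" .
    then show ?thesis
      using phi_nearby[OF x0(2), of x \<delta>] \<delta> unit_cube_segment[OF x0(1) gc, of \<tau>] \<tau> by (simp add: g(2) h_def)
  qed
  have inj: "inj_on (\<lambda>g. (1 - \<tau>) *\<^sub>R x0 + \<tau> *\<^sub>R g) (grid m :: ('a \<times> real) set)"
    using \<tau> by (auto simp: inj_on_def)
  have cG: "card G = (m + 1) ^ (?n + 1)"
    unfolding G_def by (subst card_image[OF inj]) (simp add: card_grid[OF m(1)])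
  have sep: "D \<le> norm (x - x')" if x: "x \<in> G" "x' \<in> G" "x \<noteq> x'" for x x'
  proof -
    obtain g where g: "g \<in> grid m" "x = (1 - \<tau>) *\<^sub>R x0 + \<tau> *\<^sub>R g" using x unfolding G_def by blast
    obtain g' where g': "g' \<in> grid m" "x' = (1 - \<tau>) *\<^sub>R x0 + \<tau> *\<^sub>R g'" using x unfolding G_def by blast
    have "x - x' = \<tau> *\<^sub>R (g - g')" by (simp add: g(2) g'(2) algebra_simps)
    then have "norm (x - x') = \<tau> * norm (g - g')" using \<tau> by simp
    moreover have "\<tau> * (1 / real m) \<le> \<tau> * norm (g - g')"
      using \<tau> x(3) g g' by (intro mult_left_mono grid_separated[OF m(1)]) auto
    ultimately show ?thesis using m(2) by simp
  qed
  have L: "L \<le> prob (uncovered x r)" if x: "x \<in> G" for x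
  proof -
    have "0 < snd x" "h \<le> snd x" using G_props[OF x] h by auto
    have "cap_const ?n * r ^ ?n / (1 - \<delta>) ^ ?n * phi x \<le> cap_const ?n * r ^ ?n / (1 - \<delta>) ^ ?n * (phi x0 / (1 - \<delta>) ^ ?n)"
      using G_props[OF x] cap_const_pos[of ?n] r \<delta> by (intro mult_left_mono) auto
    then have "L \<le> exp (- \<rho> * (cap_const ?n * r ^ ?n / (1 - \<delta>) ^ ?n * phi x))"
      unfolding L_def exp_le_cancel_iff by (rule mult_left_mono_neg) (use rho_pos in auto)
    also have "\<dots> \<le> prob (uncovered x r)"
      using \<delta> r \<open>0 < snd x\<close> order_trans[OF r(2) mult_left_mono[OF \<open>h \<le> snd x\<close>, of \<delta>]]
      by (intro prob_uncovered_ge) auto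
    finally show ?thesis .
  qed
  have Lpos: "0 < L" by (simp add: L_def)
  have C0: "0 \<le> C" using h by (simp add: C_def)
  have \<eta>0: "0 \<le> \<eta>"
    using rho_pos cap_const_pos[of ?n] r h C0 D by (simp add: \<eta>_def)
  have corr: "prob (uncovered x r \<inter> uncovered x' r) \<le> (1 + (exp \<eta> - 1)) * (prob (uncovered x r) * prob (uncovered x' r))"
    if x: "x \<in> G" "x' \<in> G" "x \<noteq> x'" for x x'
  proof -
    let ?I = "(LINT y:unit_cube|lborel. measure uniform_hemisphere (Pair y -` (hits x r \<inter> hits x' r)))"
    have "?I \<le> cap_const ?n * (2 * r / h) ^ ?n * (unit_ball_vol ?n * (4 * r * (1 + C)\<^sup>2 / D) ^ ?n)"
      using G_props[OF x(1)] G_props[OF x(2)] r r2 sep[OF x] D unfolding C_def by (intro overlap_le) auto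
    then have "\<rho> * ?I \<le> \<eta>" unfolding \<eta>_def using rho_pos by (intro mult_left_mono) auto
    then have "(prob (uncovered x r) * prob (uncovered x' r)) * exp (\<rho> * ?I) \<le> (prob (uncovered x r) * prob (uncovered x' r)) * exp \<eta>"
      by (intro mult_left_mono) auto
    then show ?thesis unfolding prob_uncovered_both by (simp add: mult.commute)
  qed
  have mu: "real (m + 1) ^ (?n + 1) * L \<le> (\<Sum>x\<in>G. prob (uncovered x r))"
  proof -
    have "real (m + 1) ^ (?n + 1) * L = (\<Sum>x\<in>G. L)"
      unfolding sum_constant cG of_nat_power ..
    also have "\<dots> \<le> (\<Sum>x\<in>G. prob (uncovered x r))" by (intro sum_mono L)
    finally show ?thesis .
  qed
  have "{\<omega>\<in>space M. coverage_radius Y S (cball 0 1) \<omega> < ereal r} \<subseteq> space M - (\<Union>x\<in>G. uncovered x r)"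
  proof
    fix \<omega> assume \<omega>: "\<omega> \<in> {\<omega>\<in>space M. coverage_radius Y S (cball 0 1) \<omega> < ereal r}"
    then obtain r' where "ereal r' < ereal r" "covers Y S r' \<omega>"
      unfolding coverage_radius_less_iff by blast
    then have "covers Y S r \<omega>" using covers_mono[of Y S r' \<omega> r] by simp
    then have "\<omega> \<notin> uncovered x r" if "x \<in> G" for x
      using G_props[OF that] unfolding covers_def uncovered_def by blast
    with \<omega> show "\<omega> \<in> space M - (\<Union>x\<in>G. uncovered x r)" by blast
  qed
  moreover have finG: "finite G" unfolding G_def using finite_grid by blast
  ultimately have "prob {\<omega>\<in>space M. coverage_radius Y S (cball 0 1) \<omega> < ereal r} \<le> prob (space M - (\<Union>x\<in>G. uncovered x r))"
    by (intro finite_measure_mono sets.Diff sets.top sets.finite_UN uncovered_measurable)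
  also have "\<dots> \<le> 1 / (real (m + 1) ^ (?n + 1) * L) + (exp \<eta> - 1)"
    using finG Lpos \<eta>0 corr mu by (intro second_moment_bound) auto
  finally show ?thesis .
qed

end

section \<open>Limit of the coverage radius\<close>

definition critical_scale :: "nat \<Rightarrow> real \<Rightarrow> real" where
  "critical_scale n \<rho> = (ln \<rho> / \<rho>) powr (1 / real n)"

lemma powr_inverse_power: "0 < n \<Longrightarrow> 0 \<le> x \<Longrightarrow> (x powr (1 / real n)) ^ n = x"
  by (cases "x = 0") (simp_all add: powr_power)

lemma critical_scale_pos: "1 < \<rho> \<Longrightarrow> 0 < critical_scale n \<rho>"
  by (simp add: critical_scale_def)

lemma critical_scale_power: "0 < n \<Longrightarrow> 1 < \<rho> \<Longrightarrow> \<rho> * critical_scale n \<rho> ^ n = ln \<rho>"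
  by (simp add: critical_scale_def powr_inverse_power)

lemma critical_scale_ge: "1 \<le> ln \<rho> \<Longrightarrow> 0 < \<rho> \<Longrightarrow> \<rho> powr - (1 / real n) \<le> critical_scale n \<rho>"
proof -
  assume \<rho>: "1 \<le> ln \<rho>" "0 < \<rho>"
  have "\<rho> powr - (1 / real n) = (1 / \<rho>) powr (1 / real n)"
    using \<rho> by (simp add: powr_minus_divide powr_divide)
  also have "\<dots> \<le> critical_scale n \<rho>"
    unfolding critical_scale_def using \<rho> by (intro powr_mono2 divide_right_mono) auto
  finally show ?thesis .
qed

lemma critical_scale_le:
  assumes \<rho>: "1 \<le> ln \<rho>" "0 < \<rho>" and n: "0 < n"
  shows "critical_scale n \<rho> \<le> ln \<rho> * \<rho> powr - (1 / real n)"
proof -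
  have "ln \<rho> powr (1 / real n) \<le> ln \<rho> powr 1"
    using \<rho> n by (intro powr_mono) auto
  then have "ln \<rho> powr (1 / real n) * \<rho> powr - (1 / real n) \<le> ln \<rho> * \<rho> powr - (1 / real n)"
    using \<rho> by (intro mult_right_mono) auto
  moreover have "critical_scale n \<rho> = ln \<rho> powr (1 / real n) * \<rho> powr - (1 / real n)"
    using \<rho> by (simp add: critical_scale_def powr_divide powr_minus_divide)
  ultimately show ?thesis by simp
qed

lemma ln_power_powr_tendsto_0:
  fixes e :: real
  assumes "0 < e"
  shows "((\<lambda>\<rho>. ln \<rho> ^ k * \<rho> powr - e) \<longlongrightarrow> 0) at_top"
proof -
  have "filterlim (\<lambda>\<rho>::real. e * ln \<rho>) at_top at_top"
    using assms by (intro filterlim_tendsto_pos_mult_at_top[OF tendsto_const _ ln_at_top])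
  from filterlim_compose[OF tendsto_power_div_exp_0 this, of k]
  have "((\<lambda>\<rho>. (1 / e ^ k) * ((e * ln \<rho>) ^ k / exp (e * ln \<rho>))) \<longlongrightarrow> (1 / e ^ k) * 0) at_top"
    by (intro tendsto_intros)
  moreover have "\<forall>\<^sub>F \<rho> in at_top. (1 / e ^ k) * ((e * ln \<rho>) ^ k / exp (e * ln \<rho>)) = ln \<rho> ^ k * \<rho> powr - e"
    using eventually_gt_at_top[of 0]
  proof eventually_elim
    fix \<rho> :: real assume "0 < \<rho>"
    then show "(1 / e ^ k) * ((e * ln \<rho>) ^ k / exp (e * ln \<rho>)) = ln \<rho> ^ k * \<rho> powr - e"
      using assms by (simp add: powr_def power_mult_distrib exp_minus divide_inverse)
  qed
  ultimately show ?thesis by (simp add: tendsto_cong)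
qed

lemma eventually_ln_ge: "\<forall>\<^sub>F \<rho> in at_top. c \<le> ln (\<rho>::real)"
  using ln_at_top by (simp add: filterlim_at_top)

lemma critical_scale_tendsto_0:
  assumes "0 < n"
  shows "(critical_scale n \<longlongrightarrow> 0) at_top"
proof (rule tendsto_sandwich)
  show "\<forall>\<^sub>F \<rho> in at_top. 0 \<le> critical_scale n \<rho>" by (simp add: critical_scale_def)
  show "\<forall>\<^sub>F \<rho> in at_top. critical_scale n \<rho> \<le> ln \<rho> ^ 1 * \<rho> powr - (1 / real n)"
    using eventually_ln_ge[of 1] eventually_gt_at_top[of 0]
    by eventually_elim (use critical_scale_le assms in simp)
  show "((\<lambda>\<rho>. ln \<rho> ^ 1 * \<rho> powr - (1 / real n)) \<longlongrightarrow> 0) at_top"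
    using assms by (intro ln_power_powr_tendsto_0) simp
qed simp

text \<open>
  The grid has order \<open>\<rho> powr ((n + 1) / n)\<close> points, since \<open>1 / critical_scale n \<rho>\<close> is
  eventually at most \<open>\<rho> powr (1 / n)\<close>. Each of them is uncovered with probability at most \<open>\<rho> powr - f \<epsilon>\<close>, and \<open>f \<epsilon>\<close> tends to the
  right-hand side of the hypothesis on \<open>b\<close> as \<open>\<epsilon>\<close> tends to 0.
\<close>

lemma coverage_radius_upper_tail:
  fixes Y :: "real \<Rightarrow> nat \<Rightarrow> 'w \<Rightarrow> 'a::euclidean_space" and S :: "real \<Rightarrow> nat \<Rightarrow> 'w \<Rightarrow> 'a \<times> real"
  assumes model: "\<And>\<rho>. 0 < \<rho> \<Longrightarrow> uniform_cylinder_model M \<rho> (Y \<rho>) (S \<rho>)"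
    and b: "0 < b" and super: "(real DIM('a) + 1) / real DIM('a) < b ^ DIM('a) * cap_const DIM('a) * phi_inf TYPE('a)"
  shows "((\<lambda>\<rho>. measure M {\<omega>\<in>space M. ereal (b * critical_scale DIM('a) \<rho>) < coverage_radius (Y \<rho>) (S \<rho>) (cball 0 1) \<omega>}) \<longlongrightarrow> 0) at_top"
proof -
  let ?n = "DIM('a)" and ?a = "critical_scale DIM('a)" and ?I = "phi_inf TYPE('a)"
  have half_pos: "0 < (1 / 2 :: real)" by simp
  define f where "f \<epsilon> = (b / (1 + 2 * \<epsilon>)) ^ ?n * cap_const ?n * (1 / sqrt (1 + \<epsilon>\<^sup>2)) ^ (?n + 1) * ?I" for \<epsilon> :: real
  have "(f \<longlongrightarrow> (b / (1 + 2 * 0)) ^ ?n * cap_const ?n * (1 / sqrt (1 + 0\<^sup>2)) ^ (?n + 1) * ?I) (at_right 0)"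
    unfolding f_def by (intro tendsto_intros) auto
  then have "(f \<longlongrightarrow> b ^ ?n * cap_const ?n * ?I) (at_right 0)" by simp
  from eventually_conj[OF order_tendstoD(1)[OF this super] eventually_at_right_real[of 0 "1 / 2 :: real", OF half_pos]]
  have "\<forall>\<^sub>F \<epsilon> in at_right 0. (real ?n + 1) / real ?n < f \<epsilon> \<and> \<epsilon> \<in> {0<..<1 / 2}" .
  from eventually_happens'[OF trivial_limit_at_right_real this]
  obtain \<epsilon> where \<epsilon>: "0 < \<epsilon>" "\<epsilon> \<le> 1 / 2" and s: "(real ?n + 1) / real ?n < f \<epsilon>"
    by (metis greaterThanLessThan_iff less_imp_le)
  define c where "c = b / (1 + 2 * \<epsilon>)"
  define r where "r \<rho> = c * ?a \<rho>" for \<rho>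
  have c: "0 < c" "(1 + 2 * \<epsilon>) * c = b" using b \<epsilon> by (simp_all add: c_def)
  \<comment> \<open>The summand 2 pays for rounding up the number of grid steps and for the additional grid point per axis.\<close>
  define K where "K = (real ?n + 1) / (\<epsilon> * c) + 2"
  have K: "0 < K" using \<epsilon> c by (auto simp: K_def intro!: add_nonneg_pos)
  obtain k :: nat where k: "2 * (real ?n + 1) ^ ?n * (?I / \<epsilon> ^ ?n) \<le> real k" using real_arch_simple by blast
  have low: "?I / \<epsilon> ^ ?n \<le> phi x" if "x \<in> unit_cube" "0 < snd x" "snd x \<le> 1 / 2 ^ k" for x :: "'a \<times> real"
  proof -
    have "?I / \<epsilon> ^ ?n \<le> (real k + 1) / (2 * (real ?n + 1) ^ ?n)"
      using k by (subst pos_le_divide_eq) (auto simp: mult_ac)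
    also have "\<dots> \<le> phi x" by (rule phi_blowup[OF that])
    finally show ?thesis .
  qed
  have r_small: "\<forall>\<^sub>F \<rho> in at_top. r \<rho> < u" if "0 < u" for u
  proof -
    have "(r \<longlongrightarrow> c * 0) at_top" unfolding r_def by (intro tendsto_intros critical_scale_tendsto_0) simp
    then show ?thesis using that by (intro order_tendstoD(2)) auto
  qed
  have \<epsilon>k: "0 < \<epsilon> / 2 ^ k" using \<epsilon> by simp
  have bound: "\<forall>\<^sub>F \<rho> in at_top. measure M {\<omega>\<in>space M. ereal (b * ?a \<rho>) < coverage_radius (Y \<rho>) (S \<rho>) (cball 0 1) \<omega>} \<le>
      K ^ (?n + 1) * \<rho> powr - (f \<epsilon> - (real ?n + 1) / real ?n)"
    using eventually_ln_ge[of 1] eventually_gt_at_top[of 1] r_small[OF zero_less_one] r_small[OF \<epsilon>k]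
  proof eventually_elim
    case (elim \<rho>)
    then have \<rho>: "1 \<le> ln \<rho>" "1 < \<rho>" and r1: "r \<rho> < 1" and rk: "r \<rho> < \<epsilon> / 2 ^ k" by auto
    interpret uniform_cylinder_model M \<rho> "Y \<rho>" "S \<rho>" using \<rho> by (intro model) simp
    have rpos: "0 < r \<rho>" using c \<rho> by (simp add: r_def critical_scale_pos)
    define m where "m = nat \<lceil>(real ?n + 1) / (\<epsilon> * r \<rho>)\<rceil>"
    have q: "0 < (real ?n + 1) / (\<epsilon> * r \<rho>)" using \<epsilon> rpos by simp
    then have m_ge: "(real ?n + 1) / (\<epsilon> * r \<rho>) \<le> real m" and m_le: "real m \<le> (real ?n + 1) / (\<epsilon> * r \<rho>) + 1"
      unfolding m_def by linarith+
    have m: "0 < m" using m_ge q by linarith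
    have mr: "(real ?n + 1) / real m \<le> \<epsilon> * r \<rho>" using m_ge m \<epsilon> rpos by (simp add: field_simps)
    have "b * ?a \<rho> = (1 + 2 * \<epsilon>) * r \<rho>" using c(2) by (simp add: r_def flip: mult.assoc)
    then have "prob {\<omega>\<in>space M. ereal (b * ?a \<rho>) < coverage_radius (Y \<rho>) (S \<rho>) (cball 0 1) \<omega>} \<le>
        real (m + 1) ^ (?n + 1) * exp (- \<rho> * (cap_const ?n * r \<rho> ^ ?n * (1 / sqrt (1 + \<epsilon>\<^sup>2)) ^ (?n + 1) * ?I))"
    proof (simp only:, intro prob_coverage_radius_gt)
      fix x :: "'a \<times> real" assume x: "x \<in> unit_cube" "0 < snd x" "snd x \<le> r \<rho> / \<epsilon>"
      have "r \<rho> / \<epsilon> \<le> 1 / 2 ^ k" using rk \<epsilon> by (simp add: field_simps)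
      with x show "?I / \<epsilon> ^ ?n \<le> phi x" by (intro low) auto
    qed (use rpos r1 \<epsilon> m mr in auto)
    also have "\<rho> * (cap_const ?n * r \<rho> ^ ?n * (1 / sqrt (1 + \<epsilon>\<^sup>2)) ^ (?n + 1) * ?I) = (\<rho> * ?a \<rho> ^ ?n) * f \<epsilon>"
      unfolding r_def power_mult_distrib f_def c_def by (simp only: mult_ac)
    then have "exp (- \<rho> * (cap_const ?n * r \<rho> ^ ?n * (1 / sqrt (1 + \<epsilon>\<^sup>2)) ^ (?n + 1) * ?I)) = \<rho> powr - f \<epsilon>"
      using \<rho> by (simp only: critical_scale_power[OF DIM_positive] mult_minus_left) (simp add: powr_def mult.commute)
    also have "real (m + 1) ^ (?n + 1) \<le> (K * \<rho> powr (1 / real ?n)) ^ (?n + 1)"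
    proof (rule power_mono)
      have one: "1 \<le> \<rho> powr (1 / real ?n)" using \<rho> by (intro ge_one_powr_ge_zero) auto
      have inv: "1 / ?a \<rho> \<le> \<rho> powr (1 / real ?n)"
        using critical_scale_ge[of \<rho> ?n] \<rho> critical_scale_pos[of \<rho> ?n] by (simp add: powr_minus field_simps)
      have "real (m + 1) \<le> (real ?n + 1) / (\<epsilon> * c) * (1 / ?a \<rho>) + 2"
        using m_le by (simp add: r_def mult.assoc)
      also have "\<dots> \<le> (real ?n + 1) / (\<epsilon> * c) * \<rho> powr (1 / real ?n) + 2 * \<rho> powr (1 / real ?n)"
        using one inv \<epsilon> c by (intro add_mono mult_left_mono) auto
      also have "\<dots> = K * \<rho> powr (1 / real ?n)" by (simp add: K_def algebra_simps)
      finally show "real (m + 1) \<le> K * \<rho> powr (1 / real ?n)" .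
    qed simp
    also have "(K * \<rho> powr (1 / real ?n)) ^ (?n + 1) = K ^ (?n + 1) * \<rho> powr ((real ?n + 1) / real ?n)"
      using \<rho> by (subst power_mult_distrib, subst powr_power) (auto simp: add.commute)
    finally show ?case
      using \<rho> by (simp add: mult_right_mono powr_add[symmetric] mult.assoc)
  qed
  have "((\<lambda>\<rho>. K ^ (?n + 1) * \<rho> powr - (f \<epsilon> - (real ?n + 1) / real ?n)) \<longlongrightarrow> K ^ (?n + 1) * 0) at_top"
    using s by (intro tendsto_intros tendsto_neg_powr filterlim_ident) simp
  then have lim: "((\<lambda>\<rho>. K ^ (?n + 1) * \<rho> powr - (f \<epsilon> - (real ?n + 1) / real ?n)) \<longlongrightarrow> 0) at_top"
    by (simp only: mult_zero_right)
  show ?thesis by (rule tendsto_sandwich[OF _ bound tendsto_const lim]) simp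
qed

text \<open>
  As in the upper bound the exponents \<open>(n + 1) / n\<close> and \<open>s\<close> compete, now with \<open>s\<close> the smaller one, so that the
  expected number of uncovered grid points tends to infinity.
\<close>

lemma coverage_radius_lower_tail:
  fixes Y :: "real \<Rightarrow> nat \<Rightarrow> 'w \<Rightarrow> 'a::euclidean_space" and S :: "real \<Rightarrow> nat \<Rightarrow> 'w \<Rightarrow> 'a \<times> real"
  assumes model: "\<And>\<rho>. 0 < \<rho> \<Longrightarrow> uniform_cylinder_model M \<rho> (Y \<rho>) (S \<rho>)"
    and b: "0 < b" and sub: "b ^ DIM('a) * cap_const DIM('a) * phi_inf TYPE('a) < (real DIM('a) + 1) / real DIM('a)"
  shows "((\<lambda>\<rho>. measure M {\<omega>\<in>space M. coverage_radius (Y \<rho>) (S \<rho>) (cball 0 1) \<omega> < ereal (b * critical_scale DIM('a) \<rho>)}) \<longlongrightarrow> 0) at_top"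
proof -
  let ?n = "DIM('a)" and ?a = "critical_scale DIM('a)" and ?I = "phi_inf TYPE('a)"
  let ?g = "\<lambda>\<delta> p. b ^ ?n * (cap_const ?n / (1 - \<delta>) ^ ?n * (p / (1 - \<delta>) ^ ?n))"
  have half_pos: "0 < (1 / 2 :: real)" by simp
  have "((\<lambda>\<delta>. ?g \<delta> (?I + \<delta>)) \<longlongrightarrow> ?g 0 (?I + 0)) (at_right 0)"
    by (intro tendsto_intros) auto
  then have "((\<lambda>\<delta>. ?g \<delta> (?I + \<delta>)) \<longlongrightarrow> b ^ ?n * cap_const ?n * ?I) (at_right 0)" by (simp add: mult.assoc)
  from eventually_conj[OF order_tendstoD(2)[OF this sub] eventually_at_right_real[of 0 "1 / 2 :: real", OF half_pos]]
  have "\<forall>\<^sub>F \<delta> in at_right 0. ?g \<delta> (?I + \<delta>) < (real ?n + 1) / real ?n \<and> \<delta> \<in> {0<..<1 / 2}" .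
  from eventually_happens'[OF trivial_limit_at_right_real this]
  obtain \<delta> where \<delta>: "0 < \<delta>" "\<delta> \<le> 1 / 2" and g: "?g \<delta> (?I + \<delta>) < (real ?n + 1) / real ?n"
    by (metis greaterThanLessThan_iff less_imp_le)
  obtain x0 :: "'a \<times> real" where x0: "x0 \<in> unit_cube" "0 < snd x0" "phi x0 < ?I + \<delta>"
    using phi_inf_approx[where 'a='a and c="?I + \<delta>"] \<delta> by auto
  define s where "s = ?g \<delta> (phi x0)"
  have "s \<le> ?g \<delta> (?I + \<delta>)"
    unfolding s_def using x0 \<delta> b cap_const_pos[of ?n]
    by (intro mult_left_mono divide_right_mono) auto
  with g have s: "s < (real ?n + 1) / real ?n" by linarith
  define h where "h = (1 - \<delta>) * snd x0"
  define \<tau> where "\<tau> = \<delta> * snd x0 / (real ?n + 1)"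
  define C where "C = 2 * (real ?n + 1) / h"
  have h: "0 < h" using \<delta> x0 by (simp add: h_def)
  have \<tau>: "0 < \<tau>" using \<delta> x0 by (simp add: \<tau>_def)
  have C: "0 \<le> C" using h by (simp add: C_def)
  define r where "r \<rho> = b * ?a \<rho>" for \<rho>
  \<comment> \<open>With this spacing the overlap \<open>\<rho> * r ^ n * (r / D) ^ n\<close> is of order \<open>ln \<rho> powr (1 - 2 * n)\<close> and vanishes,
    while the number of grid points is reduced by powers of \<open>ln \<rho>\<close> only.\<close>
  define D where "D \<rho> = r \<rho> * (ln \<rho>)\<^sup>2" for \<rho>
  define K where "K = cap_const ?n * (2 / h) ^ ?n * (unit_ball_vol ?n * (4 * (1 + C)\<^sup>2) ^ ?n) * b ^ ?n"
  have K: "0 \<le> K" using cap_const_pos[of ?n] h b by (simp add: K_def)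
  have lim_D: "((\<lambda>\<rho>. b * (ln \<rho> ^ 3 * \<rho> powr - (1 / real ?n))) \<longlongrightarrow> b * 0) at_top"
    by (intro tendsto_intros ln_power_powr_tendsto_0) simp
  have lim_r: "(r \<longlongrightarrow> b * 0) at_top"
    unfolding r_def by (intro tendsto_intros critical_scale_tendsto_0) simp
  have ev_D: "\<forall>\<^sub>F \<rho> in at_top. b * (ln \<rho> ^ 3 * \<rho> powr - (1 / real ?n)) < \<tau>"
    using order_tendstoD(2)[OF lim_D] \<tau> by simp
  have ev_r: "\<forall>\<^sub>F \<rho> in at_top. r \<rho> < \<delta> * h"
    using order_tendstoD(2)[OF lim_r] \<delta> h by simp
  let ?bound = "\<lambda>\<rho>. (b / \<tau>) ^ (?n + 1) * (ln \<rho> ^ (3 * (?n + 1)) * \<rho> powr - ((real ?n + 1) / real ?n - s)) + (exp (K / ln \<rho>) - 1)"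
  have bound: "\<forall>\<^sub>F \<rho> in at_top. measure M {\<omega>\<in>space M. coverage_radius (Y \<rho>) (S \<rho>) (cball 0 1) \<omega> < ereal (b * ?a \<rho>)} \<le> ?bound \<rho>"
    using eventually_ln_ge[of 1] eventually_ln_ge[of "4 * (1 + C)"] eventually_gt_at_top[of 1] ev_D ev_r
  proof eventually_elim
    case (elim \<rho>)
    then have \<rho>: "1 \<le> ln \<rho>" "4 * (1 + C) \<le> ln \<rho>" "1 < \<rho>" and D\<tau>: "b * (ln \<rho> ^ 3 * \<rho> powr - (1 / real ?n)) < \<tau>" and r_le: "r \<rho> \<le> \<delta> * h"
      by auto
    interpret uniform_cylinder_model M \<rho> "Y \<rho>" "S \<rho>" using \<rho> by (intro model) simp
    have rpos: "0 < r \<rho>" using b \<rho> by (simp add: r_def critical_scale_pos)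
    have Dpos: "0 < D \<rho>" using rpos \<rho> by (simp add: D_def)
    have "r \<rho> \<le> b * (ln \<rho> * \<rho> powr - (1 / real ?n))"
      unfolding r_def using \<rho> b by (intro mult_left_mono critical_scale_le) auto
    then have "D \<rho> \<le> b * (ln \<rho> * \<rho> powr - (1 / real ?n)) * (ln \<rho>)\<^sup>2"
      unfolding D_def by (intro mult_right_mono) auto
    also have "\<dots> = b * (ln \<rho> ^ 3 * \<rho> powr - (1 / real ?n))"
      by (simp add: power2_eq_square power3_eq_cube)
    finally have D_le: "D \<rho> \<le> b * (ln \<rho> ^ 3 * \<rho> powr - (1 / real ?n))" .
    have ln2: "ln \<rho> \<le> (ln \<rho>)\<^sup>2" using \<rho>(1) by (simp add: power2_eq_square)
    have rD: "4 * (r \<rho> * (1 + C)) \<le> D \<rho>"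
    proof -
      have "4 * (1 + C) \<le> (ln \<rho>)\<^sup>2" using \<rho>(2) ln2 by linarith
      then have "r \<rho> * (4 * (1 + C)) \<le> r \<rho> * (ln \<rho>)\<^sup>2" using rpos by (intro mult_left_mono) auto
      then show ?thesis by (simp add: D_def algebra_simps)
    qed
    define m where "m = nat \<lfloor>\<tau> / D \<rho>\<rfloor>"
    have "1 \<le> \<tau> / D \<rho>" using D_le D\<tau> Dpos by (simp add: le_divide_eq)
    then have m: "0 < m" and m_le: "real m \<le> \<tau> / D \<rho>" and m_ge: "\<tau> / D \<rho> \<le> real (m + 1)"
      unfolding m_def by linarith+
    have Dm: "D \<rho> \<le> \<tau> / real m" using m m_le Dpos by (simp add: field_simps)
    define L where "L = exp (- \<rho> * (cap_const ?n * r \<rho> ^ ?n / (1 - \<delta>) ^ ?n * (phi x0 / (1 - \<delta>) ^ ?n)))"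
    define \<eta> where "\<eta> = \<rho> * (cap_const ?n * (2 * r \<rho> / h) ^ ?n * (unit_ball_vol ?n * (4 * r \<rho> * (1 + C)\<^sup>2 / D \<rho>) ^ ?n))"
    have \<rho>a: "\<rho> * ?a \<rho> ^ ?n = ln \<rho>" using \<rho> by (simp add: critical_scale_power)
    have "prob {\<omega>\<in>space M. coverage_radius (Y \<rho>) (S \<rho>) (cball 0 1) \<omega> < ereal (r \<rho>)} \<le>
        1 / (real (m + 1) ^ (?n + 1) * L) + (exp \<eta> - 1)"
      unfolding L_def \<eta>_def C_def h_def
      using rpos r_le rD Dpos m Dm unfolding C_def h_def \<tau>_def
      by (intro prob_coverage_radius_less[OF x0(1,2) \<delta>]) auto
    also have "\<dots> \<le> ?bound \<rho>"
    proof (rule add_mono)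
      have "\<rho> * (cap_const ?n * r \<rho> ^ ?n / (1 - \<delta>) ^ ?n * (phi x0 / (1 - \<delta>) ^ ?n)) = (\<rho> * ?a \<rho> ^ ?n) * s"
        unfolding s_def r_def power_mult_distrib by (simp only: divide_inverse mult_ac)
      then have L: "L = \<rho> powr - s"
        unfolding L_def \<rho>a using \<rho> by (simp add: powr_def mult.commute)
      have "1 / (real (m + 1) ^ (?n + 1) * L) \<le> 1 / ((\<tau> / D \<rho>) ^ (?n + 1) * L)"
        using m_ge \<tau> Dpos \<rho> unfolding L
        by (intro divide_left_mono mult_right_mono power_mono mult_pos_pos zero_less_power) auto
      also have "\<dots> = (D \<rho> / \<tau>) ^ (?n + 1) * \<rho> powr s"
        using \<rho> by (simp add: L powr_minus power_divide field_simps)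
      also have "\<dots> \<le> (b * (ln \<rho> ^ 3 * \<rho> powr - (1 / real ?n)) / \<tau>) ^ (?n + 1) * \<rho> powr s"
        using D_le \<tau> Dpos by (intro mult_right_mono power_mono divide_right_mono) auto
      also have "\<dots> = (b / \<tau>) ^ (?n + 1) * (ln \<rho> ^ (3 * (?n + 1)) * ((\<rho> powr - (1 / real ?n)) ^ (?n + 1) * \<rho> powr s))"
        by (simp only: divide_inverse power_mult_distrib power_mult mult_ac)
      also have "(\<rho> powr - (1 / real ?n)) ^ (?n + 1) = \<rho> powr - ((real ?n + 1) / real ?n)"
        using \<rho> by (subst powr_power) (auto simp: field_simps)
      also have "\<rho> powr - ((real ?n + 1) / real ?n) * \<rho> powr s = \<rho> powr - ((real ?n + 1) / real ?n - s)"
        by (simp flip: powr_add)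
      finally show "1 / (real (m + 1) ^ (?n + 1) * L) \<le>
          (b / \<tau>) ^ (?n + 1) * (ln \<rho> ^ (3 * (?n + 1)) * \<rho> powr - ((real ?n + 1) / real ?n - s))" .
      have "4 * r \<rho> * (1 + C)\<^sup>2 / D \<rho> = 4 * (1 + C)\<^sup>2 / (ln \<rho>)\<^sup>2"
        using rpos by (simp add: D_def)
      then have "\<eta> = K * (\<rho> * ?a \<rho> ^ ?n) * (1 / ((ln \<rho>)\<^sup>2) ^ ?n)"
        unfolding \<eta>_def K_def r_def by (simp add: power_divide power_mult_distrib)
      also have "\<dots> = K * (ln \<rho> * (1 / ((ln \<rho>)\<^sup>2) ^ ?n))" by (simp add: \<rho>a)
      also have "ln \<rho> * (1 / ((ln \<rho>)\<^sup>2) ^ ?n) \<le> 1 / ln \<rho>"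
      proof -
        have "((ln \<rho>)\<^sup>2) ^ 1 \<le> ((ln \<rho>)\<^sup>2) ^ ?n"
          using \<rho>(1) by (intro power_increasing) (auto simp: Suc_leI DIM_positive)
        then have "ln \<rho> * (1 / ((ln \<rho>)\<^sup>2) ^ ?n) \<le> ln \<rho> * (1 / (ln \<rho>)\<^sup>2)"
          using \<rho>(1) by (intro mult_left_mono divide_left_mono mult_pos_pos) auto
        then show ?thesis using \<rho>(1) by (simp add: power2_eq_square)
      qed
      then have "K * (ln \<rho> * (1 / ((ln \<rho>)\<^sup>2) ^ ?n)) \<le> K * (1 / ln \<rho>)" using K by (intro mult_left_mono)
      finally show "exp \<eta> - 1 \<le> exp (K / ln \<rho>) - 1" by simp
    qed
    finally show ?case by (simp add: r_def)
  qed
  have "(?bound \<longlongrightarrow> (b / \<tau>) ^ (?n + 1) * 0 + (exp 0 - 1)) at_top"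
    using s by (intro tendsto_intros ln_power_powr_tendsto_0 tendsto_divide_0[OF tendsto_const] filterlim_at_top_imp_at_infinity ln_at_top) simp
  then have lim: "(?bound \<longlongrightarrow> 0) at_top" by (simp only: mult_zero_right exp_zero diff_self add_0_right)
  show ?thesis by (rule tendsto_sandwich[OF _ bound tendsto_const lim]) simp
qed

lemma coverage_radius_tendsto_in_prob:
  fixes Y :: "real \<Rightarrow> nat \<Rightarrow> 'w \<Rightarrow> 'a::euclidean_space" and S :: "real \<Rightarrow> nat \<Rightarrow> 'w \<Rightarrow> 'a \<times> real"
  assumes model: "\<And>\<rho>. 0 < \<rho> \<Longrightarrow> uniform_cylinder_model M \<rho> (Y \<rho>) (S \<rho>)"
    and c: "0 < c" "c ^ DIM('a) * cap_const DIM('a) * phi_inf TYPE('a) = (real DIM('a) + 1) / real DIM('a)"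
  shows "prob_space.tendsto_in_prob M
    (\<lambda>\<rho> \<omega>. coverage_radius (Y \<rho>) (S \<rho>) (cball 0 1) \<omega> / ereal (critical_scale DIM('a) \<rho>)) c at_top"
proof -
  let ?n = "DIM('a)" and ?a = "critical_scale DIM('a)" and ?I = "phi_inf TYPE('a)"
  let ?R = "\<lambda>\<rho>. coverage_radius (Y \<rho>) (S \<rho>) (cball 0 1)"
  have M: "prob_space M" using model[of 1] unfolding uniform_cylinder_model_def cylinder_model_def by simp
  interpret prob_space M by (rule M)
  have R_meas: "random_variable borel (?R \<rho>)" if \<rho>: "0 < \<rho>" for \<rho>
  proof -
    interpret U: uniform_cylinder_model M \<rho> "Y \<rho>" "S \<rho>" by (rule model[OF \<rho>])
    show ?thesis by (rule U.coverage_radius_measurable)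
  qed
  have kI: "0 < cap_const ?n * ?I" using cap_const_pos[of ?n] phi_inf_pos[where 'a='a] by simp
  show ?thesis
    unfolding tendsto_in_prob_def
  proof (intro conjI allI impI)
    show "\<forall>\<^sub>F \<rho> in at_top. random_variable borel (\<lambda>\<omega>. ?R \<rho> \<omega> / ereal (?a \<rho>))"
      using eventually_gt_at_top[of 0]
    proof eventually_elim
      case (elim \<rho>)
      note [measurable] = R_meas[OF elim]
      show ?case by measurable
    qed
    fix \<epsilon> :: real assume \<epsilon>: "0 < \<epsilon>"
    \<comment> \<open>The lower tail bound needs a positive threshold.\<close>
    define \<epsilon>' where "\<epsilon>' = min \<epsilon> (c / 2)"
    have \<epsilon>': "0 < \<epsilon>'" "\<epsilon>' \<le> \<epsilon>" "0 < c - \<epsilon>'" using \<epsilon> c by (auto simp: \<epsilon>'_def min_def)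
    have up: "((\<lambda>\<rho>. prob {\<omega>\<in>space M. ereal ((c + \<epsilon>) * ?a \<rho>) < ?R \<rho> \<omega>}) \<longlongrightarrow> 0) at_top"
    proof (rule coverage_radius_upper_tail[OF model])
      have "c ^ ?n < (c + \<epsilon>) ^ ?n" using c \<epsilon> by (intro power_strict_mono) auto
      then have "c ^ ?n * (cap_const ?n * ?I) < (c + \<epsilon>) ^ ?n * (cap_const ?n * ?I)"
        using kI by (intro mult_strict_right_mono)
      then show "(real ?n + 1) / real ?n < (c + \<epsilon>) ^ ?n * cap_const ?n * ?I"
        using c(2) by (simp add: mult.assoc)
    qed (use c \<epsilon> in auto)
    have lo: "((\<lambda>\<rho>. prob {\<omega>\<in>space M. ?R \<rho> \<omega> < ereal ((c - \<epsilon>') * ?a \<rho>)}) \<longlongrightarrow> 0) at_top"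
    proof (rule coverage_radius_lower_tail[OF model])
      have "(c - \<epsilon>') ^ ?n < c ^ ?n" using \<epsilon>' by (intro power_strict_mono) auto
      then have "(c - \<epsilon>') ^ ?n * (cap_const ?n * ?I) < c ^ ?n * (cap_const ?n * ?I)"
        using kI by (intro mult_strict_right_mono)
      then show "(c - \<epsilon>') ^ ?n * cap_const ?n * ?I < (real ?n + 1) / real ?n"
        using c(2) by (simp add: mult.assoc)
    qed (use \<epsilon>' in auto)
    have bound: "\<forall>\<^sub>F \<rho> in at_top. prob {\<omega>\<in>space M. ereal \<epsilon> < \<bar>?R \<rho> \<omega> / ereal (?a \<rho>) - ereal c\<bar>} \<le>
        prob {\<omega>\<in>space M. ereal ((c + \<epsilon>) * ?a \<rho>) < ?R \<rho> \<omega>} + prob {\<omega>\<in>space M. ?R \<rho> \<omega> < ereal ((c - \<epsilon>') * ?a \<rho>)}"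
      using eventually_gt_at_top[of 1]
    proof eventually_elim
      case (elim \<rho>)
      have \<rho>: "0 < \<rho>" using elim by simp
      note [measurable] = R_meas[OF \<rho>]
      have a: "0 < ?a \<rho>" by (rule critical_scale_pos[OF elim])
      have "{\<omega>\<in>space M. ereal \<epsilon> < \<bar>?R \<rho> \<omega> / ereal (?a \<rho>) - ereal c\<bar>} \<subseteq>
          {\<omega>\<in>space M. ereal ((c + \<epsilon>) * ?a \<rho>) < ?R \<rho> \<omega>} \<union> {\<omega>\<in>space M. ?R \<rho> \<omega> < ereal ((c - \<epsilon>') * ?a \<rho>)}"
      proof
        fix \<omega> assume \<omega>: "\<omega> \<in> {\<omega>\<in>space M. ereal \<epsilon> < \<bar>?R \<rho> \<omega> / ereal (?a \<rho>) - ereal c\<bar>}"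
        show "\<omega> \<in> {\<omega>\<in>space M. ereal ((c + \<epsilon>) * ?a \<rho>) < ?R \<rho> \<omega>} \<union> {\<omega>\<in>space M. ?R \<rho> \<omega> < ereal ((c - \<epsilon>') * ?a \<rho>)}"
        proof (cases "?R \<rho> \<omega>")
          case (real x)
          have "\<epsilon> < \<bar>x / ?a \<rho> - c\<bar>" using \<omega> a real by simp
          then have "c + \<epsilon> < x / ?a \<rho> \<or> x / ?a \<rho> < c - \<epsilon>'" using \<epsilon>' by linarith
          then have "(c + \<epsilon>) * ?a \<rho> < x \<or> x < (c - \<epsilon>') * ?a \<rho>"
            using a by (simp add: pos_less_divide_eq pos_divide_less_eq)
          then show ?thesis using \<omega> real by auto
        next
          case PInf
          then show ?thesis using \<omega> by auto
        next
          case MInf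
          then show ?thesis using coverage_radius_nonneg[of "Y \<rho>" "S \<rho>" \<omega>] by simp
        qed
      qed
      then have "prob {\<omega>\<in>space M. ereal \<epsilon> < \<bar>?R \<rho> \<omega> / ereal (?a \<rho>) - ereal c\<bar>} \<le>
          prob ({\<omega>\<in>space M. ereal ((c + \<epsilon>) * ?a \<rho>) < ?R \<rho> \<omega>} \<union> {\<omega>\<in>space M. ?R \<rho> \<omega> < ereal ((c - \<epsilon>') * ?a \<rho>)})"
        by (rule finite_measure_mono) measurable
      also have "\<dots> \<le> prob {\<omega>\<in>space M. ereal ((c + \<epsilon>) * ?a \<rho>) < ?R \<rho> \<omega>} + prob {\<omega>\<in>space M. ?R \<rho> \<omega> < ereal ((c - \<epsilon>') * ?a \<rho>)}"
        by (rule measure_Un_le) measurable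
      finally show ?case .
    qed
    show "((\<lambda>\<rho>. prob {\<omega>\<in>space M. ereal \<epsilon> < \<bar>?R \<rho> \<omega> / ereal (?a \<rho>) - ereal c\<bar>}) \<longlongrightarrow> 0) at_top"
      by (rule tendsto_sandwich[OF _ bound tendsto_const]) (use tendsto_add[OF up lo] in simp_all)
  qed
qed

theorem theorem1p1:
  fixes d :: nat
    and M :: "'w measure"
    and Y :: "real \<Rightarrow> nat \<Rightarrow> 'w \<Rightarrow> real ^ 'n"
    and S :: "real \<Rightarrow> nat \<Rightarrow> 'w \<Rightarrow> (real ^ 'n) \<times> real"
  assumes "d \<ge> 2" and "CARD('n) = d - 1"
    and "prob_space M"
    and "\<And>\<rho>. \<rho> > 0 \<Longrightarrow> cylinder_model M uniform_hemisphere \<rho> (Y \<rho>) (S \<rho>)"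
  shows "prob_space.tendsto_in_prob M
    (\<lambda>\<rho> \<omega>. coverage_radius (Y \<rho>) (S \<rho>) (cball 0 1) \<omega> / ereal ((ln \<rho> / \<rho>) powr (1 / (real d - 1))))
    ((real d ^ 2 / (real d - 1) * (unit_ball_vol (real d) / (2 * unit_ball_vol (real d - 1))) *
      (1 / (INF x \<in> (unit_cube :: (real ^ 'n) set) \<times> {0<..1}. phi x))) powr (1 / (real d - 1)))
    at_top"
proof -
  let ?n = "DIM(real ^ 'n)" and ?I = "phi_inf TYPE(real ^ 'n)"
  have n: "?n = d - 1" using assms(2) by simp
  then have d: "real d = real ?n + 1" using assms(1) by simp
  define A where "A = real d ^ 2 / (real d - 1) * (unit_ball_vol (real d) / (2 * unit_ball_vol (real d - 1))) * (1 / ?I)"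
  have I: "0 < ?I" by (rule phi_inf_pos)
  have npos: "0 < ?n" by (rule DIM_positive)
  have vol: "0 < unit_ball_vol (real ?n)" "0 < unit_ball_vol (real ?n + 1)" by simp_all
  have A: "A = (real ?n + 1) / real ?n / (cap_const ?n * ?I)"
    using I npos vol unfolding A_def d cap_const_def
    by (simp add: field_simps power2_eq_square)
  have Apos: "0 < A" using I npos cap_const_pos[of ?n] unfolding A by simp
  have "prob_space.tendsto_in_prob M
    (\<lambda>\<rho> \<omega>. coverage_radius (Y \<rho>) (S \<rho>) (cball 0 1) \<omega> / ereal (critical_scale ?n \<rho>)) (A powr (1 / real ?n)) at_top"
  proof (rule coverage_radius_tendsto_in_prob)
    show "uniform_cylinder_model M \<rho> (Y \<rho>) (S \<rho>)" if "0 < \<rho>" for \<rho>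
      using assms(4)[OF that] that by (simp add: uniform_cylinder_model_def uniform_cylinder_model_axioms_def)
    show "0 < A powr (1 / real ?n)" using Apos by simp
    show "(A powr (1 / real ?n)) ^ ?n * cap_const ?n * ?I = (real ?n + 1) / real ?n"
      unfolding powr_inverse_power[OF npos less_imp_le[OF Apos]] using I cap_const_pos[of ?n] by (simp add: A)
  qed
  moreover have "real ?n = real d - 1" using d by simp
  ultimately show ?thesis
    unfolding A_def phi_inf_def critical_scale_def by (simp only:)
qed

end
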